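(* Let $\varphi:\mathbb{R}^n\to\mathbb{R}^n$ be of class $C^1$, let $K\subset\mathbb{R}^n$ be compact and forward-invariant for the continuous-time system $\dot x(t)=\varphi[x(t)]$, $t\ge0$, $x(0)\in K$, and let $H_{\mathrm{res}}(\varphi,K)$ be its restoration entropy. Call a map $P:K\to\mathcal{S}^+$ admissible if it is continuous, its orbital derivative $\dot P(a)$ exists for every $a\in K$, and $\dot P$ is orbitally continuous. For admissible $P$ and $x\in K$ let $\varsigma_1^P(x),\ldots,\varsigma_n^P(x)\in\mathbb{R}$ be the roots $\lambda$, repeated according to multiplicity, of $$\det\bigl\{P(x)\mathbf{D}\varphi(x)+\mathbf{D}\varphi(x)^{\top}P(x)+\dot P(x)-\lambda P(x)\bigr\}=0.$$ Then: (i) For every admissible $P$, $$H_{\mathrm{res}}(\varphi,K)\le\frac{1}{2\ln2}\max_{x\in K}\sum_{i=1}^n\max\{0,\varsigma_i^P(x)\}.$$ (ii) Suppose in addition that $K$ is the closure of its interior. Then for every $\varepsilon>0$ there exists an admissible $P$ such that $$H_{\mathrm{res}}(\varphi,K)\ge\frac{1}{2\ln2}\max_{x\in K}\sum_{i=1}^n\max\{0,\varsigma_i^P(x)\}-\varepsilon.$$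
   Context: $\log$ is the logarithm to base $2$; $\ln$ is the natural logarithm. $\mathbf{D}\varphi(x)$ is the Jacobian matrix. $\mathcal{S}^+$ is the set of real symmetric positive definite $n\times n$ matrices. $x(t,a)$ is the solution of $\dot x=\varphi(x)$ with $x(0)=a$, and $\varphi^t: a\mapsto x(t,a)$ is the time-$t$ map. Forward-invariance of $K$ means that solutions starting in $K$ stay in $K$ for all $t\ge0$. Orbital derivative: $\dot P(a):=\lim_{\tau\to0+}\frac{P[x(\tau,a)]-P[a]}{\tau}$. Orbital continuity of $\dot P$ means that $t\mapsto\dot P[x(t,a)]$, $t\ge0$, is continuous for every $a\in K$. The roots $\varsigma_i^P(x)$ are the eigenvalues of the symmetric matrix $P(x)^{-1/2}\{P(x)\mathbf{D}\varphi(x)+\mathbf{D}\varphi(x)^\top P(x)+\dot P(x)\}P(x)^{-1/2}$, hence real. Here $\max_{x\in K}$ is read as the least upper bound over $K$ (in $[0,+\infty]$). Restoration entropy: for $\tau\ge0$, a point $a$ and $\delta>0$, let $N_{\varphi,K}(\tau,a,\delta)$ be the minimal number of open Euclidean $\delta$-balls needed to cover $\varphi^\tau[B_\delta(a)\cap K]$, where $B_\delta(a)$ is the open Euclidean $\delta$-ball around $a$. Then $$H_{\mathrm{res}}(\varphi,K):=\lim_{\tau\to\infty}\frac1\tau\limsup_{\delta\to0}\sup_{a\in K}\log N_{\varphi,K}(\tau,a,\delta),$$ where the limit in $\tau$ exists by subadditivity. *)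

theory Defs
  imports "HOL-Analysis.Analysis" "HOL-Computational_Algebra.Polynomial"
begin

definition class_C1 :: "(real^'n \<Rightarrow> real^'n) \<Rightarrow> bool" where
  "class_C1 \<phi> \<longleftrightarrow>
     (\<forall>x. \<phi> differentiable (at x)) \<and> continuous_on UNIV (\<lambda>x. jacobian \<phi> (at x))"

text \<open>At the end points of \<open>I\<close> the derivative is one-sided.\<close>

definition ode_solution_on ::
    "(real^'n \<Rightarrow> real^'n) \<Rightarrow> real set \<Rightarrow> (real \<Rightarrow> real^'n) \<Rightarrow> bool" where
  "ode_solution_on \<phi> I x \<longleftrightarrow>
     (\<forall>t\<in>I. (x has_vector_derivative \<phi> (x t)) (at t within I))"

text \<open>Existence of solutions for all \<open>t \<ge> 0\<close> is not part of the definition. For compact \<open>K\<close>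
  and \<open>\<phi>\<close> of class \<open>C\<^sup>1\<close> it is a consequence: a solution that is confined to a compact set
  extends to \<open>[0, \<infinity>)\<close>.\<close>

definition forward_invariant :: "(real^'n \<Rightarrow> real^'n) \<Rightarrow> (real^'n) set \<Rightarrow> bool" where
  "forward_invariant \<phi> K \<longleftrightarrow>
     (\<forall>a\<in>K. \<forall>T\<ge>0. \<forall>x. x 0 = a \<and> ode_solution_on \<phi> {0..T} x \<longrightarrow> (\<forall>t\<in>{0..T}. x t \<in> K))"

text \<open>\<open>flow \<phi> t a\<close> is \<open>x(t,a)\<close>, for \<open>t \<ge> 0\<close>; it is well defined whenever \<open>\<phi>\<close> is of class \<open>C\<^sup>1\<close>
  and the solution starting at \<open>a\<close> exists up to time \<open>t\<close>, in particular for \<open>a\<close> in a compact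
  forward-invariant set.\<close>

definition flow :: "(real^'n \<Rightarrow> real^'n) \<Rightarrow> real \<Rightarrow> real^'n \<Rightarrow> real^'n" where
  "flow \<phi> t a = (THE y. \<exists>x. x 0 = a \<and> ode_solution_on \<phi> {0..t} x \<and> y = x t)"

text \<open>The centres of the covering balls need not lie in \<open>K\<close>.\<close>

definition covering_number ::
    "(real^'n \<Rightarrow> real^'n) \<Rightarrow> (real^'n) set \<Rightarrow> real \<Rightarrow> real^'n \<Rightarrow> real \<Rightarrow> nat" where
  "covering_number \<phi> K \<tau> a \<delta> =
     (LEAST N. \<exists>C. finite C \<and> card C = N \<and> flow \<phi> \<tau> ` (ball a \<delta> \<inter> K) \<subseteq> (\<Union>c\<in>C. ball c \<delta>))"

text \<open>Suprema are taken in \<open>[0, \<infinity>]\<close>. No value is truncated by \<open>ennreal\<close>: for \<open>a \<in> K\<close> and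
  \<open>\<delta> > 0\<close> the covering number is at least 1, so its logarithm is nonnegative.\<close>

definition restoration_entropy :: "(real^'n \<Rightarrow> real^'n) \<Rightarrow> (real^'n) set \<Rightarrow> ennreal" where
  "restoration_entropy \<phi> K =
     Lim at_top (\<lambda>\<tau>::real. ennreal (1 / \<tau>) *
       Limsup (at_right 0) (\<lambda>\<delta>::real.
         SUP a\<in>K. ennreal (log 2 (real (covering_number \<phi> K \<tau> a \<delta>)))))"

definition sym_pos_def :: "(real^'n^'n) set" where
  "sym_pos_def = {A. transpose A = A \<and> (\<forall>v. v \<noteq> 0 \<longrightarrow> v \<bullet> (A *v v) > 0)}"

definition orbital_quotient ::
    "(real^'n \<Rightarrow> real^'n) \<Rightarrow> (real^'n \<Rightarrow> real^'n^'n) \<Rightarrow> real^'n \<Rightarrow> real \<Rightarrow> real^'n^'n" where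
  "orbital_quotient \<phi> P a \<tau> = (1 / \<tau>) *\<^sub>R (P (flow \<phi> \<tau> a) - P a)"

definition orbitally_differentiable_at ::
    "(real^'n \<Rightarrow> real^'n) \<Rightarrow> (real^'n \<Rightarrow> real^'n^'n) \<Rightarrow> real^'n \<Rightarrow> bool" where
  "orbitally_differentiable_at \<phi> P a \<longleftrightarrow>
     (\<exists>D. (orbital_quotient \<phi> P a \<longlongrightarrow> D) (at_right 0))"

definition orbital_deriv ::
    "(real^'n \<Rightarrow> real^'n) \<Rightarrow> (real^'n \<Rightarrow> real^'n^'n) \<Rightarrow> real^'n \<Rightarrow> real^'n^'n" where
  "orbital_deriv \<phi> P a = Lim (at_right 0) (orbital_quotient \<phi> P a)"

text \<open>A map \<open>K \<rightarrow> \<S>\<^sup>+\<close> is a total function of which only the values on \<open>K\<close> matter.\<close>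

definition admissible ::
    "(real^'n \<Rightarrow> real^'n) \<Rightarrow> (real^'n) set \<Rightarrow> (real^'n \<Rightarrow> real^'n^'n) \<Rightarrow> bool" where
  "admissible \<phi> K P \<longleftrightarrow>
     P ` K \<subseteq> sym_pos_def \<and>
     continuous_on K P \<and>
     (\<forall>a\<in>K. orbitally_differentiable_at \<phi> P a) \<and>
     (\<forall>a\<in>K. continuous_on {0..} (\<lambda>t. orbital_deriv \<phi> P (flow \<phi> t a)))"

text \<open>The determinant of \<open>A - \<lambda>B\<close> as a polynomial in \<open>\<lambda>\<close>.\<close>

definition pencil_poly :: "real^'n^'n \<Rightarrow> real^'n^'n \<Rightarrow> real poly" where
  "pencil_poly A B = det (\<chi> i j. [: A $ i $ j, - (B $ i $ j) :])"

lemma poly_pencil_poly: "poly (pencil_poly A B) l = det (A - l *\<^sub>R B)"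
proof -
  have "poly (of_int k) l = of_int k" for k :: int
    by (simp add: of_int_poly)
  then show ?thesis
    by (simp add: pencil_poly_def det_def poly_sum poly_prod)
qed

text \<open>The multiset of the \<open>\<varsigma>\<^sub>i\<^sup>P(x)\<close>, i.e. the roots repeated according to multiplicity. All
  complex roots are real because \<open>P x\<close> is positive definite and the other matrix is symmetric.\<close>

definition varsigma ::
    "(real^'n \<Rightarrow> real^'n) \<Rightarrow> (real^'n \<Rightarrow> real^'n^'n) \<Rightarrow> real^'n \<Rightarrow> real multiset" where
  "varsigma \<phi> P x = proots (pencil_poly
     (P x ** jacobian \<phi> (at x) + transpose (jacobian \<phi> (at x)) ** P x + orbital_deriv \<phi> P x)
     (P x))"

text \<open>The maximum over \<open>K\<close> is the least upper bound in \<open>[0, \<infinity>]\<close>; the orbital derivative, and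
  hence the roots, may be unbounded on \<open>K\<close>.\<close>

definition max_pos_root_sum ::
    "(real^'n \<Rightarrow> real^'n) \<Rightarrow> (real^'n) set \<Rightarrow> (real^'n \<Rightarrow> real^'n^'n) \<Rightarrow> ennreal" where
  "max_pos_root_sum \<phi> K P = (SUP x\<in>K. ennreal (\<Sum>s\<in>#varsigma \<phi> P x. max 0 s))"

end

theory Submission
  imports Defs
begin

text \<open>Let \<open>Z(t)\<close> solve the variational equation along the trajectory through \<open>a\<close>. The number of
  \<open>\<delta>\<close>-balls needed to cover the image of a small \<open>\<delta>\<close>-ball is, up to constants depending only on \<open>n\<close>,
  the square root of \<open>det (I + Z\<^sup>T Z)\<close>; so the entropy is the exponential growth rate of the supremum
  of this quantity over \<open>K\<close> (for the lower bound, one needs that \<open>K\<close> is the closure of its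
  interior).

  (i) Along a trajectory, \<open>Y = Z\<^sup>T P Z\<close> has the right derivative \<open>Z\<^sup>T Q Z\<close> with
  \<open>Q = P D\<phi> + D\<phi>\<^sup>T P + P'\<close>, and concavity of \<open>ln \<circ> det\<close> bounds the growth rate of
  \<open>ln (det (P(a) + Y))\<close> by the trace of \<open>(P(a) + Y)\<^sup>-\<^sup>1 Z\<^sup>T Q Z\<close>, which is at most the sum of the
  positive roots because \<open>Z (P(a) + Y)\<^sup>-\<^sup>1 Z\<^sup>T \<le> P\<^sup>-\<^sup>1\<close>.

  (ii) For large \<open>T\<close> the constant metric \<open>P = I\<close> has the right expansion over time \<open>T\<close>. Replacing
  \<open>P\<close> by the geometric mean of \<open>P\<close> and its pullback under the time \<open>T / 2\<close> map halves both the
  time step and the expansion over one step. After many bisections the time step \<open>h\<close> is so small that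
  the pullbacks of \<open>P\<close> over times in \<open>[0, h]\<close> are almost equal; their arithmetic mean is orbitally
  differentiable, and for it \<open>Q\<close> is the difference quotient of the pullback over the step \<open>h\<close>.\<close>

section \<open>Symmetric matrices and the Loewner order\<close>

text \<open>For a singular value s the factor sqrt (1 + s^2) replaces max {1, s}. This changes
  covering counts only by a constant depending on the dimension, but makes the whole product a
  determinant, to which concavity and the Loewner order apply. Such constants become additive after
  taking logarithms and disappear on division by the time; for the same reason P(a) may replace I on
  the compact set. In (i) the orbital derivative is one-sided and may be unbounded on K, so growth
  is controlled through right difference quotients alone. In (ii) it is the averaging that creates
  an orbital derivative. Averaging I directly over the long time T would lose a factor exp(2 L T),
  where L bounds the Jacobian. Bisection shortens the averaging time to h without spoiling the
  comparison behind this estimate: the bound of the pullback over time s from below by exp(-2 L s) P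
  survives every geometric mean, so the final loss is only exp(2 L h). Expansion over a step is
  measured by a common majorant of the metric and its pullback, since majorants pass through a
  monotone mean.\<close>

definition diagm :: "('n \<Rightarrow> real) \<Rightarrow> real^'n^'n" where
  "diagm d = (\<chi> i j. if i = j then d i else 0)"

definition pullback :: "real^'n^'m \<Rightarrow> real^'m^'m \<Rightarrow> real^'n^'n" where
  "pullback S A = transpose S ** A ** S"

text \<open>Only quadratic forms are compared, so the relation makes sense for every square matrix;
  it is antisymmetric on symmetric ones only.\<close>

definition loewner_le :: "real^'n^'n \<Rightarrow> real^'n^'n \<Rightarrow> bool"  (infix "\<preceq>" 50) where
  "A \<preceq> B \<longleftrightarrow> (\<forall>v. v \<bullet> (A *v v) \<le> v \<bullet> (B *v v))"

lemma inner_transpose_mult: "x \<bullet> (transpose A *v y) = (A *v x) \<bullet> y"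
  for A :: "real^'n^'m"
  by (metis dot_lmul_matrix inner_commute vector_transpose_matrix)

lemma inner_vector_matrix: "x \<bullet> (y v* A) = (A *v x) \<bullet> y"
  for A :: "real^'n^'m"
  by (metis dot_lmul_matrix inner_commute)

lemma inner_mult_symmetric: "transpose A = A \<Longrightarrow> x \<bullet> (A *v y) = (A *v x) \<bullet> y"
  for A :: "real^'n^'n"
  by (metis inner_transpose_mult)

lemma pullback_mult_vec: "pullback S A *v v = transpose S *v (A *v (S *v v))"
  by (simp only: pullback_def matrix_vector_mul_assoc matrix_mul_assoc)

lemma pullback_inner: "u \<bullet> (pullback S A *v v) = (S *v u) \<bullet> (A *v (S *v v))"
  by (simp only: pullback_mult_vec inner_transpose_mult)

lemma pullback_pullback: "pullback S (pullback T A) = pullback (T ** S) A"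
  by (simp add: pullback_def matrix_transpose_mul matrix_mul_assoc)

lemma pullback_mat_1 [simp]: "pullback (mat 1) A = A"
  by (simp add: pullback_def transpose_mat)

lemma transpose_pullback: "transpose A = A \<Longrightarrow> transpose (pullback S A) = pullback S A"
  by (simp add: pullback_def matrix_transpose_mul matrix_mul_assoc)

lemma pullback_mono: "A \<preceq> B \<Longrightarrow> pullback S A \<preceq> pullback S B"
  by (simp add: loewner_le_def pullback_inner)

lemma transpose_add: "transpose (A + B) = transpose A + transpose B"
  for A B :: "real^'n^'m"
  by (simp add: transpose_def vec_eq_iff)

lemma transpose_diff: "transpose (A - B) = transpose A - transpose B"
  for A B :: "real^'n^'m"
  by (simp add: transpose_def vec_eq_iff)

lemma matrix_scaleR_mult_left: "(c *\<^sub>R A) ** B = c *\<^sub>R (A ** B)" for A :: "real^'n^'m"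
  by (simp add: matrix_matrix_mult_def vec_eq_iff sum_distrib_left mult.assoc)

lemma matrix_scaleR_mult_right: "A ** (c *\<^sub>R B) = c *\<^sub>R (A ** B)" for A :: "real^'n^'m"
  by (simp add: matrix_matrix_mult_def vec_eq_iff sum_distrib_left mult.left_commute)

lemma matrix_add_rdistrib: "(A + B) ** C = A ** C + B ** C" for A :: "real^'n^'m"
  by (simp add: matrix_matrix_mult_def vec_eq_iff distrib_right sum.distrib)

lemma matrix_diff_ldistrib: "A ** (B - C) = A ** B - A ** C" for A :: "real^'n^'m"
  by (simp add: matrix_matrix_mult_def vec_eq_iff right_diff_distrib sum_subtractf)

lemma matrix_diff_rdistrib: "(A - B) ** C = A ** C - B ** C" for A :: "real^'n^'m"
  by (simp add: matrix_matrix_mult_def vec_eq_iff left_diff_distrib sum_subtractf)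

lemma pullback_add: "pullback S (A + B) = pullback S A + pullback S B"
  by (simp add: pullback_def matrix_add_ldistrib matrix_add_rdistrib)

lemma pullback_diff: "pullback S (A - B) = pullback S A - pullback S B"
  by (simp add: pullback_def matrix_diff_ldistrib matrix_diff_rdistrib)

lemma pullback_scaleR: "pullback S (c *\<^sub>R A) = c *\<^sub>R pullback S A"
  by (simp add: pullback_def matrix_scaleR_mult_left matrix_scaleR_mult_right)

lemma det_pullback: "det (pullback S A) = (det S)\<^sup>2 * det A" for S :: "real^'n^'n"
  by (simp add: pullback_def det_mul power2_eq_square)

lemma det_diagm: "det (diagm d) = (\<Prod>i\<in>UNIV. d i)"
  by (subst det_diagonal) (auto simp: diagm_def)

lemma diagm_mult_vec: "diagm d *v v = (\<chi> i. d i * v $ i)"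
  by (simp add: diagm_def matrix_vector_mult_def vec_eq_iff if_distrib[of "\<lambda>x. x * _"] cong: if_cong)

lemma transpose_diagm [simp]: "transpose (diagm d) = diagm d"
  by (auto simp: diagm_def transpose_def vec_eq_iff)

lemma diagm_mult_diagm: "diagm c ** diagm d = diagm (\<lambda>i. c i * d i)"
  by (simp add: matrix_eq diagm_mult_vec matrix_vector_mul_assoc[symmetric] vec_eq_iff)

lemma mat_eq_diagm: "mat c = diagm (\<lambda>_. c)"
  by (simp add: mat_def diagm_def)

lemma inner_diagm: "v \<bullet> (diagm d *v v) = (\<Sum>i\<in>UNIV. d i * (v $ i)\<^sup>2)"
  by (simp add: diagm_mult_vec inner_vec_def power2_eq_square mult_ac)

lemma trace_diagm: "trace (diagm d) = (\<Sum>i\<in>UNIV. d i)"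
  by (simp add: trace_def diagm_def)

section \<open>Spectral theorem and simultaneous diagonalisation\<close>

text \<open>The eigenvector is a maximiser \<open>v\<close> of the Rayleigh quotient on the unit
  sphere of \<open>S\<close>. Working inside an invariant subspace lets eigenvectors be split off
  one at a time.\<close>

lemma symmetric_eigenvector_in_subspace:
  fixes A :: "real^'n^'n"
  assumes A: "transpose A = A" and S: "subspace S" "\<And>x. x \<in> S \<Longrightarrow> A *v x \<in> S"
    and ne: "x0 \<in> S" "x0 \<noteq> 0"
  obtains v c where "v \<in> S" "norm v = 1" "A *v v = c *\<^sub>R v"
proof -
  define q where "q x = x \<bullet> (A *v x)" for x
  have cont: "continuous_on UNIV q"
    unfolding q_def by (intro continuous_intros linear_continuous_on) simp
  have "compact (sphere 0 1 \<inter> S)"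
    by (intro compact_Int_closed compact_sphere closed_subspace S)
  moreover have "x0 /\<^sub>R norm x0 \<in> sphere 0 1 \<inter> S"
    using ne S by (auto simp: subspace_scale)
  ultimately obtain v where v: "v \<in> sphere 0 1 \<inter> S" and max: "\<And>y. y \<in> sphere 0 1 \<inter> S \<Longrightarrow> q y \<le> q v"
    using continuous_attains_sup[of "sphere 0 1 \<inter> S" q] continuous_on_subset[OF cont] by blast
  have vv: "v \<bullet> v = 1" "v \<in> S" "norm v = 1" using v by (auto simp: norm_eq_1)
  have le: "q x \<le> q v * (x \<bullet> x)" if "x \<in> S" for x
  proof (cases "x = 0")
    case False
    have "q (x /\<^sub>R norm x) \<le> q v"
      using False that S by (intro max) (auto simp: subspace_scale)
    also have "q (x /\<^sub>R norm x) = q x / (x \<bullet> x)"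
      by (simp add: q_def matrix_vector_mult_scaleR dot_square_norm power2_eq_square field_simps)
    finally show ?thesis using False by (simp add: field_simps)
  qed (simp add: q_def)
  \<comment> \<open>\<open>w\<close> is the part of \<open>A *v v\<close> orthogonal to
    \<open>v\<close>; the goal is \<open>w = 0\<close>.\<close>
  define w where "w = A *v v - q v *\<^sub>R v"
  have w: "w \<in> S" "w \<bullet> v = 0"
    using S vv by (auto simp: w_def subspace_diff subspace_scale inner_diff q_def inner_commute algebra_simps)
  define b where "b = w \<bullet> (A *v v)"
  define M where "M = q v * (w \<bullet> w) - q w"
  \<comment> \<open>Maximality of \<open>v\<close> along the line \<open>v + t w\<close>. The linear
    term must vanish, since for small \<open>t\<close> of the sign of \<open>b\<close> it would beat
    the quadratic one; \<open>b\<close> divided by \<open>|M| + 1\<close> is such a value.\<close>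
  have t: "2 * t * b \<le> t\<^sup>2 * M" for t
  proof -
    have "v + t *\<^sub>R w \<in> S" using w vv S by (simp add: subspace_add subspace_scale)
    from le[OF this] have "q (v + t *\<^sub>R w) \<le> q v * (1 + t\<^sup>2 * (w \<bullet> w))"
      using w vv by (simp add: inner_add inner_commute power2_eq_square algebra_simps)
    moreover have "v \<bullet> (A *v w) = b"
      using inner_mult_symmetric[OF A, of v w] by (simp add: b_def inner_commute)
    then have "q (v + t *\<^sub>R w) = q v + 2 * t * b + t\<^sup>2 * q w"
      by (simp add: q_def b_def inner_add matrix_vector_right_distrib matrix_vector_mult_scaleR power2_eq_square
          inner_commute algebra_simps)
    ultimately show ?thesis by (simp add: M_def algebra_simps)
  qed
  have "b = 0"
  proof (rule ccontr)
    assume "b \<noteq> 0"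
    have "2 * (b / (\<bar>M\<bar> + 1)) * b \<le> (b / (\<bar>M\<bar> + 1))\<^sup>2 * M" by (rule t)
    also have "\<dots> \<le> (b / (\<bar>M\<bar> + 1))\<^sup>2 * (\<bar>M\<bar> + 1)" by (intro mult_left_mono) auto
    also have "\<dots> = (b / (\<bar>M\<bar> + 1)) * b" by (simp add: power2_eq_square)
    finally have "b / (\<bar>M\<bar> + 1) * b \<le> 0" by simp
    moreover have "b / (\<bar>M\<bar> + 1) * b > 0"
      using \<open>b \<noteq> 0\<close> by (simp add: zero_less_mult_iff zero_less_divide_iff add_nonneg_pos linorder_neq_iff disj_commute)
    ultimately show False by simp
  qed
  then have "w \<bullet> w = 0"
    using w by (simp add: b_def w_def inner_diff inner_commute)
  then have "A *v v = q v *\<^sub>R v" by (simp add: w_def)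
  with vv that show ?thesis by blast
qed

text \<open>Among orthonormal sets of eigenvectors, one of greatest cardinality must span: otherwise
  its orthogonal complement is a nonzero invariant subspace and contains a further
  eigenvector.\<close>

theorem symmetric_spectral:
  fixes A :: "real^'n^'n"
  assumes A: "transpose A = A"
  obtains S :: "real^'n^'n" and d where "transpose S ** S = mat 1" "pullback S A = diagm d"
proof -
  define \<B> where "\<B> = {B :: (real^'n) set. pairwise orthogonal B \<and> (\<forall>b\<in>B. norm b = 1 \<and> (\<exists>c. A *v b = c *\<^sub>R b))}"
  have ind: "independent B" if "B \<in> \<B>" for B
    using that by (intro pairwise_orthogonal_independent) (auto simp: \<B>_def)
  have bnd: "finite B \<and> card B \<le> CARD('n)" if "B \<in> \<B>" for B
    using independent_bound[OF ind[OF that]] by simp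
  have "{} \<in> \<B>" by (simp add: \<B>_def)
  then obtain B where B: "B \<in> \<B>" and max: "\<And>C. C \<in> \<B> \<Longrightarrow> card C \<le> card B"
    using ex_has_greatest_nat[of "\<lambda>B. B \<in> \<B>" "{}" card "CARD('n)+1"] bnd by force
  have orth: "\<And>b c. b \<in> B \<Longrightarrow> c \<in> B \<Longrightarrow> b \<noteq> c \<Longrightarrow> b \<bullet> c = 0" and nrm: "\<And>b. b \<in> B \<Longrightarrow> norm b = 1"
    and eig: "\<And>b. b \<in> B \<Longrightarrow> \<exists>c. A *v b = c *\<^sub>R b"
    using B by (auto simp: \<B>_def pairwise_def orthogonal_def)
  have span: "span B = UNIV"
  proof (rule ccontr)
    assume "span B \<noteq> UNIV"
    then obtain x where x: "x \<noteq> 0" "\<And>y. y \<in> span B \<Longrightarrow> orthogonal x y"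
      using orthogonal_to_subspace_exists_gen[of B UNIV] by (auto simp: psubset_eq)
    define S where "S = {x. \<forall>b\<in>B. x \<bullet> b = 0}"
    have sub: "subspace S" unfolding S_def subspace_def by (auto simp: inner_add)
    have inv: "A *v y \<in> S" if "y \<in> S" for y
      unfolding S_def
    proof (clarify)
      fix b assume b: "b \<in> B"
      with eig obtain c where c: "A *v b = c *\<^sub>R b" by blast
      have "(A *v y) \<bullet> b = y \<bullet> (A *v b)" using inner_mult_symmetric[OF A, of y b] by simp
      then show "(A *v y) \<bullet> b = 0" using that b by (simp add: c S_def)
    qed
    have "x \<in> S" using x by (auto simp: S_def orthogonal_def span_base)
    then obtain v c where v: "v \<in> S" "norm v = 1" "A *v v = c *\<^sub>R v"
      using symmetric_eigenvector_in_subspace[OF A sub inv] x by blast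
    have "v \<notin> B" using v by (auto simp: S_def)
    have "insert v B \<in> \<B>"
      using B v by (auto simp: \<B>_def S_def pairwise_insert orthogonal_def inner_commute)
    from max[OF this] show False using \<open>v \<notin> B\<close> bnd[OF B] by simp
  qed
  have "card B = CARD('n)"
    using dim_eq_card_independent[OF ind[OF B]] span by (metis dim_span dim_UNIV DIM_cart DIM_real mult.right_neutral)
  then obtain f where f: "bij_betw f (UNIV :: 'n set) B"
    using bnd[OF B] finite_same_card_bij[of "UNIV :: 'n set" B] by auto
  then have fB: "f i \<in> B" for i by (auto simp: bij_betw_def)
  have "\<forall>i. \<exists>c. A *v f i = c *\<^sub>R f i" using eig fB by blast
  then obtain d where d: "\<And>i. A *v f i = d i *\<^sub>R f i" by metis
  define S :: "real^'n^'n" where "S = (\<chi> i j. f j $ i)"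
  have inn: "f i \<bullet> f j = (if i = j then 1 else 0)" for i j
    using fB[of i] nrm[of "f i"] orth[OF fB fB, of i j] f inj_eq[of f i j] by (auto simp: bij_betw_def simp flip: norm_eq_1)
  have col: "S *v axis j 1 = f j" for j
    by (simp add: matrix_vector_mult_basis column_def S_def)
  have entry: "M $ i $ j = axis i 1 \<bullet> (M *v axis j 1)" for M :: "real^'n^'n" and i j
    by (simp add: matrix_vector_mult_basis column_def inner_axis')
  have "transpose S ** S = mat 1"
    by (simp add: vec_eq_iff entry[of "_ ** _"] matrix_vector_mul_assoc[symmetric] inner_vector_matrix col inn mat_def)
  moreover have "pullback S A = diagm d"
    by (simp add: vec_eq_iff entry[of "pullback _ _"] pullback_inner col d inn diagm_def)
  ultimately show ?thesis using that by blast
qed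

lemma sym_pos_def_symmetric: "A \<in> sym_pos_def \<Longrightarrow> transpose A = A"
  and sym_pos_def_pos: "A \<in> sym_pos_def \<Longrightarrow> v \<noteq> 0 \<Longrightarrow> 0 < v \<bullet> (A *v v)"
  by (auto simp: sym_pos_def_def)

lemma sym_pos_def_nonneg: "A \<in> sym_pos_def \<Longrightarrow> 0 \<le> v \<bullet> (A *v v)"
  by (cases "v = 0") (auto dest: sym_pos_def_pos intro: less_imp_le)

text \<open>\<open>P\<close> is normalised to the identity by rescaling its principal axes; a
  further rotation diagonalises \<open>Q\<close> and keeps the identity. Statements invariant under
  congruence thus reduce to diagonal matrices.\<close>

theorem simultaneous_diagonalization:
  fixes P Q :: "real^'n^'n"
  assumes P: "P \<in> sym_pos_def" and Q: "transpose Q = Q"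
  obtains S :: "real^'n^'n" and d where "pullback S P = mat 1" "pullback S Q = diagm d"
proof -
  obtain O1 :: "real^'n^'n" and p where O1: "transpose O1 ** O1 = mat 1" "pullback O1 P = diagm p"
    using symmetric_spectral[OF sym_pos_def_symmetric[OF P]] .
  have p: "p i > 0" for i
  proof -
    have "O1 *v axis i 1 \<noteq> 0"
    proof
      assume "O1 *v axis i 1 = 0"
      then have "(transpose O1 ** O1) *v axis i 1 = 0" by (simp add: matrix_vector_mul_assoc[symmetric])
      then show False by (simp add: O1 axis_eq_0_iff)
    qed
    then have "0 < axis i 1 \<bullet> (pullback O1 P *v axis i 1)"
      unfolding pullback_inner by (rule sym_pos_def_pos[OF P])
    then show ?thesis by (simp add: O1 diagm_mult_vec inner_axis')
  qed
  define R where "R = O1 ** diagm (\<lambda>i. 1 / sqrt (p i))"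
  have R: "pullback R P = mat 1"
  proof -
    have "pullback R P = pullback (diagm (\<lambda>i. 1 / sqrt (p i))) (diagm p)"
      by (simp add: R_def pullback_pullback[symmetric] O1)
    also have "\<dots> = mat 1"
      using p by (simp add: pullback_def diagm_mult_diagm mat_eq_diagm less_imp_le less_imp_neq[THEN not_sym])
    finally show ?thesis .
  qed
  obtain O2 :: "real^'n^'n" and d where O2: "transpose O2 ** O2 = mat 1" "pullback O2 (pullback R Q) = diagm d"
    using symmetric_spectral[OF transpose_pullback[OF Q]] .
  have "pullback (R ** O2) P = mat 1" "pullback (R ** O2) Q = diagm d"
    by (simp_all add: pullback_pullback[symmetric] R O2) (simp add: pullback_def O2)
  then show ?thesis by (rule that)
qed

lemma det_nonzero_inverse:
  fixes S :: "real^'n^'n"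
  assumes "det S \<noteq> 0"
  obtains N where "S ** N = mat 1" "N ** S = mat 1"
  using assms invertible_det_nz[of S] unfolding invertible_def by blast

lemma det_nonzero_mult_eq_0: "det S \<noteq> 0 \<Longrightarrow> S *v v = 0 \<Longrightarrow> v = 0" for S :: "real^'n^'n"
  by (metis det_nonzero_inverse matrix_vector_mul_assoc matrix_vector_mul_lid matrix_vector_mult_0_right)

lemma pullback_pos_def:
  assumes "A \<in> sym_pos_def" "det S \<noteq> 0"
  shows "pullback S A \<in> sym_pos_def"
  using assms det_nonzero_mult_eq_0[of S]
  by (auto simp: sym_pos_def_def transpose_pullback pullback_inner)

lemma mat_1_pos_def: "mat 1 \<in> sym_pos_def"
  by (simp add: sym_pos_def_def transpose_mat)

lemma loewner_le_refl [simp]: "A \<preceq> A"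
  and loewner_le_trans [trans]: "A \<preceq> B \<Longrightarrow> B \<preceq> C \<Longrightarrow> A \<preceq> C"
  by (auto simp: loewner_le_def intro: order_trans)

lemma pullback_eq_mat_1:
  fixes A S :: "real^'n^'n"
  assumes "pullback S A = mat 1"
  shows "(det S)\<^sup>2 * det A = 1" "det S \<noteq> 0"
  using arg_cong[OF assms, of det] by (auto simp: det_pullback)

lemma sym_pos_def_det_pos: "A \<in> sym_pos_def \<Longrightarrow> 0 < det A"
  by (metis simultaneous_diagonalization sym_pos_def_symmetric pullback_eq_mat_1 zero_less_power2 zero_less_mult_pos zero_less_one)

lemma diagm_axis_inner: "axis i 1 \<bullet> (diagm d *v axis i 1) = d i"
  by (simp add: diagm_mult_vec inner_axis')

text \<open>Where \<open>A\<close> is the identity, \<open>B\<close> is diagonal with entries at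
  least 1; congruence multiplies both determinants by the same positive square.\<close>

lemma det_mono:
  fixes A B :: "real^'n^'n"
  assumes A: "A \<in> sym_pos_def" and B: "transpose B = B" and AB: "A \<preceq> B"
  shows "det A \<le> det B"
proof -
  obtain S :: "real^'n^'n" and d where S: "pullback S A = mat 1" "pullback S B = diagm d"
    using simultaneous_diagonalization[OF A B] .
  have "1 \<le> d i" for i
    using pullback_mono[OF AB, of S, unfolded loewner_le_def, rule_format, of "axis i 1"]
    by (simp add: S diagm_axis_inner inner_axis_axis)
  then have "1 \<le> det (pullback S B)" by (simp add: S det_diagm prod_ge_1)
  also have "1 = det (pullback S A)" by (simp add: S)
  finally show ?thesis using pullback_eq_mat_1[OF S(1)] mult_le_cancel_left_pos[of "(det S)\<^sup>2" "det A" "det B"]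
    by (simp add: det_pullback)
qed

lemma det_scaleR: "det (c *\<^sub>R A) = c ^ CARD('n) * det A" for A :: "real^'n^'n"
proof -
  have "c *\<^sub>R A = diagm (\<lambda>_. c) ** A"
    by (simp add: matrix_eq matrix_vector_mul_assoc[symmetric] diagm_mult_vec
        scaleR_matrix_vector_assoc[symmetric] vec_eq_iff)
  then show ?thesis by (simp only: det_mul det_diagm prod_constant)
qed

lemma mat_1_plus_pos_def: "mat 1 + transpose M ** M \<in> sym_pos_def" for M :: "real^'n^'n"
proof -
  have eq: "mat 1 + transpose M ** M = mat 1 + pullback M (mat 1)" by (simp add: pullback_def)
  have "0 < v \<bullet> v + (M *v v) \<bullet> (M *v v)" if "v \<noteq> 0" for v
    using that inner_ge_zero[of "M *v v"] by (simp add: add_pos_nonneg)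
  then show ?thesis
    unfolding eq by (auto simp: sym_pos_def_def matrix_vector_mult_add_rdistrib inner_add_right
        pullback_inner transpose_add transpose_mat transpose_pullback)
qed

lemma trace_pullback_orthogonal:
  fixes S M :: "real^'n^'n"
  assumes "transpose S ** S = mat 1"
  shows "trace (pullback S M) = trace M"
proof -
  have "S ** transpose S = mat 1" using assms by (simp add: matrix_left_right_inverse)
  then show ?thesis
    by (simp add: pullback_def trace_mul_sym[of "transpose S ** M" S] matrix_mul_assoc)
qed

text \<open>Concavity of \<open>ln \<circ> det\<close>.\<close>

lemma det_add_le:
  fixes A H R :: "real^'n^'n"
  assumes R: "pullback R A = mat 1" and H: "transpose H = H" and nn: "0 \<preceq> A + H"
  shows "det (A + H) \<le> det A * exp (trace (pullback R H))"
proof -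
  obtain S :: "real^'n^'n" and m where S: "transpose S ** S = mat 1" "pullback S (pullback R H) = diagm m"
    using symmetric_spectral[OF transpose_pullback[OF H, of R]] .
  have "pullback S (pullback R A) = mat 1"
    by (simp add: R) (simp add: pullback_def S)
  then have eq: "pullback S (pullback R (A + H)) = diagm (\<lambda>i. 1 + m i)"
    unfolding pullback_add by (simp only: S mat_eq_diagm) (simp add: diagm_def vec_eq_iff)
  have "0 \<le> 1 + m i" for i
    using nn[unfolded loewner_le_def, rule_format, of "R *v (S *v axis i 1)"] diagm_axis_inner[of i "\<lambda>i. 1 + m i"]
    unfolding eq[symmetric] pullback_inner by simp
  \<comment> \<open>The factorwise bound \<open>1 + m i \<le> exp (m i)\<close> may be multiplied up
    because every \<open>1 + m i\<close> is nonnegative, which is what \<open>nn\<close>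
    provides.\<close>
  then have "(\<Prod>i\<in>UNIV. 1 + m i) \<le> (\<Prod>i\<in>UNIV. exp (m i))"
    by (intro prod_mono) (auto simp: exp_ge_add_one_self)
  also have "\<dots> = exp (trace (pullback R H))"
    using trace_pullback_orthogonal[OF S(1), of "pullback R H"] by (simp add: exp_sum[symmetric] S trace_diagm)
  finally have "det (pullback S (pullback R (A + H))) \<le> exp (trace (pullback R H))"
    by (simp only: eq det_diagm)
  moreover have "(det S)\<^sup>2 = 1" using arg_cong[OF S(1), of det] by (simp add: det_mul power2_eq_square)
  ultimately have le: "(det R)\<^sup>2 * det (A + H) \<le> exp (trace (pullback R H))"
    by (simp add: det_pullback)
  have R2: "(det R)\<^sup>2 * det A = 1" "det R \<noteq> 0" using pullback_eq_mat_1[OF R] by auto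
  then have "(det R)\<^sup>2 * det (A + H) \<le> (det R)\<^sup>2 * (det A * exp (trace (pullback R H)))"
    using le by (simp add: mult.assoc[symmetric])
  then show ?thesis using R2 by simp
qed

text \<open>The expanded product contains 1 and the single \<open>f x\<close> besides further
  nonnegative terms. It converts a determinant bound into a trace bound.\<close>

lemma one_plus_sum_le_prod:
  fixes f :: "'a \<Rightarrow> real"
  assumes "\<And>x. x \<in> A \<Longrightarrow> 0 \<le> f x"
  shows "1 + sum f A \<le> (\<Prod>x\<in>A. 1 + f x)"
  using assms
proof (induction A rule: infinite_finite_induct)
  case (insert x A)
  have "f x * 1 \<le> f x * (\<Prod>x\<in>A. 1 + f x)"
    using insert.prems by (intro mult_left_mono prod_ge_1) auto
  moreover have "1 + sum f A \<le> (\<Prod>x\<in>A. 1 + f x)"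
    using insert by auto
  ultimately show ?case using insert.hyps by (simp add: algebra_simps)
qed simp_all

section \<open>Positive roots of a matrix pencil\<close>

definition pos_root_sum :: "real^'n^'n \<Rightarrow> real^'n^'n \<Rightarrow> real" where
  "pos_root_sum Q P = (\<Sum>s\<in>#proots (pencil_poly Q P). max 0 s)"

text \<open>Congruence by \<open>S\<close> makes the pencil diagonal and multiplies its determinant
  by a nonzero constant, so roots and multiplicities are those of the product of the
  \<open>d i - l\<close>. The polynomials are identified through their values at all reals.\<close>

lemma proots_pencil_poly:
  fixes S P Q :: "real^'n^'n"
  assumes P: "pullback S P = mat 1" and Q: "pullback S Q = diagm d"
  shows "proots (pencil_poly Q P) = image_mset d (mset_set UNIV)"
proof -
  have S: "det S \<noteq> 0" using pullback_eq_mat_1[OF P] by simp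
  have "poly (pencil_poly Q P) l = poly (smult (1 / (det S)\<^sup>2) (\<Prod>i\<in>UNIV. [: d i, -1 :])) l" for l
  proof -
    have "(det S)\<^sup>2 * det (Q - l *\<^sub>R P) = det (pullback S (Q - l *\<^sub>R P))"
      by (simp add: det_pullback)
    also have "pullback S (Q - l *\<^sub>R P) = diagm (\<lambda>i. d i - l)"
      by (simp add: pullback_diff pullback_scaleR P Q) (simp add: diagm_def mat_def vec_eq_iff)
    finally show ?thesis using S by (simp add: poly_pencil_poly det_diagm poly_prod field_simps)
  qed
  then have "pencil_poly Q P = smult (1 / (det S)\<^sup>2) (\<Prod>i\<in>UNIV. [: d i, -1 :])"
    by (simp add: poly_eq_poly_eq_iff[symmetric] fun_eq_iff)
  moreover have "proots [: d i, -1 :] = {# d i #}" for i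
  proof -
    have "[: d i, -1 :] = - [: - d i, 1 :]" by simp
    then show ?thesis by (simp only: proots_uminus proots_linear_factor) simp
  qed
  ultimately show ?thesis
    using S by (simp add: proots_prod sum_unfold_sum_mset)
qed

lemma pos_root_sum_eq:
  fixes S P Q :: "real^'n^'n"
  assumes "pullback S P = mat 1" "pullback S Q = diagm d"
  shows "pos_root_sum Q P = (\<Sum>i\<in>UNIV. max 0 (d i))"
  by (simp add: pos_root_sum_def proots_pencil_poly[OF assms] image_mset.compositionality o_def sum_unfold_sum_mset)

text \<open>The trace is the sum of the \<open>d i\<close> weighted by the squared row norms of
  \<open>U\<close>, and a bound on \<open>U\<close> bounds its rows as well.\<close>

lemma trace_pullback_diagm_le:
  fixes U :: "real^'n^'n"
  assumes U: "\<And>w. (U *v w) \<bullet> (U *v w) \<le> \<beta> * (w \<bullet> w)"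
  shows "trace (pullback U (diagm d)) \<le> \<beta> * (\<Sum>i\<in>UNIV. max 0 (d i))"
proof -
  define r where "r i = U $ i \<bullet> U $ i" for i
  have row: "0 \<le> r i" "r i \<le> \<beta>" for i
  proof -
    show nn: "0 \<le> r i" by (simp add: r_def)
    \<comment> \<open>Entry \<open>i\<close> of \<open>U\<close> applied to its own row
      \<open>i\<close> is \<open>r i\<close>; the bound on \<open>U\<close> then gives
      \<open>r i * r i \<le> \<beta> * r i\<close>.\<close>
    have "(r i)\<^sup>2 = ((U *v (U $ i)) $ i)\<^sup>2" by (simp add: r_def matrix_vector_mul_component)
    also have "\<dots> \<le> (U *v (U $ i)) \<bullet> (U *v (U $ i))"
      unfolding inner_vec_def power2_eq_square inner_real_def by (rule member_le_sum) auto
    also have "\<dots> \<le> \<beta> * r i" unfolding r_def by (rule U)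
    finally have "r i * r i \<le> \<beta> * r i" by (simp add: power2_eq_square)
    moreover have "0 \<le> \<beta>"
      using U[of "axis i 1"] by (simp add: inner_axis_axis) (metis inner_ge_zero order_trans)
    ultimately show "r i \<le> \<beta>" using nn by (cases "r i = 0") auto
  qed
  have "trace (pullback U (diagm d)) = (\<Sum>j\<in>UNIV. \<Sum>i\<in>UNIV. d i * (U $ i $ j)\<^sup>2)"
  proof -
    have "pullback U (diagm d) $ j $ j = axis j 1 \<bullet> (pullback U (diagm d) *v axis j 1)" for j
      by (simp add: matrix_vector_mult_basis column_def inner_axis')
    then show ?thesis
      by (simp add: trace_def pullback_inner inner_diagm) (simp add: matrix_vector_mult_basis column_def)
  qed
  also have "\<dots> = (\<Sum>i\<in>UNIV. d i * r i)"
    by (subst sum.swap) (simp add: r_def inner_vec_def power2_eq_square sum_distrib_left)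
  also have "\<dots> \<le> (\<Sum>i\<in>UNIV. \<beta> * max 0 (d i))"
  proof (rule sum_mono)
    fix i
    have "d i * r i \<le> max 0 (d i) * r i" using row by (intro mult_right_mono) auto
    also have "\<dots> \<le> max 0 (d i) * \<beta>" using row by (intro mult_left_mono) auto
    finally show "d i * r i \<le> \<beta> * max 0 (d i)" by (simp add: mult_ac)
  qed
  finally show ?thesis by (simp add: sum_distrib_left)
qed

text \<open>In coordinates where \<open>P\<close> is the identity and \<open>Q\<close> diagonal, the
  hypothesis on \<open>T\<close> becomes a bound on the inverse of \<open>S\<close> times
  \<open>T\<close>; that inverse is \<open>transpose S ** P\<close>.\<close>

lemma trace_pullback_le_pos_root_sum:
  fixes P Q T :: "real^'n^'n"
  assumes P: "P \<in> sym_pos_def" and Q: "transpose Q = Q"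
    and T: "\<And>w. (T *v w) \<bullet> (P *v (T *v w)) \<le> \<beta> * (w \<bullet> w)"
  shows "trace (pullback T Q) \<le> \<beta> * pos_root_sum Q P"
proof -
  obtain S :: "real^'n^'n" and d where S: "pullback S P = mat 1" "pullback S Q = diagm d"
    using simultaneous_diagonalization[OF P Q] .
  have "transpose S ** P ** S = mat 1" using S by (simp add: pullback_def)
  then have "S ** (transpose S ** P) = mat 1" by (simp add: matrix_left_right_inverse)
  then have T_eq: "T = S ** (transpose S ** P ** T)" (is "_ = S ** ?U")
    by (simp add: matrix_mul_assoc)
  have "(?U *v w) \<bullet> (?U *v w) \<le> \<beta> * (w \<bullet> w)" for w
  proof -
    have "(?U *v w) \<bullet> (?U *v w) = w \<bullet> (pullback ?U (pullback S P) *v w)"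
      by (simp add: S pullback_inner)
    also have "\<dots> = (T *v w) \<bullet> (P *v (T *v w))"
      by (simp only: pullback_pullback T_eq[symmetric] pullback_inner)
    also have "\<dots> \<le> \<beta> * (w \<bullet> w)" by (rule T)
    finally show ?thesis .
  qed
  then have "trace (pullback ?U (diagm d)) \<le> \<beta> * (\<Sum>i\<in>UNIV. max 0 (d i))"
    by (rule trace_pullback_diagm_le)
  then show ?thesis
    unfolding pos_root_sum_eq[OF S] S(2)[symmetric] pullback_pullback T_eq[symmetric] .
qed

text \<open>\<open>N\<close> dominates both 0 and \<open>h *\<^sub>R Q\<close>, so in coordinates
  diagonalising \<open>P\<close> and \<open>Q\<close> its diagonal dominates the positive parts of
  \<open>h * d i\<close>. Its trace relative to \<open>P\<close> is at most \<open>\<beta>\<close>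
  times the one relative to \<open>P'\<close>, which the determinant bound limits to
  \<open>r - 1\<close>. In the application \<open>P\<close> is an average of pullbacks of
  \<open>P'\<close>.\<close>

lemma pos_root_sum_le:
  fixes P P' Q N :: "real^'n^'n"
  assumes P: "P \<in> sym_pos_def" and P': "P' \<in> sym_pos_def" and PP': "P' \<preceq> \<beta> *\<^sub>R P"
    and Q: "transpose Q = Q" and N: "transpose N = N" "0 \<preceq> N" and h: "h > 0" "h *\<^sub>R Q \<preceq> N"
    and det: "det (P' + N) \<le> r * det P'"
  shows "h * pos_root_sum Q P \<le> \<beta> * (r - 1)"
proof -
  obtain S :: "real^'n^'n" and d where S: "pullback S P = mat 1" "pullback S Q = diagm d"
    using simultaneous_diagonalization[OF P Q] .
  have "h * max 0 (d i) \<le> pullback S N $ i $ i" for i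
  proof -
    have e: "pullback S N $ i $ i = axis i 1 \<bullet> (pullback S N *v axis i 1)"
      by (simp add: matrix_vector_mult_basis column_def inner_axis')
    have "0 \<le> pullback S N $ i $ i"
      using N(2) unfolding e pullback_inner by (simp add: loewner_le_def)
    moreover have "h * d i \<le> pullback S N $ i $ i"
      using pullback_mono[OF h(2), of S, unfolded loewner_le_def, rule_format, of "axis i 1"]
      by (simp add: e pullback_scaleR S diagm_axis_inner scaleR_matrix_vector_assoc[symmetric])
    ultimately show ?thesis by (simp add: max_def)
  qed
  then have "h * pos_root_sum Q P \<le> trace (pullback S N)"
    unfolding pos_root_sum_eq[OF S] sum_distrib_left trace_def by (intro sum_mono) auto
  also have "\<dots> \<le> \<beta> * pos_root_sum N P'"
  proof (rule trace_pullback_le_pos_root_sum[OF P' N(1)])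
    fix w
    have "w \<bullet> (pullback S P' *v w) \<le> w \<bullet> (pullback S (\<beta> *\<^sub>R P) *v w)"
      using pullback_mono[OF PP', of S] by (simp add: loewner_le_def)
    then show "(S *v w) \<bullet> (P' *v (S *v w)) \<le> \<beta> * (w \<bullet> w)"
      by (simp add: pullback_scaleR S) (simp add: pullback_inner scaleR_matrix_vector_assoc[symmetric])
  qed
  also have "\<dots> \<le> \<beta> * (r - 1)"
  proof (rule mult_left_mono)
    obtain R :: "real^'n^'n" and m where R: "pullback R P' = mat 1" "pullback R N = diagm m"
      using simultaneous_diagonalization[OF P' N(1)] .
    have m: "0 \<le> m i" for i
      using N(2)[unfolded loewner_le_def, rule_format, of "R *v axis i 1"] diagm_axis_inner[of i m]
      unfolding R(2)[symmetric] pullback_inner by simp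
    have "1 + (\<Sum>i\<in>UNIV. m i) \<le> (\<Prod>i\<in>UNIV. 1 + m i)"
      using m by (intro one_plus_sum_le_prod) auto
    also have "\<dots> = det (pullback R (P' + N))"
      by (simp add: pullback_add R mat_eq_diagm det_diagm[symmetric]) (rule arg_cong[where f=det], simp add: diagm_def vec_eq_iff)
    also have "\<dots> \<le> r"
      using pullback_eq_mat_1[OF R(1)] mult_left_mono[OF det, of "(det R)\<^sup>2"]
      by (simp add: det_pullback mult_ac)
    finally show "pos_root_sum N P' \<le> r - 1"
      using m by (simp add: pos_root_sum_eq[OF R] max_def)
    \<comment> \<open>Any coordinate vector will do: positivity of both forms on it forces
      \<open>\<beta>\<close> to be positive.\<close>
    obtain i :: 'n where True by simp
    have pos: "0 < axis i 1 \<bullet> (P *v axis i 1)" "0 < axis i 1 \<bullet> (P' *v axis i 1)"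
      using sym_pos_def_pos[OF P, of "axis i 1"] sym_pos_def_pos[OF P', of "axis i 1"] by (auto simp: axis_eq_0_iff)
    have "axis i 1 \<bullet> (P' *v axis i 1) \<le> \<beta> * (axis i 1 \<bullet> (P *v axis i 1))"
      using PP' unfolding loewner_le_def by (simp add: scaleR_matrix_vector_assoc[symmetric])
    then have "0 < \<beta> * (axis i 1 \<bullet> (P *v axis i 1))" using pos by linarith
    then show "0 \<le> \<beta>" using pos by (simp add: zero_less_mult_iff)
  qed
  finally show ?thesis .
qed

section \<open>The geometric mean of positive definite matrices\<close>

lemma loewner_le_antisym:
  fixes A B :: "real^'a^'a"
  assumes "transpose A = A" "transpose B = B" "A \<preceq> B" "B \<preceq> A"
  shows "A = B"
proof -
  have quad: "v \<bullet> (A *v v) = v \<bullet> (B *v v)" for v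
    using assms(3,4) unfolding loewner_le_def by (metis order_antisym)
  have polar: "2 * (u \<bullet> (M *v v)) = (u + v) \<bullet> (M *v (u + v)) - u \<bullet> (M *v u) - v \<bullet> (M *v v)"
    if "transpose M = M" for M :: "real^'a^'a" and u v
  proof -
    have "v \<bullet> (M *v u) = u \<bullet> (M *v v)"
      using inner_mult_symmetric[OF that, of v u] by (metis inner_commute)
    then show ?thesis by (simp add: matrix_vector_right_distrib inner_add_left inner_add_right)
  qed
  have "u \<bullet> (A *v v) = u \<bullet> (B *v v)" for u v
    using polar[OF assms(1), of u v] polar[OF assms(2), of u v] quad[of u] quad[of v] quad[of "u + v"] by linarith
  then have "A *v v = B *v v" for v using vector_eq_ldot by blast
  then show ?thesis by (simp add: matrix_eq)
qed

text \<open>This is operator monotonicity of the square root. If \<open>v\<close> were an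
  eigenvector of \<open>Y - X\<close> with eigenvalue \<open>m < 0\<close>, then
  \<open>|Y v|^2 - |X v|^2 = m (v . X v + v . Y v) < 0\<close>, against the hypothesis.\<close>

lemma square_mono_imp_mono:
  fixes X Y :: "real^'n^'n"
  assumes X: "X \<in> sym_pos_def" and Y: "Y \<in> sym_pos_def" and le: "X ** X \<preceq> Y ** Y"
  shows "X \<preceq> Y"
proof -
  have sym: "transpose X = X" "transpose Y = Y" using X Y by (auto simp: sym_pos_def_symmetric)
  obtain S :: "real^'n^'n" and m where S: "transpose S ** S = mat 1" "pullback S (Y - X) = diagm m"
    using symmetric_spectral[of "Y - X"] by (auto simp: transpose_diff sym)
  have S': "S ** transpose S = mat 1" using S(1) by (simp add: matrix_left_right_inverse)
  have m: "0 \<le> m i" for i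
  proof (rule ccontr)
    assume neg: "\<not> 0 \<le> m i"
    define v where "v = S *v axis i 1"
    have vv: "v \<bullet> v = 1"
      using inner_transpose_mult[of "axis i 1" S "S *v axis i 1"]
      by (simp only: v_def matrix_vector_mul_assoc S matrix_vector_mul_lid inner_axis_axis) simp
    have "(Y - X) *v v = (S ** transpose S) *v ((Y - X) *v v)" by (simp add: S')
    also have "\<dots> = S *v (pullback S (Y - X) *v axis i 1)"
      by (simp only: v_def pullback_mult_vec matrix_vector_mul_assoc matrix_mul_assoc)
    also have "pullback S (Y - X) *v axis i 1 = m i *\<^sub>R axis i 1"
      by (auto simp: S diagm_mult_vec vec_eq_iff axis_def)
    finally have Yv: "Y *v v = X *v v + m i *\<^sub>R v"
      by (simp add: v_def matrix_vector_mult_scaleR matrix_vector_mult_diff_rdistrib algebra_simps)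
    have "v \<bullet> (X ** X *v v) \<le> v \<bullet> (Y ** Y *v v)" using le by (simp add: loewner_le_def)
    then have "(X *v v) \<bullet> (X *v v) \<le> (Y *v v) \<bullet> (Y *v v)"
      by (simp add: matrix_vector_mul_assoc[symmetric] inner_mult_symmetric sym)
    also have "\<dots> = (X *v v) \<bullet> (X *v v) + m i * (v \<bullet> (X *v v) + v \<bullet> (Y *v v))"
      by (simp add: Yv inner_add inner_commute algebra_simps)
    finally have "0 \<le> m i * (v \<bullet> (X *v v) + v \<bullet> (Y *v v))" by simp
    moreover have "0 < v \<bullet> (X *v v) + v \<bullet> (Y *v v)"
      using vv sym_pos_def_pos[OF X, of v] sym_pos_def_pos[OF Y, of v] by (cases "v = 0") auto
    ultimately show False using neg by (simp add: zero_le_mult_iff)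
  qed
  show ?thesis
    unfolding loewner_le_def
  proof
    fix v
    have "v \<bullet> ((Y - X) *v v) = (transpose S *v v) \<bullet> (pullback S (Y - X) *v (transpose S *v v))"
    proof -
      have "S *v (transpose S *v v) = v" by (simp only: matrix_vector_mul_assoc S' matrix_vector_mul_lid)
      then show ?thesis by (simp only: pullback_inner)
    qed
    also have "\<dots> \<ge> 0" using m by (simp add: S inner_diagm sum_nonneg)
    finally show "v \<bullet> (X *v v) \<le> v \<bullet> (Y *v v)"
      by (simp add: matrix_vector_mult_diff_rdistrib inner_diff)
  qed
qed

text \<open>\<open>X\<close> is the geometric mean of \<open>A\<close> and \<open>B\<close> iff it solves the Riccati equation
  \<open>X A\<^sup>-\<^sup>1 X = B\<close>; here \<open>G\<close> is the inverse of \<open>A\<close>.\<close>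

definition is_gmean :: "real^'n^'n \<Rightarrow> real^'n^'n \<Rightarrow> real^'n^'n \<Rightarrow> bool" where
  "is_gmean A B X \<longleftrightarrow> A \<in> sym_pos_def \<and> B \<in> sym_pos_def \<and> X \<in> sym_pos_def \<and>
     (\<exists>G. A ** G = mat 1 \<and> X ** G ** X = B)"

definition gmean :: "real^'n^'n \<Rightarrow> real^'n^'n \<Rightarrow> real^'n^'n" where
  "gmean A B = (THE X. is_gmean A B X)"

text \<open>With \<open>N\<close> the inverse of \<open>M\<close>, the inverse \<open>G\<close> of
  \<open>A\<close> turns into \<open>N ** G ** transpose N\<close>, so the Riccati equation is
  covariant under congruence. This is why the mean of two metrics can be formed before or after
  transport by the flow.\<close>

lemma is_gmean_pullback:
  fixes M :: "real^'n^'n"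
  assumes "is_gmean A B X" and M: "det M \<noteq> 0"
  shows "is_gmean (pullback M A) (pullback M B) (pullback M X)"
proof -
  obtain G where G: "A ** G = mat 1" "X ** G ** X = B"
    and pd: "A \<in> sym_pos_def" "B \<in> sym_pos_def" "X \<in> sym_pos_def"
    using assms by (auto simp: is_gmean_def)
  obtain N where N: "M ** N = mat 1" "N ** M = mat 1" using det_nonzero_inverse[OF M] .
  have NT: "transpose N ** transpose M = mat 1" "transpose M ** transpose N = mat 1"
    by (simp_all add: matrix_transpose_mul[symmetric] N transpose_mat)
  let ?G = "N ** G ** transpose N"
  have "pullback M A ** ?G = transpose M ** (A ** ((M ** N) ** G)) ** transpose N"
    by (simp only: pullback_def matrix_mul_assoc)
  also have "\<dots> = mat 1" by (simp add: N G NT)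
  finally have 1: "pullback M A ** ?G = mat 1" .
  have "pullback M X ** ?G ** pullback M X
      = transpose M ** (X ** ((M ** N) ** (G ** ((transpose N ** transpose M) ** X)))) ** M"
    by (simp only: pullback_def matrix_mul_assoc)
  also have "\<dots> = pullback M B" by (simp add: N NT G(2)[symmetric] pullback_def matrix_mul_assoc)
  finally show ?thesis unfolding is_gmean_def using 1 pd M by (blast intro: pullback_pos_def)
qed

lemma is_gmean_mat_1: "is_gmean (mat 1) B X \<Longrightarrow> X ** X = B"
  by (auto simp: is_gmean_def)

lemma pullback_inverse_mono:
  fixes S :: "real^'n^'n"
  assumes "det S \<noteq> 0" "pullback S A \<preceq> pullback S B"
  shows "A \<preceq> B"
proof -
  obtain N where N: "S ** N = mat 1" using det_nonzero_inverse[OF assms(1)] .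
  show ?thesis using pullback_mono[OF assms(2), of N] by (simp add: pullback_pullback N)
qed

text \<open>Congruence reduces to \<open>A = mat 1\<close>, where the mean is the square root of the
  second argument. Uniqueness is the case of equal second arguments.\<close>

lemma is_gmean_mono:
  fixes A B B' X Y :: "real^'n^'n"
  assumes X: "is_gmean A B X" and Y: "is_gmean A B' Y" and le: "B \<preceq> B'"
  shows "X \<preceq> Y"
proof -
  have A: "A \<in> sym_pos_def" using X by (simp add: is_gmean_def)
  obtain S :: "real^'n^'n" and d where "pullback S A = mat 1" "pullback S A = diagm d"
    using simultaneous_diagonalization[OF A sym_pos_def_symmetric[OF A]] .
  then have S: "pullback S A = mat 1" "det S \<noteq> 0" using pullback_eq_mat_1 by auto
  from is_gmean_pullback[OF X S(2)] is_gmean_pullback[OF Y S(2)]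
  have g: "is_gmean (mat 1) (pullback S B) (pullback S X)" "is_gmean (mat 1) (pullback S B') (pullback S Y)"
    by (simp_all only: S)
  have "pullback S X \<preceq> pullback S Y"
  proof (rule square_mono_imp_mono)
    show "pullback S X \<in> sym_pos_def" "pullback S Y \<in> sym_pos_def" using g by (simp_all only: is_gmean_def)
    show "pullback S X ** pullback S X \<preceq> pullback S Y ** pullback S Y"
      unfolding is_gmean_mat_1[OF g(1)] is_gmean_mat_1[OF g(2)] by (rule pullback_mono[OF le])
  qed
  then show ?thesis by (rule pullback_inverse_mono[OF S(2)])
qed

lemma is_gmean_unique: "is_gmean A B X \<Longrightarrow> is_gmean A B Y \<Longrightarrow> X = Y"
  using is_gmean_mono[of A B X B Y] is_gmean_mono[of A B Y B X]
  by (auto simp: is_gmean_def sym_pos_def_symmetric intro: loewner_le_antisym)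

text \<open>For a pair diagonalised together the mean is the diagonal matrix of square roots,
  carried back by the inverse congruence.\<close>

lemma is_gmean_exists:
  fixes A B :: "real^'n^'n"
  assumes A: "A \<in> sym_pos_def" and B: "B \<in> sym_pos_def"
  shows "\<exists>X. is_gmean A B X"
proof -
  obtain S :: "real^'n^'n" and d where S: "pullback S A = mat 1" "pullback S B = diagm d"
    using simultaneous_diagonalization[OF A sym_pos_def_symmetric[OF B]] .
  have detS: "det S \<noteq> 0" using pullback_eq_mat_1[OF S(1)] by simp
  have d: "0 < d i" for i
    using sym_pos_def_pos[OF pullback_pos_def[OF B detS], of "axis i 1"]
    by (simp add: S diagm_axis_inner axis_eq_0_iff)
  have pd: "diagm c \<in> sym_pos_def" if "\<And>i. 0 < c i" for c :: "'n \<Rightarrow> real"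
    unfolding sym_pos_def_def
  proof (clarsimp simp: inner_diagm)
    fix v :: "real^'n" assume "v \<noteq> 0"
    then obtain i where "v $ i \<noteq> 0" by (auto simp: vec_eq_iff)
    then show "0 < (\<Sum>i\<in>UNIV. c i * (v $ i)\<^sup>2)"
      using that by (intro sum_pos2[of UNIV i]) (auto simp: less_imp_le)
  qed
  have G: "is_gmean (mat 1) (diagm d) (diagm (\<lambda>i. sqrt (d i)))"
    unfolding is_gmean_def using d
    by (auto intro!: pd mat_1_pos_def exI[of _ "mat 1"] simp: diagm_mult_diagm less_imp_le)
  obtain N where N: "S ** N = mat 1" "N ** S = mat 1" using det_nonzero_inverse[OF detS] .
  have "det N \<noteq> 0" using arg_cong[OF N(1), of det] by (auto simp: det_mul)
  from is_gmean_pullback[OF G this]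
  have "is_gmean A B (pullback N (diagm (\<lambda>i. sqrt (d i))))"
    using pullback_pullback[of N S A] pullback_pullback[of N S B] by (simp add: S N)
  then show ?thesis ..
qed

lemma is_gmean_gmean: "A \<in> sym_pos_def \<Longrightarrow> B \<in> sym_pos_def \<Longrightarrow> is_gmean A B (gmean A B)"
  unfolding gmean_def using is_gmean_exists is_gmean_unique by (metis theI)

lemma gmean_eqI: "is_gmean A B X \<Longrightarrow> gmean A B = X"
  by (metis is_gmean_gmean is_gmean_unique is_gmean_def)

lemma gmean_pos_def: "A \<in> sym_pos_def \<Longrightarrow> B \<in> sym_pos_def \<Longrightarrow> gmean A B \<in> sym_pos_def"
  using is_gmean_gmean is_gmean_def by blast

lemma gmean_pullback:
  "A \<in> sym_pos_def \<Longrightarrow> B \<in> sym_pos_def \<Longrightarrow> det M \<noteq> 0 \<Longrightarrow>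
    gmean (pullback M A) (pullback M B) = pullback M (gmean A B)"
  by (intro gmean_eqI is_gmean_pullback is_gmean_gmean)

text \<open>With \<open>Y\<close> the inverse of \<open>X\<close>, inverting
  \<open>X ** G ** X = B\<close> shows that \<open>Y ** A ** Y\<close> is the inverse of
  \<open>B\<close>; multiplying it by \<open>X\<close> on both sides gives back
  \<open>A\<close>.\<close>

lemma gmean_commute:
  fixes A B :: "real^'n^'n"
  assumes A: "A \<in> sym_pos_def" and B: "B \<in> sym_pos_def"
  shows "gmean A B = gmean B A"
proof (rule sym, rule gmean_eqI)
  define X where "X = gmean A B"
  obtain G where G: "A ** G = mat 1" "X ** G ** X = B" and X: "X \<in> sym_pos_def"
    using is_gmean_gmean[OF A B] unfolding X_def[symmetric] by (auto simp: is_gmean_def)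
  then have GA: "G ** A = mat 1" by (simp add: matrix_left_right_inverse)
  have "det X \<noteq> 0" using sym_pos_def_det_pos[OF X] by simp
  then obtain Y where Y: "X ** Y = mat 1" "Y ** X = mat 1" by (rule det_nonzero_inverse)
  have "B ** (Y ** A ** Y) = X ** (G ** ((X ** Y) ** A)) ** Y"
    by (simp only: G(2)[symmetric] matrix_mul_assoc)
  also have "\<dots> = mat 1" by (simp add: Y GA)
  finally have 1: "B ** (Y ** A ** Y) = mat 1" .
  have "X ** (Y ** A ** Y) ** X = (X ** Y) ** A ** (Y ** X)" by (simp only: matrix_mul_assoc)
  also have "\<dots> = A" by (simp add: Y)
  finally show "is_gmean B A (gmean A B)" unfolding X_def[symmetric] is_gmean_def using A B X 1 by blast
qed

lemma gmean_mono:
  assumes "A \<in> sym_pos_def" "B \<in> sym_pos_def" "A' \<in> sym_pos_def" "B' \<in> sym_pos_def"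
    and "A \<preceq> A'" "B \<preceq> B'"
  shows "gmean A B \<preceq> gmean A' B'"
proof -
  have "gmean A B \<preceq> gmean A B'"
    using assms by (intro is_gmean_mono[OF is_gmean_gmean is_gmean_gmean]) auto
  moreover have "gmean B' A \<preceq> gmean B' A'"
    using assms by (intro is_gmean_mono[OF is_gmean_gmean is_gmean_gmean]) auto
  ultimately show ?thesis
    using assms by (metis gmean_commute loewner_le_trans)
qed

lemma gmean_det:
  fixes A B :: "real^'n^'n"
  assumes A: "A \<in> sym_pos_def" and B: "B \<in> sym_pos_def"
  shows "(det (gmean A B))\<^sup>2 = det A * det B"
proof -
  obtain G where G: "A ** G = mat 1" "gmean A B ** G ** gmean A B = B"
    using is_gmean_gmean[OF A B] by (auto simp: is_gmean_def)
  have "det A * det G = 1" using arg_cong[OF G(1), of det] by (simp add: det_mul)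
  moreover have "det B = det (gmean A B) * det G * det (gmean A B)"
    using arg_cong[OF G(2), of det] by (simp add: det_mul)
  ultimately show ?thesis by (simp add: power2_eq_square mult_ac)
qed

lemma sym_pos_def_scaleR: "A \<in> sym_pos_def \<Longrightarrow> 0 < c \<Longrightarrow> c *\<^sub>R A \<in> sym_pos_def"
  by (auto simp: sym_pos_def_def transpose_scalar scaleR_matrix_vector_assoc[symmetric])

text \<open>Scaling by \<open>c\<close> is congruence by \<open>sqrt c\<close> times the
  identity.\<close>

lemma gmean_scaleR:
  fixes A B :: "real^'n^'n"
  assumes A: "A \<in> sym_pos_def" and B: "B \<in> sym_pos_def" and c: "0 < c"
  shows "gmean (c *\<^sub>R A) (c *\<^sub>R B) = c *\<^sub>R gmean A B"
proof -
  have pb: "pullback (sqrt c *\<^sub>R mat 1) M = c *\<^sub>R M" for M :: "real^'n^'n"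
    using c by (simp add: pullback_def matrix_scaleR_mult_left matrix_scaleR_mult_right transpose_scalar transpose_mat)
  have "det (sqrt c *\<^sub>R (mat 1 :: real^'n^'n)) \<noteq> 0"
  proof -
    have "det (sqrt c *\<^sub>R (mat 1 :: real^'n^'n)) * det ((1 / sqrt c) *\<^sub>R (mat 1 :: real^'n^'n)) = 1"
      using c by (simp add: det_mul[symmetric] matrix_scaleR_mult_left matrix_scaleR_mult_right)
    then show ?thesis by auto
  qed
  from gmean_pullback[OF A B this] show ?thesis by (simp add: pb)
qed

section \<open>Matrix norms and continuity of matrix operations\<close>

lemma norm_matrix_squared: "(norm A)\<^sup>2 = (\<Sum>i\<in>UNIV. \<Sum>j\<in>UNIV. (A $ i $ j)\<^sup>2)" for A :: "real^'n^'m"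
  unfolding power2_norm_eq_inner inner_vec_def by (simp add: power2_eq_square)

lemma norm_transpose: "norm (transpose A) = norm A" for A :: "real^'n^'m"
proof -
  have "(norm (transpose A))\<^sup>2 = (norm A)\<^sup>2"
    unfolding norm_matrix_squared by (simp add: transpose_def) (rule sum.swap)
  then show ?thesis by simp
qed

lemma norm_matrix_vector_mult_le: "norm (A *v x) \<le> norm A * norm x" for A :: "real^'n^'m"
proof -
  have "norm (A *v x) = L2_set (\<lambda>i. norm ((A *v x) $ i)) UNIV" by (rule norm_vec_def)
  also have "\<dots> \<le> L2_set (\<lambda>i. norm (A $ i) * norm x) UNIV"
    by (intro L2_set_mono) (auto simp: matrix_vector_mul_component Cauchy_Schwarz_ineq2)
  also have "\<dots> = norm A * norm x" by (simp add: L2_set_left_distrib norm_vec_def)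
  finally show ?thesis .
qed

lemma norm_matrix_mult_le: "norm (A ** B) \<le> norm A * norm B" for A :: "real^'n^'m" and B :: "real^'k^'n"
proof -
  have row: "(A ** B) $ i = transpose B *v (A $ i)" for i
    by (simp add: vec_eq_iff matrix_matrix_mult_def matrix_vector_mult_def transpose_def mult.commute)
  have "norm (A ** B) = L2_set (\<lambda>i. norm ((A ** B) $ i)) UNIV" by (rule norm_vec_def)
  also have "\<dots> \<le> L2_set (\<lambda>i. norm (A $ i) * norm B) UNIV"
  proof (rule L2_set_mono)
    fix i show "norm ((A ** B) $ i) \<le> norm (A $ i) * norm B"
      using norm_matrix_vector_mult_le[of "transpose B" "A $ i"] unfolding row[symmetric] norm_transpose
      by (simp add: mult.commute)
  qed simp
  also have "\<dots> = norm A * norm B" by (simp add: L2_set_left_distrib norm_vec_def)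
  finally show ?thesis .
qed

lemma bounded_bilinear_matrix_mult: "bounded_bilinear (\<lambda>(A :: real^'n^'m) (B :: real^'k^'n). A ** B)"
  by (rule bounded_bilinear.intro)
    (auto simp: matrix_add_ldistrib matrix_add_rdistrib matrix_scaleR_mult_left matrix_scaleR_mult_right
      intro!: exI[of _ 1] norm_matrix_mult_le)

lemma bounded_bilinear_matrix_vector_mult: "bounded_bilinear (\<lambda>(A :: real^'n^'m) (x :: real^'n). A *v x)"
  by (rule bounded_bilinear.intro)
    (auto simp: matrix_vector_right_distrib matrix_vector_mult_add_rdistrib matrix_vector_mult_scaleR
      scaleR_matrix_vector_assoc[symmetric] intro!: exI[of _ 1] norm_matrix_vector_mult_le)

lemma bounded_linear_transpose: "bounded_linear (transpose :: real^'n^'m \<Rightarrow> real^'m^'n)"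
  by (rule bounded_linear_intro[of _ 1]) (auto simp: transpose_add transpose_scalar norm_transpose)

lemmas tendsto_matrix_mult [tendsto_intros] = bounded_bilinear.tendsto[OF bounded_bilinear_matrix_mult]
lemmas tendsto_transpose [tendsto_intros] = bounded_linear.tendsto[OF bounded_linear_transpose]
lemmas continuous_on_matrix_mult [continuous_intros] = bounded_bilinear.continuous_on[OF bounded_bilinear_matrix_mult]
lemmas continuous_on_matrix_vector_mult [continuous_intros] = bounded_bilinear.continuous_on[OF bounded_bilinear_matrix_vector_mult]
lemmas continuous_on_transpose [continuous_intros] = bounded_linear.continuous_on[OF bounded_linear_transpose]

text \<open>By polarisation every entry of a symmetric matrix is a combination of three values of
  its quadratic form.\<close>

lemma tendsto_symmetric_matrixI:
  fixes f :: "'b \<Rightarrow> real^'n^'n"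
  assumes quad: "\<And>v. ((\<lambda>x. v \<bullet> (f x *v v)) \<longlongrightarrow> v \<bullet> (X *v v)) F"
    and f: "\<And>x. transpose (f x) = f x" and X: "transpose X = X"
  shows "(f \<longlongrightarrow> X) F"
proof (intro vec_tendstoI)
  have polar: "M $ i $ j = ((axis i 1 + axis j 1) \<bullet> (M *v (axis i 1 + axis j 1))
      - axis i 1 \<bullet> (M *v axis i 1) - axis j 1 \<bullet> (M *v axis j 1)) / 2"
    if "transpose M = M" for M :: "real^'n^'n" and i j
  proof -
    have "M $ i $ j = axis i 1 \<bullet> (M *v axis j 1)" "M $ j $ i = axis j 1 \<bullet> (M *v axis i 1)"
      by (simp_all add: matrix_vector_mult_basis column_def inner_axis')
    moreover have "M $ j $ i = M $ i $ j" using arg_cong[OF that, of "\<lambda>M. M $ i $ j"] by (simp add: transpose_def)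
    ultimately show ?thesis by (simp add: matrix_vector_right_distrib inner_add)
  qed
  show "((\<lambda>x. f x $ i $ j) \<longlongrightarrow> X $ i $ j) F" for i j
    unfolding polar[OF f] polar[OF X] by (intro tendsto_intros quad) simp
qed

lemma uniform_lower_bound:
  fixes P :: "'a::topological_space \<Rightarrow> real^'n^'n"
  assumes K: "compact K" and P: "continuous_on K P" and pd: "\<And>x. x \<in> K \<Longrightarrow> P x \<in> sym_pos_def"
  shows "\<exists>m>0. \<forall>x\<in>K. \<forall>v. m * (v \<bullet> v) \<le> v \<bullet> (P x *v v)"
proof (cases "K = {}")
  case False
  let ?q = "\<lambda>(x, v). v \<bullet> (P x *v v)"
  have "continuous_on (K \<times> sphere (0 :: real^'n) 1) (\<lambda>y. P (fst y))"
    by (rule continuous_on_compose2[OF P continuous_on_fst]) (auto intro: continuous_intros)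
  then have "continuous_on (K \<times> sphere (0 :: real^'n) 1) ?q"
    unfolding case_prod_beta by (intro continuous_intros)
  moreover have "axis undefined 1 \<in> sphere (0 :: real^'n) 1" by simp
  then have "K \<times> sphere (0 :: real^'n) 1 \<noteq> {}" using False by blast
  ultimately obtain p where p: "p \<in> K \<times> sphere 0 1" and min: "\<And>y. y \<in> K \<times> sphere 0 1 \<Longrightarrow> ?q p \<le> ?q y"
    using continuous_attains_inf[OF compact_Times[OF K compact_sphere], of 0 1 ?q] by blast
  obtain y u where yu: "p = (y, u)" by (cases p)
  show ?thesis
  proof (intro exI[of _ "u \<bullet> (P y *v u)"] conjI ballI allI)
    show "0 < u \<bullet> (P y *v u)" using p yu by (intro sym_pos_def_pos pd) auto
    fix x v assume x: "x \<in> K"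
    show "u \<bullet> (P y *v u) * (v \<bullet> v) \<le> v \<bullet> (P x *v v)"
    proof (cases "v = 0")
      case False
      have "u \<bullet> (P y *v u) \<le> (v /\<^sub>R norm v) \<bullet> (P x *v (v /\<^sub>R norm v))"
        using min[of "(x, v /\<^sub>R norm v)"] False x by (simp add: yu)
      also have "\<dots> = v \<bullet> (P x *v v) / (v \<bullet> v)"
        by (simp add: matrix_vector_mult_scaleR dot_square_norm power2_eq_square field_simps)
      finally show ?thesis using False by (simp add: field_simps)
    qed simp
  qed
qed (auto intro: exI[of _ 1])

lemma abs_inner_matrix_le: "\<bar>v \<bullet> (M *v v)\<bar> \<le> norm M * (v \<bullet> v)" for M :: "real^'n^'n"
proof -
  have "\<bar>v \<bullet> (M *v v)\<bar> \<le> norm v * norm (M *v v)" by (rule Cauchy_Schwarz_ineq2)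
  also have "\<dots> \<le> norm v * (norm M * norm v)" by (intro mult_left_mono norm_matrix_vector_mult_le) simp
  finally show ?thesis by (simp add: dot_square_norm power2_eq_square mult_ac)
qed

text \<open>Norm closeness becomes relative closeness in the Loewner order because \<open>A\<close>
  dominates a positive multiple \<open>m\<close> of the identity; the compact family consisting of
  \<open>A\<close> alone supplies \<open>m\<close>.\<close>

lemma eventually_loewner_close:
  fixes A :: "real^'n^'n"
  assumes lim: "(f \<longlongrightarrow> A) F" and A: "A \<in> sym_pos_def" and e: "0 < e"
  shows "\<forall>\<^sub>F x in F. (1 - e) *\<^sub>R A \<preceq> f x \<and> f x \<preceq> (1 + e) *\<^sub>R A"
proof -
  have "B \<in> sym_pos_def" if "B \<in> {A}" for B using A that by simp
  then obtain m where m: "0 < m" "\<And>v. m * (v \<bullet> v) \<le> v \<bullet> (A *v v)"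
    using uniform_lower_bound[OF compact_sing continuous_on_id, of A] by auto
  have "\<forall>\<^sub>F x in F. dist (f x) A < e * m" using lim e m by (intro tendstoD) auto
  then show ?thesis
  proof eventually_elim
    fix x assume d: "dist (f x) A < e * m"
    have "\<bar>v \<bullet> ((f x - A) *v v)\<bar> \<le> e * (v \<bullet> (A *v v))" for v
    proof -
      have "\<bar>v \<bullet> ((f x - A) *v v)\<bar> \<le> norm (f x - A) * (v \<bullet> v)" by (rule abs_inner_matrix_le)
      also have "\<dots> \<le> (e * m) * (v \<bullet> v)" using d by (intro mult_right_mono) (auto simp: dist_norm)
      also have "\<dots> \<le> e * (v \<bullet> (A *v v))" using m(2)[of v] e by (simp add: mult.assoc)
      finally show ?thesis .
    qed
    then show "(1 - e) *\<^sub>R A \<preceq> f x \<and> f x \<preceq> (1 + e) *\<^sub>R A"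
      by (auto simp: loewner_le_def scaleR_matrix_vector_assoc[symmetric] matrix_vector_mult_diff_rdistrib
          inner_diff abs_le_iff algebra_simps)
  qed
qed

text \<open>Monotonicity and homogeneity of the mean suffice: arguments between \<open>1 - e\<close>
  and \<open>1 + e\<close> times their limits have a mean between the same multiples of the limit
  mean.\<close>

lemma tendsto_gmean:
  fixes A B :: "real^'n^'n"
  assumes f: "(f \<longlongrightarrow> A) F" and g: "(g \<longlongrightarrow> B) F" and A: "A \<in> sym_pos_def" and B: "B \<in> sym_pos_def"
    and fp: "\<And>x. f x \<in> sym_pos_def" and gp: "\<And>x. g x \<in> sym_pos_def"
  shows "((\<lambda>x. gmean (f x) (g x)) \<longlongrightarrow> gmean A B) F"
proof (rule tendsto_symmetric_matrixI)
  show "transpose (gmean (f x) (g x)) = gmean (f x) (g x)" for x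
    using fp gp by (simp add: gmean_pos_def sym_pos_def_symmetric)
  show "transpose (gmean A B) = gmean A B"
    using A B by (simp add: gmean_pos_def sym_pos_def_symmetric)
  fix v
  define q where "q = v \<bullet> (gmean A B *v v)"
  have q: "0 \<le> q" unfolding q_def using A B by (intro sym_pos_def_nonneg gmean_pos_def)
  show "((\<lambda>x. v \<bullet> (gmean (f x) (g x) *v v)) \<longlongrightarrow> v \<bullet> (gmean A B *v v)) F"
  proof (rule tendstoI)
    fix \<epsilon> :: real assume \<epsilon>: "0 < \<epsilon>"
    \<comment> \<open>The cap 1/2 keeps \<open>1 - e\<close> positive; the other term makes
      \<open>e * q < \<epsilon>\<close>, with \<open>q + 1\<close> guarding against
      \<open>q = 0\<close>.\<close>
    define e where "e = min (1/2) (\<epsilon> / (2 * (q + 1)))"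
    have e: "0 < e" "e < 1" using \<epsilon> q by (auto simp: e_def)
    have "e * q \<le> \<epsilon> / (2 * (q + 1)) * q" using q by (intro mult_right_mono) (auto simp: e_def)
    also have "\<dots> < \<epsilon>"
    proof -
      have "\<epsilon> * q < \<epsilon> * (2 * (q + 1))" using \<epsilon> q by (intro mult_strict_left_mono) auto
      then show ?thesis using q by (simp add: divide_less_eq)
    qed
    finally have eq: "e * q < \<epsilon>" .
    show "\<forall>\<^sub>F x in F. dist (v \<bullet> (gmean (f x) (g x) *v v)) (v \<bullet> (gmean A B *v v)) < \<epsilon>"
      using eventually_loewner_close[OF f A e(1)] eventually_loewner_close[OF g B e(1)]
    proof eventually_elim
      fix x assume fx: "(1 - e) *\<^sub>R A \<preceq> f x \<and> f x \<preceq> (1 + e) *\<^sub>R A"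
        and gx: "(1 - e) *\<^sub>R B \<preceq> g x \<and> g x \<preceq> (1 + e) *\<^sub>R B"
      have pd: "(1 - e) *\<^sub>R A \<in> sym_pos_def" "(1 + e) *\<^sub>R A \<in> sym_pos_def"
        "(1 - e) *\<^sub>R B \<in> sym_pos_def" "(1 + e) *\<^sub>R B \<in> sym_pos_def"
        using e A B by (auto intro!: sym_pos_def_scaleR)
      have "(1 - e) *\<^sub>R gmean A B \<preceq> gmean (f x) (g x)"
        using gmean_mono[OF pd(1) pd(3) fp gp] fx gx gmean_scaleR[OF A B, of "1 - e"] e by auto
      moreover have "gmean (f x) (g x) \<preceq> (1 + e) *\<^sub>R gmean A B"
        using gmean_mono[OF fp gp pd(2) pd(4)] fx gx gmean_scaleR[OF A B, of "1 + e"] e by auto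
      ultimately have "(1 - e) * q \<le> v \<bullet> (gmean (f x) (g x) *v v)" "v \<bullet> (gmean (f x) (g x) *v v) \<le> (1 + e) * q"
        by (auto simp: loewner_le_def q_def scaleR_matrix_vector_assoc[symmetric])
      then show "dist (v \<bullet> (gmean (f x) (g x) *v v)) (v \<bullet> (gmean A B *v v)) < \<epsilon>"
        using eq unfolding dist_real_def q_def[symmetric] left_diff_distrib distrib_right by linarith
    qed
  qed
qed

section \<open>Ordinary differential equations\<close>

text \<open>Integration of the growing weight gains the factor \<open>1 / l\<close>, which becomes
  the contraction factor in the fixed point argument.\<close>

lemma norm_integral_exp_bound:
  fixes f :: "real \<Rightarrow> 'a::banach"
  assumes f: "continuous_on {0..t} f" and t: "0 \<le> t" and l: "0 < l" and C: "0 \<le> C"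
    and bnd: "\<And>s. s \<in> {0..t} \<Longrightarrow> norm (f s) \<le> C * exp (l * s)"
  shows "norm (integral {0..t} f) \<le> C / l * exp (l * t)"
proof -
  have "((\<lambda>s. C * exp (l * s)) has_integral (C / l * exp (l * t) - C / l * exp (l * 0))) {0..t}"
    using t l by (intro fundamental_theorem_of_calculus)
      (auto intro!: derivative_eq_intros simp: has_real_derivative_iff_has_vector_derivative[symmetric])
  then have "norm (integral {0..t} f) \<le> C / l * exp (l * t) - C / l * exp (l * 0)"
    using f bnd by (metis (no_types, lifting) Henstock_Kurzweil_Integration.integral_norm_bound_integral
        has_integral_integrable integral_unique integrable_continuous_real)
  also have "\<dots> \<le> C / l * exp (l * t)" using C l by simp
  finally show ?thesis .
qed

text \<open>Banach's fixed point theorem for the rescaled unknown \<open>exp (- l t) x(t)\<close>, with \<open>l\<close> twice the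
  Lipschitz constant.\<close>

theorem global_ode_solution_exists:
  fixes F :: "real \<Rightarrow> 'a::banach \<Rightarrow> 'a"
  assumes cont: "\<And>u. continuous_on {0..} u \<Longrightarrow> continuous_on {0..} (\<lambda>t. F t (u t))"
    and Lip: "\<And>t x y. 0 \<le> t \<Longrightarrow> norm (F t x - F t y) \<le> L * norm (x - y)"
    and bnd: "\<And>t. 0 \<le> t \<Longrightarrow> norm (F t 0) \<le> M"
  shows "\<exists>x. x 0 = a \<and> (\<forall>t\<ge>0. (x has_vector_derivative F t (x t)) (at t within {0..}))"
proof -
  define L' where "L' = \<bar>L\<bar> + 1"
  define l where "l = 2 * L'"
  have L': "0 < L'" "0 < l" by (auto simp: L'_def l_def)
  have LipL': "norm (F t x - F t y) \<le> L' * norm (x - y)" if "0 \<le> t" for t x y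
    by (rule order_trans[OF Lip[OF that]], rule mult_right_mono) (auto simp: L'_def)
  have M: "0 \<le> M" using bnd[of 0] norm_ge_zero order_trans by blast
  define I where "I u t = integral {0..t} (\<lambda>s. F s (exp (l * s) *\<^sub>R u s))" for u t
  \<comment> \<open>The fixed-point map is extended to negative times as a constant, through
    \<open>max 0 t\<close>, so that it acts on bounded continuous functions on the whole
    line.\<close>
  define G where "G u t = exp (- (l * max 0 t)) *\<^sub>R (a + I u (max 0 t))" for u t
  have contF: "continuous_on {0..} (\<lambda>s. F s (exp (l * s) *\<^sub>R u s))" if "continuous_on UNIV u" for u
    using that by (intro cont continuous_intros) (auto intro: continuous_on_subset)
  have contF': "continuous_on {0..t} (\<lambda>s. F s (exp (l * s) *\<^sub>R u s))" if "continuous_on UNIV u" for u t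
    using contF[OF that] by (rule continuous_on_subset) auto
  have dI: "(I u has_vector_derivative F t (exp (l * t) *\<^sub>R u t)) (at t within {0..})"
    if u: "continuous_on UNIV u" and t: "0 \<le> t" for u t
  proof -
    have "(I u has_vector_derivative F t (exp (l * t) *\<^sub>R u t)) (at t within {0..t + 1})"
      unfolding I_def using t by (intro integral_has_vector_derivative contF' u) auto
    moreover have "at t within {0..t + 1} = at t within {0..}"
      by (rule at_within_nhd[of _ "{..<t + 1}"]) auto
    ultimately show ?thesis by simp
  qed
  have contI: "continuous_on {0..} (I u)" if "continuous_on UNIV u" for u
    using dI[OF that] by (intro continuous_on_vector_derivative) auto
  have contG: "continuous_on UNIV (G u)" if "continuous_on UNIV u" for u
    unfolding G_def using contI[OF that]
    by (intro continuous_intros continuous_on_compose2[of "{0..}" "I u" UNIV "\<lambda>t. max 0 t"]) auto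
  have bcont: "G (apply_bcontfun u) \<in> bcontfun" for u :: "real \<Rightarrow>\<^sub>C 'a"
  proof (rule bcontfun_normI)
    show "continuous_on UNIV (G u)" by (intro contG) simp
    fix t :: real
    define t' where "t' = max 0 t"
    have t': "0 \<le> t'" by (simp add: t'_def)
    define C where "C = M + L' * norm u"
    have C: "0 \<le> C" using M L' by (simp add: C_def)
    have "norm (I u t') \<le> C / l * exp (l * t')"
      unfolding I_def
    proof (rule norm_integral_exp_bound[OF contF' t' L'(2) C])
      fix s assume s: "s \<in> {0..t'}"
      have "norm (F s (exp (l * s) *\<^sub>R u s)) \<le> norm (F s 0) + norm (F s (exp (l * s) *\<^sub>R u s) - F s 0)"
        by norm
      also have "\<dots> \<le> M + L' * norm (exp (l * s) *\<^sub>R u s)"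
        using LipL'[of s "exp (l * s) *\<^sub>R u s" 0] bnd[of s] s by auto
      also have "\<dots> \<le> M * exp (l * s) + L' * (exp (l * s) * norm u)"
        using M L' s norm_bounded[of u s] mult_left_mono[of 1 "exp (l * s)" M]
        by (intro add_mono mult_left_mono) auto
      finally show "norm (F s (exp (l * s) *\<^sub>R u s)) \<le> C * exp (l * s)" by (simp add: C_def algebra_simps)
    qed simp
    then have "norm (a + I u t') \<le> norm a + C / l * exp (l * t')"
      using norm_triangle_ineq[of a "I u t'"] by linarith
    also have "\<dots> \<le> (norm a + C / l) * exp (l * t')"
      using t' L' mult_left_mono[of 1 "exp (l * t')" "norm a"] by (simp add: distrib_right)
    finally show "norm (G u t) \<le> norm a + C / l"
      unfolding G_def t'_def[symmetric] norm_scaleR by (simp add: exp_minus divide_simps mult_ac)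
  qed
  define \<Phi> where "\<Phi> u = Bcontfun (G (apply_bcontfun u))" for u :: "real \<Rightarrow>\<^sub>C 'a"
  have app: "apply_bcontfun (\<Phi> u) = G u" for u
    unfolding \<Phi>_def by (rule Bcontfun_inverse) (rule bcont)
  have "\<exists>!u. \<Phi> u = u"
  proof (rule banach_fix_type[of "1/2"])
    show "\<forall>u v. dist (\<Phi> u) (\<Phi> v) \<le> 1 / 2 * dist u v"
    proof (intro allI dist_bound)
      fix u v :: "real \<Rightarrow>\<^sub>C 'a" and t :: real
      define t' where "t' = max 0 t"
      have t': "0 \<le> t'" by (simp add: t'_def)
      have int: "(\<lambda>s. F s (exp (l * s) *\<^sub>R apply_bcontfun w s)) integrable_on {0..t'}" for w
        by (intro integrable_continuous_real contF') simp
      have "norm (I u t' - I v t') = norm (integral {0..t'} (\<lambda>s. F s (exp (l * s) *\<^sub>R u s) - F s (exp (l * s) *\<^sub>R v s)))"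
        unfolding I_def by (subst integral_diff[OF int int]) simp
      also have "\<dots> \<le> (L' * dist u v) / l * exp (l * t')"
      proof (rule norm_integral_exp_bound[OF _ t' L'(2)])
        show "continuous_on {0..t'} (\<lambda>s. F s (exp (l * s) *\<^sub>R u s) - F s (exp (l * s) *\<^sub>R v s))"
          by (intro continuous_on_diff contF') auto
        fix s assume s: "s \<in> {0..t'}"
        have "norm (F s (exp (l * s) *\<^sub>R u s) - F s (exp (l * s) *\<^sub>R v s)) \<le> L' * norm (exp (l * s) *\<^sub>R (u s - v s))"
          using LipL'[of s "exp (l * s) *\<^sub>R u s" "exp (l * s) *\<^sub>R v s"] s by (simp add: scaleR_diff_right)
        also have "\<dots> \<le> L' * (exp (l * s) * dist u v)"
          using L' dist_bounded[of u s v] by (auto simp: dist_norm intro!: mult_left_mono)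
        finally show "norm (F s (exp (l * s) *\<^sub>R u s) - F s (exp (l * s) *\<^sub>R v s)) \<le> L' * dist u v * exp (l * s)"
          by (simp add: mult_ac)
      qed (use L' in auto)
      finally have "norm (I u t' - I v t') \<le> dist u v / 2 * exp (l * t')" using L' by (simp add: l_def)
      then have "exp (- (l * t')) * norm (I u t' - I v t') \<le> exp (- (l * t')) * (dist u v / 2 * exp (l * t'))"
        by (intro mult_left_mono) auto
      also have "\<dots> = 1 / 2 * dist u v" by (simp add: exp_minus field_simps)
      finally show "dist (apply_bcontfun (\<Phi> u) t) (apply_bcontfun (\<Phi> v) t) \<le> 1 / 2 * dist u v"
        unfolding app G_def t'_def[symmetric] by (simp add: dist_norm flip: scaleR_diff_right)
    qed
  qed auto
  then obtain u where "\<Phi> u = u" by blast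
  then have u: "apply_bcontfun u = G u" using app[of u] by simp
  define x where "x t = exp (l * t) *\<^sub>R u t" for t
  have x: "x t = a + I u t" if "0 \<le> t" for t
    using that unfolding x_def by (subst u) (simp add: G_def exp_minus)
  show ?thesis
  proof (intro exI[of _ x] conjI allI impI)
    show "x 0 = a" by (simp add: x I_def)
    fix t :: real assume t: "0 \<le> t"
    have "((\<lambda>t. a + I u t) has_vector_derivative F t (exp (l * t) *\<^sub>R u t)) (at t within {0..})"
      using dI[of u t] t by (auto intro!: derivative_eq_intros)
    then show "(x has_vector_derivative F t (x t)) (at t within {0..})"
      using t by (intro has_vector_derivative_transform[of t "{0..}" x "\<lambda>t. a + I u t"]) (auto simp: x, simp add: x_def flip: x)
  qed
qed

lemma energy_derivative:
  fixes u :: "real \<Rightarrow> 'a::real_inner"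
  assumes "(u has_vector_derivative u') (at t within S)"
  shows "((\<lambda>t. exp (c * t) * (u t \<bullet> u t)) has_real_derivative exp (c * t) * (c * (u t \<bullet> u t) + 2 * (u t \<bullet> u'))) (at t within S)"
proof -
  have "((\<lambda>t. u t \<bullet> u t) has_real_derivative u t \<bullet> u' + u' \<bullet> u t) (at t within S)"
    using has_derivative_inner[OF assms[unfolded has_vector_derivative_def] assms[unfolded has_vector_derivative_def]]
    by (rule has_derivative_imp_has_field_derivative) (simp add: algebra_simps)
  then show ?thesis
    by (auto intro!: derivative_eq_intros simp: inner_commute algebra_simps)
qed

text \<open>The squared norm is differentiable even where \<open>u\<close> vanishes. The cross term
  is split by \<open>2 |u| \<eta> \<le> |u|^2 + \<eta>^2\<close>, whence the rate
  \<open>2 * L + 1\<close>.\<close>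

lemma gronwall_norm_squared:
  fixes u :: "real \<Rightarrow> 'a::real_inner"
  assumes T: "0 \<le> T" and L: "0 \<le> L"
    and u: "\<And>t. t \<in> {0..T} \<Longrightarrow> (u has_vector_derivative u' t) (at t within {0..T})"
    and bnd: "\<And>t. t \<in> {0..T} \<Longrightarrow> norm (u' t) \<le> L * norm (u t) + \<eta>"
  shows "(norm (u T))\<^sup>2 \<le> exp ((2 * L + 1) * T) * ((norm (u 0))\<^sup>2 + \<eta>\<^sup>2 * T)"
proof -
  define c where "c = - (2 * L + 1)"
  define v where "v t = exp (c * t) * (u t \<bullet> u t) - \<eta>\<^sup>2 * t" for t
  define v' where "v' t = exp (c * t) * (c * (u t \<bullet> u t) + 2 * (u t \<bullet> u' t)) - \<eta>\<^sup>2" for t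
  have v: "(v has_real_derivative v' t) (at t within {0..T})" if "t \<in> {0..T}" for t
  proof -
    have "((\<lambda>t. \<eta>\<^sup>2 * t) has_real_derivative \<eta>\<^sup>2) (at t within {0..T})"
      by (auto intro!: derivative_eq_intros)
    from DERIV_diff[OF energy_derivative[OF u[OF that]] this] show ?thesis
      unfolding v_def v'_def .
  qed
  have v'_le: "v' t \<le> 0" if t: "t \<in> {0..T}" for t
  proof -
    have "2 * (u t \<bullet> u' t) \<le> 2 * (norm (u t) * (L * norm (u t) + \<eta>))"
      using norm_cauchy_schwarz[of "u t" "u' t"] bnd[OF t] by (smt (verit) mult_left_mono norm_ge_zero)
    also have "\<dots> = 2 * L * (u t \<bullet> u t) + 2 * norm (u t) * \<eta>"
      by (simp add: dot_square_norm power2_eq_square algebra_simps)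
    also have "2 * norm (u t) * \<eta> \<le> (u t \<bullet> u t) + \<eta>\<^sup>2"
      using sum_squares_bound[of "norm (u t)" \<eta>] by (simp add: dot_square_norm)
    finally have "c * (u t \<bullet> u t) + 2 * (u t \<bullet> u' t) \<le> \<eta>\<^sup>2" by (simp add: c_def algebra_simps)
    then have "exp (c * t) * (c * (u t \<bullet> u t) + 2 * (u t \<bullet> u' t)) \<le> exp (c * t) * \<eta>\<^sup>2"
      by (intro mult_left_mono) auto
    also have "\<dots> \<le> 1 * \<eta>\<^sup>2"
      using t L by (intro mult_right_mono) (auto simp: c_def intro: mult_nonpos_nonneg)
    finally show ?thesis by (simp add: v'_def)
  qed
  have "v T \<le> v 0"
  proof (rule DERIV_nonpos_imp_decreasing_open[OF T])
    fix t assume "0 < t" "t < T"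
    then show "\<exists>y. DERIV v t :> y \<and> y \<le> 0"
      using v[of t] v'_le[of t] at_within_Icc_at[of 0 t T] by auto
  next
    show "continuous_on {0..T} v" using v by (rule DERIV_continuous_on)
  qed
  then have "exp (c * T) * (u T \<bullet> u T) \<le> u 0 \<bullet> u 0 + \<eta>\<^sup>2 * T" by (simp add: v_def)
  then have "exp (- c * T) * (exp (c * T) * (u T \<bullet> u T)) \<le> exp (- c * T) * (u 0 \<bullet> u 0 + \<eta>\<^sup>2 * T)"
    by (intro mult_left_mono) auto
  then have "u T \<bullet> u T \<le> exp (- c * T) * (u 0 \<bullet> u 0 + \<eta>\<^sup>2 * T)"
    by (simp add: mult.assoc[symmetric] exp_add[symmetric])
  then show ?thesis by (simp add: c_def dot_square_norm add.commute)
qed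

text \<open>The squared norm times \<open>exp (- 2 L t)\<close> decreases, and times
  \<open>exp (2 L t)\<close> increases. The lower bound later gives invertibility of the variational
  matrices and the comparison of a metric with its pullback.\<close>

lemma linear_growth_bounds:
  fixes u :: "real \<Rightarrow> 'a::real_inner"
  assumes T: "0 \<le> T"
    and u: "\<And>t. t \<in> {0..T} \<Longrightarrow> (u has_vector_derivative u' t) (at t within {0..T})"
    and bnd: "\<And>t. t \<in> {0..T} \<Longrightarrow> norm (u' t) \<le> L * norm (u t)"
  shows "u T \<bullet> u T \<le> exp (2 * L * T) * (u 0 \<bullet> u 0)" "exp (- (2 * L * T)) * (u 0 \<bullet> u 0) \<le> u T \<bullet> u T"
proof -
  define v where "v c t = exp (c * t) * (u t \<bullet> u t)" for c t
  define v' where "v' c t = exp (c * t) * (c * (u t \<bullet> u t) + 2 * (u t \<bullet> u' t))" for c t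
  have v: "(v c has_real_derivative v' c t) (at t within {0..T})" if "t \<in> {0..T}" for c t
    unfolding v_def v'_def using energy_derivative[OF u[OF that], of c] .
  have ab: "\<bar>u t \<bullet> u' t\<bar> \<le> L * (u t \<bullet> u t)" if t: "t \<in> {0..T}" for t
  proof -
    have "\<bar>u t \<bullet> u' t\<bar> \<le> norm (u t) * norm (u' t)" by (rule Cauchy_Schwarz_ineq2)
    also have "\<dots> \<le> norm (u t) * (L * norm (u t))" by (intro mult_left_mono bnd t) auto
    finally show ?thesis by (simp add: dot_square_norm power2_eq_square mult_ac)
  qed
  have c1: "v' (- (2 * L)) t \<le> 0" if t: "t \<in> {0..T}" for t
    using ab[OF t] by (auto simp: v'_def mult_le_0_iff)
  have c2: "0 \<le> v' (2 * L) t" if t: "t \<in> {0..T}" for t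
    using ab[OF t] by (auto simp: v'_def)
  have cont: "continuous_on {0..T} (v c)" for c using v by (rule DERIV_continuous_on)
  have "v (- (2 * L)) T \<le> v (- (2 * L)) 0"
  proof (rule DERIV_nonpos_imp_decreasing_open[OF T _ cont])
    fix t assume "0 < t" "t < T"
    then show "\<exists>y. DERIV (v (- (2 * L))) t :> y \<and> y \<le> 0"
      using v[of t "- (2 * L)"] c1[of t] at_within_Icc_at[of 0 t T] by auto
  qed
  then have "exp (2 * L * T) * (exp (- (2 * L) * T) * (u T \<bullet> u T)) \<le> exp (2 * L * T) * (u 0 \<bullet> u 0)"
    by (intro mult_left_mono) (auto simp: v_def)
  then show "u T \<bullet> u T \<le> exp (2 * L * T) * (u 0 \<bullet> u 0)"
    by (simp add: mult.assoc[symmetric] exp_add[symmetric])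
  have "v (2 * L) 0 \<le> v (2 * L) T"
  proof (rule DERIV_nonneg_imp_increasing_open[OF T _ cont])
    fix t assume "0 < t" "t < T"
    then show "\<exists>y. DERIV (v (2 * L)) t :> y \<and> 0 \<le> y"
      using v[of t "2 * L"] c2[of t] at_within_Icc_at[of 0 t T] by auto
  qed
  then have "exp (- (2 * L * T)) * (u 0 \<bullet> u 0) \<le> exp (- (2 * L * T)) * (exp (2 * L * T) * (u T \<bullet> u T))"
    by (intro mult_left_mono) (auto simp: v_def)
  then show "exp (- (2 * L * T)) * (u 0 \<bullet> u 0) \<le> u T \<bullet> u T"
    by (simp add: mult.assoc[symmetric] exp_add[symmetric])
qed

section \<open>Trajectories in a compact invariant set and their linearization\<close>

lemma class_C1_has_derivative:
  "class_C1 \<phi> \<Longrightarrow> (\<phi> has_derivative (\<lambda>h. jacobian \<phi> (at x) *v h)) (at x within S)"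
  unfolding class_C1_def jacobian_works[symmetric]
  by (metis has_derivative_at_withinI jacobian_works)

lemma onorm_matrix_le: "onorm ((*v) A) \<le> norm A" for A :: "real^'n^'m"
  by (rule onorm_bound) (auto simp: norm_matrix_vector_mult_le)

lemma class_C1_lipschitz:
  fixes \<phi> :: "real^'n \<Rightarrow> real^'n"
  assumes \<phi>: "class_C1 \<phi>" and S: "compact S" "convex S"
  obtains L where "0 \<le> L" "\<And>x. x \<in> S \<Longrightarrow> norm (jacobian \<phi> (at x)) \<le> L"
    "\<And>x y. x \<in> S \<Longrightarrow> y \<in> S \<Longrightarrow> norm (\<phi> x - \<phi> y) \<le> L * norm (x - y)"
proof -
  have "compact ((\<lambda>x. jacobian \<phi> (at x)) ` S)"
    using \<phi> S by (intro compact_continuous_image) (auto simp: class_C1_def intro: continuous_on_subset)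
  then have "bounded ((\<lambda>x. jacobian \<phi> (at x)) ` S)" by (rule compact_imp_bounded)
  then obtain L where L: "0 < L" "\<And>x. x \<in> S \<Longrightarrow> norm (jacobian \<phi> (at x)) \<le> L"
    unfolding bounded_pos by blast
  have "norm (\<phi> x - \<phi> y) \<le> L * norm (x - y)" if "x \<in> S" "y \<in> S" for x y
    by (rule differentiable_bound[where S=S and f'="\<lambda>x h. jacobian \<phi> (at x) *v h",
          OF S(2) class_C1_has_derivative[OF \<phi>] order_trans[OF onorm_matrix_le L(2)] that])
  with L show ?thesis by (intro that[of L]) auto
qed

text \<open>Uniform continuity of the Jacobian on the compact set makes one \<open>d\<close> work
  for all base points; convexity keeps the segment inside for the mean value inequality.\<close>

lemma class_C1_uniform_linearization:
  fixes \<phi> :: "real^'n \<Rightarrow> real^'n"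
  assumes \<phi>: "class_C1 \<phi>" and S: "compact S" "convex S" and e: "0 < \<eta>"
  obtains d where "0 < d" "\<And>x y. x \<in> S \<Longrightarrow> y \<in> S \<Longrightarrow> dist x y < d \<Longrightarrow>
    norm (\<phi> y - \<phi> x - jacobian \<phi> (at x) *v (y - x)) \<le> \<eta> * norm (y - x)"
proof -
  have "uniformly_continuous_on S (\<lambda>x. jacobian \<phi> (at x))"
    using \<phi> S by (intro compact_uniformly_continuous) (auto simp: class_C1_def intro: continuous_on_subset)
  then obtain d where d: "0 < d"
    "\<And>x y. x \<in> S \<Longrightarrow> y \<in> S \<Longrightarrow> dist y x < d \<Longrightarrow> dist (jacobian \<phi> (at y)) (jacobian \<phi> (at x)) < \<eta>"
    using e unfolding uniformly_continuous_on_def by metis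
  have "norm (\<phi> y - \<phi> x - jacobian \<phi> (at x) *v (y - x)) \<le> norm (y - x) * \<eta>"
    if x: "x \<in> S" and y: "y \<in> S" and xy: "dist x y < d" for x y
  proof (rule differentiable_bound_linearization[where S="S \<inter> ball x d" and f'="\<lambda>x h. jacobian \<phi> (at x) *v h"])
    have "convex (S \<inter> ball x d)" using S by (intro convex_Int) auto
    moreover have "x \<in> S \<inter> ball x d" "y \<in> S \<inter> ball x d" using x y xy d by auto
    ultimately have "closed_segment x y \<subseteq> S \<inter> ball x d" by (simp only: closed_segment_subset)
    then show "x + t *\<^sub>R (y - x) \<in> S \<inter> ball x d" if "t \<in> {0..1}" for t
    proof -
      have "x + t *\<^sub>R (y - x) = (1 - t) *\<^sub>R x + t *\<^sub>R y" by (simp add: algebra_simps)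
      then have "x + t *\<^sub>R (y - x) \<in> closed_segment x y" using that by (auto simp: closed_segment_def)
      with \<open>closed_segment x y \<subseteq> _\<close> show ?thesis by blast
    qed
    show "x \<in> S \<inter> ball x d" by fact
    show "onorm ((*v) (jacobian \<phi> (at z)) - (*v) (jacobian \<phi> (at x))) \<le> \<eta>" if "z \<in> S \<inter> ball x d" for z
    proof -
      have "(*v) (jacobian \<phi> (at z)) - (*v) (jacobian \<phi> (at x)) = (*v) (jacobian \<phi> (at z) - jacobian \<phi> (at x))"
        by (simp add: fun_eq_iff matrix_vector_mult_diff_rdistrib)
      then show ?thesis
        using d(2)[OF x, of z] that onorm_matrix_le[of "jacobian \<phi> (at z) - jacobian \<phi> (at x)"]
        by (auto simp: dist_norm norm_minus_commute)
    qed
  qed (rule class_C1_has_derivative[OF \<phi>])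
  with d(1) that show ?thesis by (auto simp: mult.commute)
qed

lemma continuous_on_Times_equicontinuous:
  fixes f :: "'a::metric_space \<Rightarrow> 'b::metric_space \<Rightarrow> 'c::metric_space"
  assumes snd: "\<And>a. a \<in> K \<Longrightarrow> continuous_on I (f a)"
    and fst: "\<And>a e. a \<in> K \<Longrightarrow> 0 < e \<Longrightarrow> \<exists>d>0. \<forall>b\<in>K. dist b a < d \<longrightarrow> (\<forall>t\<in>I. dist (f b t) (f a t) < e)"
  shows "continuous_on (K \<times> I) (\<lambda>(a, t). f a t)"
  unfolding continuous_on_iff
proof (intro ballI allI impI)
  fix p and e :: real assume p: "p \<in> K \<times> I" and e: "0 < e"
  obtain a t where p_eq: "p = (a, t)" by (cases p)
  then have a: "a \<in> K" and t: "t \<in> I" using p by auto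
  obtain d1 where d1: "0 < d1" "\<And>b s. b \<in> K \<Longrightarrow> dist b a < d1 \<Longrightarrow> s \<in> I \<Longrightarrow> dist (f b s) (f a s) < e / 2"
    using fst[OF a, of "e / 2"] e by auto
  obtain d2 where d2: "0 < d2" "\<And>s. s \<in> I \<Longrightarrow> dist s t < d2 \<Longrightarrow> dist (f a s) (f a t) < e / 2"
    using snd[OF a, unfolded continuous_on_iff, rule_format, OF t, of "e / 2"] e by auto
  have "dist (f b s) (f a t) < e" if "b \<in> K" "s \<in> I" "dist (b, s) (a, t) < min d1 d2" for b s
    using d1(2)[of b s] d2(2)[of s] that dist_fst_le[of "(b, s)" "(a, t)"] dist_snd_le[of "(b, s)" "(a, t)"]
      dist_triangle[of "f b s" "f a t" "f a s"]
    by auto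
  then show "\<exists>d>0. \<forall>x'\<in>K \<times> I. dist x' p < d \<longrightarrow>
      dist (case x' of (a, t) \<Rightarrow> f a t) (case p of (a, t) \<Rightarrow> f a t) < e"
    unfolding p_eq using d1(1) d2(1) by (intro exI[of _ "min d1 d2"]) auto
qed

locale compact_invariant_system =
  fixes \<phi> :: "real^'n \<Rightarrow> real^'n" and K :: "(real^'n) set"
  assumes C1: "class_C1 \<phi>" and compact_K: "compact K" and invariant_K: "forward_invariant \<phi> K"
begin

abbreviation J :: "real^'n \<Rightarrow> real^'n^'n" where "J x \<equiv> jacobian \<phi> (at x)"

text \<open>\<open>K\<close> need not be convex, so Lipschitz bounds are taken on a ball. That
  \<open>K\<close> lies in the open ball leaves room for the first-exit argument in the existence
  proof.\<close>

definition ball_radius :: real where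
  "ball_radius = (SOME R. 0 < R \<and> K \<subseteq> ball 0 R)"

lemma ball_radius: "0 < ball_radius" "K \<subseteq> ball 0 ball_radius"
proof -
  have "\<exists>R. 0 < R \<and> K \<subseteq> ball 0 R"
    using bounded_subset_ballD[OF compact_imp_bounded[OF compact_K], of 0] by blast
  then have "0 < ball_radius \<and> K \<subseteq> ball 0 ball_radius" unfolding ball_radius_def by (rule someI_ex)
  then show "0 < ball_radius" "K \<subseteq> ball 0 ball_radius" by auto
qed

definition lip :: real where
  "lip = (SOME L. 0 \<le> L \<and> (\<forall>x\<in>cball 0 ball_radius. norm (J x) \<le> L) \<and>
     (\<forall>x\<in>cball 0 ball_radius. \<forall>y\<in>cball 0 ball_radius. norm (\<phi> x - \<phi> y) \<le> L * norm (x - y)))"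

lemma lip_cball: "0 \<le> lip" "x \<in> cball 0 ball_radius \<Longrightarrow> norm (J x) \<le> lip"
  "x \<in> cball 0 ball_radius \<Longrightarrow> y \<in> cball 0 ball_radius \<Longrightarrow> norm (\<phi> x - \<phi> y) \<le> lip * norm (x - y)"
proof -
  have "\<exists>L. 0 \<le> L \<and> (\<forall>x\<in>cball 0 ball_radius. norm (J x) \<le> L) \<and>
     (\<forall>x\<in>cball 0 ball_radius. \<forall>y\<in>cball 0 ball_radius. norm (\<phi> x - \<phi> y) \<le> L * norm (x - y))"
    using class_C1_lipschitz[OF C1, of "cball 0 ball_radius"] by (metis compact_cball convex_cball)
  from someI_ex[OF this, folded lip_def]
  show "0 \<le> lip" "x \<in> cball 0 ball_radius \<Longrightarrow> norm (J x) \<le> lip"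
    "x \<in> cball 0 ball_radius \<Longrightarrow> y \<in> cball 0 ball_radius \<Longrightarrow> norm (\<phi> x - \<phi> y) \<le> lip * norm (x - y)" by auto
qed

lemma K_cball: "x \<in> K \<Longrightarrow> x \<in> cball 0 ball_radius"
  using ball_radius by auto

lemma norm_J_le: "x \<in> K \<Longrightarrow> norm (J x) \<le> lip"
  by (intro lip_cball K_cball)

lemma lip_K: "x \<in> K \<Longrightarrow> y \<in> K \<Longrightarrow> norm (\<phi> x - \<phi> y) \<le> lip * norm (x - y)"
  by (intro lip_cball K_cball)

lemma continuous_on_J: "continuous_on S J"
  using C1 by (auto simp: class_C1_def intro: continuous_on_subset)

lemma continuous_on_\<phi>: "continuous_on S \<phi>"
  using class_C1_has_derivative[OF C1] by (intro has_derivative_continuous_on)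

text \<open>Solve the equation with \<open>\<phi>\<close> replaced by its composition with the projection onto a large
  ball. A solution of that equation starting in \<open>K\<close> cannot reach the boundary of the ball: up to
  the first time that this happens it also solves the original equation and is confined to \<open>K\<close>.\<close>

lemma solution_exists:
  assumes a: "a \<in> K"
  shows "\<exists>x. x 0 = a \<and> (\<forall>t\<ge>0. x t \<in> K \<and> (x has_vector_derivative \<phi> (x t)) (at t within {0..}))"
proof -
  let ?B = "cball (0 :: real^'n) ball_radius"
  have B: "convex ?B" "closed ?B" "?B \<noteq> {}" using ball_radius by auto
  define p where "p = closest_point ?B"
  have p: "p x \<in> ?B" for x unfolding p_def by (rule closest_point_in_set) (use B in auto)
  have pid: "p x = x" if "x \<in> ?B" for x unfolding p_def by (rule closest_point_self) (use that in auto)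
  have "\<exists>x. x 0 = a \<and> (\<forall>t\<ge>0. (x has_vector_derivative \<phi> (p (x t))) (at t within {0..}))"
  proof (rule global_ode_solution_exists[where L=lip and M="norm (\<phi> (p 0))"])
    show "continuous_on {0..} (\<lambda>t. \<phi> (p (u t)))" if u: "continuous_on {0..} u" for u :: "real \<Rightarrow> real^'n"
    proof -
      have "continuous_on {0..} (\<lambda>t. p (u t))"
        unfolding p_def by (rule continuous_on_compose2[OF continuous_on_closest_point[OF B, of UNIV] u]) auto
      then show ?thesis by (intro continuous_on_compose2[OF continuous_on_\<phi>[of UNIV]]) auto
    qed
    show "norm (\<phi> (p y) - \<phi> (p z)) \<le> lip * norm (y - z)" for y z
    proof -
      have "norm (\<phi> (p y) - \<phi> (p z)) \<le> lip * norm (p y - p z)" by (intro lip_cball p)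
      also have "\<dots> \<le> lip * norm (y - z)"
        using closest_point_lipschitz[OF B, of y z] lip_cball(1)
        by (intro mult_left_mono) (auto simp: p_def dist_norm)
      finally show ?thesis .
    qed
  qed simp
  then obtain x where x0: "x 0 = a"
    and x: "\<And>t. 0 \<le> t \<Longrightarrow> (x has_vector_derivative \<phi> (p (x t))) (at t within {0..})"
    by blast
  have contx: "continuous_on {0..} x"
    using x by (intro continuous_on_vector_derivative) auto
  have sol: "ode_solution_on \<phi> {0..T} x" if "\<And>t. t \<in> {0..T} \<Longrightarrow> x t \<in> ?B" for T
    unfolding ode_solution_on_def
  proof
    fix t assume t: "t \<in> {0..T}"
    then have "(x has_vector_derivative \<phi> (p (x t))) (at t within {0..T})"
      by (intro has_vector_derivative_within_subset[OF x]) auto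
    then show "(x has_vector_derivative \<phi> (x t)) (at t within {0..T})" using that[OF t] pid by simp
  qed
  have inK: "x T \<in> K" if "0 \<le> T" "\<And>t. t \<in> {0..T} \<Longrightarrow> x t \<in> ?B" for T
    using invariant_K a that(1) x0 sol[OF that(2)] unfolding forward_invariant_def by auto
  have inB: "x t1 \<in> ?B" if t1: "0 \<le> t1" for t1
  proof (rule ccontr)
    assume out: "x t1 \<notin> ?B"
    define S where "S = {t \<in> {0..t1}. norm (x t) = ball_radius}"
    have cn: "continuous_on {0..t} (\<lambda>t. norm (x t))" for t
      using contx by (intro continuous_on_norm) (auto intro: continuous_on_subset)
    have a_less: "norm (x 0) < ball_radius" using a ball_radius x0 by auto
    have ivt: "\<exists>s. 0 \<le> s \<and> s \<le> t \<and> norm (x s) = ball_radius" if "0 \<le> t" "ball_radius \<le> norm (x t)" for t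
      using a_less that cn[of t] by (intro IVT'[of "\<lambda>t. norm (x t)" 0 ball_radius t]) auto
    have "S \<noteq> {}" using ivt[of t1] out t1 by (auto simp: S_def)
    moreover have "compact S"
    proof -
      have "closed S" unfolding S_def using cn[of t1]
        by (intro continuous_closed_preimage_constant) auto
      then have "compact ({0..t1} \<inter> S)" by (intro compact_Int_closed compact_Icc)
      moreover have "{0..t1} \<inter> S = S" by (auto simp: S_def)
      ultimately show ?thesis by simp
    qed
    ultimately obtain s where s: "s \<in> S" and smin: "\<And>t. t \<in> S \<Longrightarrow> s \<le> t"
      using compact_attains_inf[of S] by auto
    have "x t \<in> ?B" if t: "t \<in> {0..s}" for t
    proof (rule ccontr)
      assume "x t \<notin> ?B"
      then have "ball_radius < norm (x t)" by auto
      then obtain r where r: "0 \<le> r" "r \<le> t" "norm (x r) = ball_radius" using ivt[of t] t by auto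
      then have "s \<le> r" using t s by (intro smin) (auto simp: S_def)
      then have "t = r" using r t by auto
      then show False using r \<open>ball_radius < norm (x t)\<close> by simp
    qed
    then have "x s \<in> K" using s by (intro inK) (auto simp: S_def)
    then have "norm (x s) < ball_radius" using ball_radius by auto
    then show False using s by (simp add: S_def)
  qed
  have "x t \<in> K \<and> (x has_vector_derivative \<phi> (x t)) (at t within {0..})" if "0 \<le> t" for t
    using inK[OF that] inB x[OF that] pid[OF inB[OF that]] by auto
  with x0 show ?thesis by blast
qed

definition traj :: "real^'n \<Rightarrow> real \<Rightarrow> real^'n" where
  "traj a = (SOME x. x 0 = a \<and> (\<forall>t\<ge>0. x t \<in> K \<and> (x has_vector_derivative \<phi> (x t)) (at t within {0..})))"

lemma traj_0 [simp]: "a \<in> K \<Longrightarrow> traj a 0 = a"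
  and traj_in_K: "a \<in> K \<Longrightarrow> 0 \<le> t \<Longrightarrow> traj a t \<in> K"
  and traj_deriv: "a \<in> K \<Longrightarrow> 0 \<le> t \<Longrightarrow> (traj a has_vector_derivative \<phi> (traj a t)) (at t within {0..})"
  using someI_ex[OF solution_exists, of a] unfolding traj_def by auto

lemma traj_deriv_Icc: "a \<in> K \<Longrightarrow> t \<in> {0..T} \<Longrightarrow> (traj a has_vector_derivative \<phi> (traj a t)) (at t within {0..T})"
  by (rule has_vector_derivative_within_subset[OF traj_deriv]) auto

lemma continuous_on_traj: "a \<in> K \<Longrightarrow> continuous_on {0..} (traj a)"
  using traj_deriv by (intro continuous_on_vector_derivative) auto

lemma solutions_close:
  assumes T: "0 \<le> T" and x: "ode_solution_on \<phi> {0..T} x" "\<And>t. t \<in> {0..T} \<Longrightarrow> x t \<in> K"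
    and y: "ode_solution_on \<phi> {0..T} y" "\<And>t. t \<in> {0..T} \<Longrightarrow> y t \<in> K"
  shows "(norm (x T - y T))\<^sup>2 \<le> exp ((2 * lip + 1) * T) * (norm (x 0 - y 0))\<^sup>2"
proof -
  have "(norm (x T - y T))\<^sup>2 \<le> exp ((2 * lip + 1) * T) * ((norm (x 0 - y 0))\<^sup>2 + 0\<^sup>2 * T)"
  proof (rule gronwall_norm_squared[where u="\<lambda>t. x t - y t" and u'="\<lambda>t. \<phi> (x t) - \<phi> (y t)", OF T lip_cball(1)])
    show "((\<lambda>t. x t - y t) has_vector_derivative \<phi> (x t) - \<phi> (y t)) (at t within {0..T})" if "t \<in> {0..T}" for t
      using x(1) y(1) that by (intro has_vector_derivative_diff) (auto simp: ode_solution_on_def)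
    show "norm (\<phi> (x t) - \<phi> (y t)) \<le> lip * norm (x t - y t) + 0" if "t \<in> {0..T}" for t
      using lip_K[OF x(2) y(2)] that by simp
  qed
  then show ?thesis by simp
qed

lemma traj_solution: "a \<in> K \<Longrightarrow> ode_solution_on \<phi> {0..T} (traj a)"
  by (auto simp: ode_solution_on_def intro: traj_deriv_Icc)

text \<open>Forward invariance confines the competing solution to \<open>K\<close> as well, where
  the Lipschitz bound applies. This is what makes the description in \<open>flow\<close>
  definite.\<close>

lemma traj_unique:
  assumes a: "a \<in> K" and t: "0 \<le> t" and y: "y 0 = a" "ode_solution_on \<phi> {0..t} y"
  shows "y t = traj a t"
proof -
  have "y s \<in> K" if "s \<in> {0..t}" for s
    using invariant_K[unfolded forward_invariant_def] a t y that by blast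
  from solutions_close[OF t y(2) this traj_solution[OF a]] traj_in_K[OF a]
  have "(norm (y t - traj a t))\<^sup>2 \<le> exp ((2 * lip + 1) * t) * (norm (y 0 - traj a 0))\<^sup>2" by auto
  then show ?thesis using a y by simp
qed

lemma flow_eq_traj: "a \<in> K \<Longrightarrow> 0 \<le> t \<Longrightarrow> flow \<phi> t a = traj a t"
  unfolding flow_def by (rule the_equality) (auto intro!: exI[of _ "traj a"] traj_solution traj_unique)

lemma traj_add:
  assumes a: "a \<in> K" and st: "0 \<le> s" "0 \<le> t"
  shows "traj (traj a s) t = traj a (s + t)"
proof -
  have "(traj a \<circ> (+) s has_vector_derivative 1 *\<^sub>R \<phi> (traj a (s + r))) (at r within {0..t})" if "r \<in> {0..t}" for r
    by (rule vector_diff_chain_within)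
      (use that st in \<open>auto intro!: derivative_eq_intros has_vector_derivative_within_subset[OF traj_deriv[OF a]]\<close>)
  then have "ode_solution_on \<phi> {0..t} (traj a \<circ> (+) s)" by (auto simp: ode_solution_on_def)
  from traj_unique[OF traj_in_K[OF a st(1)] st(2) _ this] show ?thesis by simp
qed

lemma dist_traj_le:
  assumes "a \<in> K" "b \<in> K" "0 \<le> t" "t \<le> T"
  shows "norm (traj b t - traj a t) \<le> sqrt (exp ((2 * lip + 1) * T)) * norm (b - a)"
proof -
  have "(norm (traj b t - traj a t))\<^sup>2 \<le> exp ((2 * lip + 1) * t) * (norm (traj b 0 - traj a 0))\<^sup>2"
    using assms by (intro solutions_close traj_solution traj_in_K) auto
  also have "\<dots> \<le> exp ((2 * lip + 1) * T) * (norm (b - a))\<^sup>2"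
    using assms lip_cball(1) by (intro mult_mono) (auto intro!: mult_left_mono)
  also have "\<dots> = (sqrt (exp ((2 * lip + 1) * T)) * norm (b - a))\<^sup>2" by (simp add: power_mult_distrib)
  finally show ?thesis by (simp add: power2_le_iff_abs_le)
qed

lemma variational_solution_exists:
  assumes a: "a \<in> K"
  shows "\<exists>Z :: real \<Rightarrow> real^'n^'n. Z 0 = mat 1 \<and>
    (\<forall>t\<ge>0. (Z has_vector_derivative J (traj a t) ** Z t) (at t within {0..}))"
  proof (rule global_ode_solution_exists[where L=lip and M=0])
    show "continuous_on {0..} (\<lambda>t. J (traj a t) ** u t)" if "continuous_on {0..} u" for u :: "real \<Rightarrow> real^'n^'n"
      using that by (intro continuous_intros continuous_on_compose2[OF continuous_on_J[of UNIV] continuous_on_traj[OF a]]) auto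
    show "norm (J (traj a t) ** X - J (traj a t) ** Y) \<le> lip * norm (X - Y)" if "0 \<le> t" for t and X Y :: "real^'n^'n"
      unfolding matrix_diff_ldistrib[symmetric] using norm_J_le[OF traj_in_K[OF a that]]
      by (intro order_trans[OF norm_matrix_mult_le] mult_right_mono) auto
  qed (auto simp: bounded_bilinear.zero_right[OF bounded_bilinear_matrix_mult])

text \<open>The matrix stands for the Jacobian of the time \<open>t\<close> map, which as such may
  fail to exist, since solutions are only known to persist when they start in \<open>K\<close>;
  \<open>uniform_linearization\<close> is the substitute.\<close>

definition Z :: "real^'n \<Rightarrow> real \<Rightarrow> real^'n^'n" where
  "Z a = (SOME Z. Z 0 = mat 1 \<and> (\<forall>t\<ge>0. (Z has_vector_derivative J (traj a t) ** Z t) (at t within {0..})))"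

lemma Z_0 [simp]: "a \<in> K \<Longrightarrow> Z a 0 = mat 1"
  and Z_deriv: "a \<in> K \<Longrightarrow> 0 \<le> t \<Longrightarrow> (Z a has_vector_derivative J (traj a t) ** Z a t) (at t within {0..})"
  using someI_ex[OF variational_solution_exists, of a] unfolding Z_def by auto

lemma Z_deriv_Icc: "a \<in> K \<Longrightarrow> t \<in> {0..T} \<Longrightarrow> (Z a has_vector_derivative J (traj a t) ** Z a t) (at t within {0..T})"
  by (rule has_vector_derivative_within_subset[OF Z_deriv]) auto

lemma continuous_on_Z: "a \<in> K \<Longrightarrow> continuous_on {0..} (Z a)"
  using Z_deriv by (intro continuous_on_vector_derivative) auto

lemma Z_mult_vec_deriv:
  "a \<in> K \<Longrightarrow> t \<in> {0..T} \<Longrightarrow> ((\<lambda>t. Z a t *v v) has_vector_derivative J (traj a t) *v (Z a t *v v)) (at t within {0..T})"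
  using bounded_linear.has_vector_derivative[OF bounded_bilinear.bounded_linear_left[OF bounded_bilinear_matrix_vector_mult] Z_deriv_Icc]
  by (simp add: matrix_vector_mul_assoc)

lemma Z_growth_bounds:
  assumes a: "a \<in> K" and t: "0 \<le> t"
  shows "(Z a t *v v) \<bullet> (Z a t *v v) \<le> exp (2 * lip * t) * (v \<bullet> v)"
    "exp (- (2 * lip * t)) * (v \<bullet> v) \<le> (Z a t *v v) \<bullet> (Z a t *v v)"
proof -
  have "norm (J (traj a s) *v (Z a s *v v)) \<le> lip * norm (Z a s *v v)" if "s \<in> {0..t}" for s
    using norm_J_le[OF traj_in_K[OF a], of s] that
    by (intro order_trans[OF norm_matrix_vector_mult_le] mult_right_mono) auto
  from linear_growth_bounds[OF t Z_mult_vec_deriv[OF a] this] a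
  show "(Z a t *v v) \<bullet> (Z a t *v v) \<le> exp (2 * lip * t) * (v \<bullet> v)"
    "exp (- (2 * lip * t)) * (v \<bullet> v) \<le> (Z a t *v v) \<bullet> (Z a t *v v)" by auto
qed

lemma det_Z_nonzero:
  assumes "a \<in> K" "0 \<le> t"
  shows "det (Z a t) \<noteq> 0"
proof
  assume "det (Z a t) = 0"
  then obtain v where "v \<noteq> 0" "Z a t *v v = 0"
    using invertible_det_nz[of "Z a t"] matrix_left_invertible_ker[of "Z a t"] by (auto simp: invertible_left_inverse)
  then show False using Z_growth_bounds(2)[OF assms, of v]
    by (simp add: mult_le_0_iff) (metis inner_gt_zero_iff not_le)
qed

text \<open>Both sides solve the variational equation along the shifted trajectory with the same
  value at time 0, so their difference \<open>U\<close> vanishes by the growth bound.\<close>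

lemma Z_add:
  assumes a: "a \<in> K" and st: "0 \<le> s" "0 \<le> t"
  shows "Z a (s + t) = Z (traj a s) t ** Z a s"
proof -
  let ?b = "traj a s"
  have b: "?b \<in> K" using traj_in_K a st by blast
  define U where "U r = Z a (s + r) - Z ?b r ** Z a s" for r
  have "(U has_vector_derivative J (traj a (s + r)) ** U r) (at r within {0..t})" if r: "r \<in> {0..t}" for r
  proof -
    have "(Z a \<circ> (+) s has_vector_derivative 1 *\<^sub>R (J (traj a (s + r)) ** Z a (s + r))) (at r within {0..t})"
      by (rule vector_diff_chain_within)
        (use r st in \<open>auto intro!: derivative_eq_intros has_vector_derivative_within_subset[OF Z_deriv[OF a]]\<close>)
    moreover have "((\<lambda>r. Z ?b r ** Z a s) has_vector_derivative J (traj ?b r) ** Z ?b r ** Z a s) (at r within {0..t})"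
      by (rule bounded_linear.has_vector_derivative[OF bounded_bilinear.bounded_linear_left[OF bounded_bilinear_matrix_mult] Z_deriv_Icc[OF b r]])
    ultimately have "((\<lambda>r. (Z a \<circ> (+) s) r - Z ?b r ** Z a s) has_vector_derivative
        1 *\<^sub>R (J (traj a (s + r)) ** Z a (s + r)) - J (traj ?b r) ** Z ?b r ** Z a s) (at r within {0..t})"
      by (rule has_vector_derivative_diff)
    moreover have "traj ?b r = traj a (s + r)" using r by (intro traj_add a st) auto
    ultimately show ?thesis
      by (simp add: U_def[abs_def] matrix_diff_ldistrib matrix_mul_assoc)
  qed
  moreover have "norm (J (traj a (s + r)) ** U r) \<le> lip * norm (U r)" if "r \<in> {0..t}" for r
    using norm_J_le[OF traj_in_K[OF a], of "s + r"] that st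
    by (intro order_trans[OF norm_matrix_mult_le] mult_right_mono) auto
  ultimately have "U t \<bullet> U t \<le> exp (2 * lip * t) * (U 0 \<bullet> U 0)"
    by (rule linear_growth_bounds(1)[OF st(2)])
  moreover have "U 0 = 0" using b by (simp add: U_def)
  ultimately have "U t = 0" by simp (metis inner_gt_zero_iff not_le)
  then show ?thesis by (simp add: U_def)
qed

text \<open>The deviation \<open>u\<close> from the linear prediction solves the variational
  equation up to the Taylor remainder of \<open>\<phi>\<close>, which is small relative to the
  distance of the two trajectories.\<close>

lemma uniform_linearization:
  assumes T: "0 \<le> T" and e: "0 < e"
  obtains d where "0 < d" "\<And>a b t. a \<in> K \<Longrightarrow> b \<in> K \<Longrightarrow> dist a b < d \<Longrightarrow> t \<in> {0..T} \<Longrightarrow>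
    norm (traj b t - traj a t - Z a t *v (b - a)) \<le> e * norm (b - a)"
proof -
  define E where "E = exp ((2 * lip + 1) * T)"
  have E: "1 \<le> E" using lip_cball(1) T by (simp add: E_def)
  \<comment> \<open>Of the factor \<open>E\<close>, one square root is the growth of the distance
    between trajectories and the other comes from Gronwall's inequality; \<open>T + 1\<close>
    absorbs the square root of the integration time.\<close>
  define \<eta> where "\<eta> = e / (E * (T + 1))"
  have \<eta>: "0 < \<eta>" using e E T by (simp add: \<eta>_def)
  obtain d where d: "0 < d" "\<And>x y. x \<in> cball 0 ball_radius \<Longrightarrow> y \<in> cball 0 ball_radius \<Longrightarrow> dist x y < d \<Longrightarrow>
      norm (\<phi> y - \<phi> x - J x *v (y - x)) \<le> \<eta> * norm (y - x)"
    using class_C1_uniform_linearization[OF C1 compact_cball convex_cball \<eta>] by blast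
  have "norm (traj b t - traj a t - Z a t *v (b - a)) \<le> e * norm (b - a)"
    if a: "a \<in> K" and b: "b \<in> K" and ab: "dist a b < d / sqrt E" and t: "t \<in> {0..T}" for a b t
  proof -
    define w where "w s = traj b s - traj a s" for s
    define u where "u s = w s - Z a s *v (b - a)" for s
    define u' where "u' s = \<phi> (traj b s) - \<phi> (traj a s) - J (traj a s) *v (Z a s *v (b - a))" for s
    have w: "norm (w s) \<le> sqrt E * norm (b - a)" if "s \<in> {0..t}" for s
      unfolding w_def E_def using that t by (intro dist_traj_le a b) auto
    have du: "(u has_vector_derivative u' s) (at s within {0..t})" if "s \<in> {0..t}" for s
      unfolding u_def[abs_def] u'_def w_def
      by (intro has_vector_derivative_diff traj_deriv_Icc Z_mult_vec_deriv a b that)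
    have bu: "norm (u' s) \<le> lip * norm (u s) + \<eta> * (sqrt E * norm (b - a))" if s: "s \<in> {0..t}" for s
    proof -
      have K: "traj a s \<in> K" "traj b s \<in> K" using s a b traj_in_K by auto
      have "norm (w s) < d"
      proof -
        have "norm (b - a) < d / sqrt E" using ab by (simp add: dist_norm norm_minus_commute)
        then have "sqrt E * norm (b - a) < d" using E by (simp add: field_simps)
        then show ?thesis using w[OF s] by linarith
      qed
      then have r: "norm (\<phi> (traj b s) - \<phi> (traj a s) - J (traj a s) *v w s) \<le> \<eta> * norm (w s)"
        unfolding w_def using K by (intro d(2) K_cball) (auto simp: dist_norm norm_minus_commute)
      have "u' s = J (traj a s) *v u s + (\<phi> (traj b s) - \<phi> (traj a s) - J (traj a s) *v w s)"
        by (simp add: u'_def u_def matrix_vector_mult_diff_distrib)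
      then have "norm (u' s) \<le> norm (J (traj a s) *v u s) + norm (\<phi> (traj b s) - \<phi> (traj a s) - J (traj a s) *v w s)"
        by (metis norm_triangle_ineq)
      also have "norm (J (traj a s) *v u s) \<le> lip * norm (u s)"
        using norm_J_le[OF K(1)] by (intro order_trans[OF norm_matrix_vector_mult_le] mult_right_mono) auto
      also have "norm (\<phi> (traj b s) - \<phi> (traj a s) - J (traj a s) *v w s) \<le> \<eta> * (sqrt E * norm (b - a))"
        using r mult_left_mono[OF w[OF s], of \<eta>] \<eta> by linarith
      finally show ?thesis by simp
    qed
    have t': "0 \<le> t" "t \<le> T" using t by auto
    have "(norm (u t))\<^sup>2 \<le> exp ((2 * lip + 1) * t) * ((norm (u 0))\<^sup>2 + (\<eta> * (sqrt E * norm (b - a)))\<^sup>2 * t)"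
      by (rule gronwall_norm_squared[OF t'(1) lip_cball(1) du bu])
    also have "\<dots> \<le> E * ((\<eta> * (sqrt E * norm (b - a)))\<^sup>2 * T)"
      unfolding E_def using t' lip_cball(1) a b by (intro mult_mono) (auto simp: u_def w_def intro!: mult_left_mono)
    also have "\<dots> = (\<eta> * E * norm (b - a))\<^sup>2 * T" using E by (simp add: power_mult_distrib power2_eq_square)
    also have "\<dots> \<le> (\<eta> * E * norm (b - a))\<^sup>2 * (T + 1)\<^sup>2"
    proof -
      have "T \<le> (T + 1)\<^sup>2" using T by (simp add: power2_eq_square algebra_simps)
      then show ?thesis by (intro mult_left_mono) auto
    qed
    also have "\<dots> = (e * norm (b - a))\<^sup>2" using E T by (simp add: \<eta>_def power_mult_distrib[symmetric])
    finally have "(norm (u t))\<^sup>2 \<le> (e * norm (b - a))\<^sup>2" .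
    then have "norm (u t) \<le> e * norm (b - a)" using e by (simp add: power2_le_iff_abs_le)
    then show ?thesis by (simp add: u_def w_def)
  qed
  moreover have "0 < d / sqrt E" using d E by simp
  ultimately show ?thesis using that by blast
qed

lemma continuous_on_traj_joint: "0 \<le> T \<Longrightarrow> continuous_on (K \<times> {0..T}) (\<lambda>(a, t). traj a t)"
proof (rule continuous_on_Times_equicontinuous)
  show "continuous_on {0..T} (traj a)" if "a \<in> K" for a
    using continuous_on_traj[OF that] by (rule continuous_on_subset) auto
  fix a and e :: real assume a: "a \<in> K" and e: "0 < e" and T: "0 \<le> T"
  define E where "E = exp ((2 * lip + 1) * T)"
  have E: "0 < E" by (simp add: E_def)
  have "dist (traj b t) (traj a t) < e" if b: "b \<in> K" and ab: "dist b a < e / sqrt E" and t: "t \<in> {0..T}" for b t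
  proof -
    have "norm (traj b t - traj a t) \<le> sqrt E * norm (b - a)"
      using dist_traj_le[OF a b, of t T] t by (simp add: E_def)
    also have "\<dots> < e" using ab E by (simp add: dist_norm field_simps)
    finally show ?thesis by (simp add: dist_norm)
  qed
  then show "\<exists>d>0. \<forall>b\<in>K. dist b a < d \<longrightarrow> (\<forall>t\<in>{0..T}. dist (traj b t) (traj a t) < e)"
    using e E by (intro exI[of _ "e / sqrt E"]) auto
qed

text \<open>The difference of the solutions for two initial points solves a linear equation with
  source \<open>(J (traj b s) - J (traj a s)) ** Z a s\<close>, uniformly small by uniform
  continuity of \<open>J\<close> on \<open>K\<close>.\<close>

lemma continuous_on_Z_joint: "0 \<le> T \<Longrightarrow> continuous_on (K \<times> {0..T}) (\<lambda>(a, t). Z a t)"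
proof (rule continuous_on_Times_equicontinuous)
  show cZ: "continuous_on {0..T} (Z a)" if "a \<in> K" for a
    using continuous_on_Z[OF that] by (rule continuous_on_subset) auto
  fix a and e :: real assume a: "a \<in> K" and e: "0 < e" and T: "0 \<le> T"
  define E where "E = exp ((2 * lip + 1) * T)"
  have E: "1 \<le> E" using lip_cball(1) T by (simp add: E_def)
  have "bounded (Z a ` {0..T})" using compact_continuous_image[OF cZ[OF a]] compact_imp_bounded by blast
  then obtain C where C: "0 < C" "\<And>t. t \<in> {0..T} \<Longrightarrow> norm (Z a t) \<le> C" by (auto simp: bounded_pos)
  define \<eta> where "\<eta> = e / (2 * E * (T + 1) * C)"
  have \<eta>: "0 < \<eta>" using e E T C by (simp add: \<eta>_def)
  have "uniformly_continuous_on K J" by (intro compact_uniformly_continuous continuous_on_J compact_K)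
  then obtain d1 where d1: "0 < d1" "\<And>x y. x \<in> K \<Longrightarrow> y \<in> K \<Longrightarrow> dist y x < d1 \<Longrightarrow> dist (J y) (J x) < \<eta>"
    using \<eta> unfolding uniformly_continuous_on_def by metis
  have "dist (Z b t) (Z a t) < e" if b: "b \<in> K" and ab: "dist b a < d1 / sqrt E" and t: "t \<in> {0..T}" for b t
  proof -
    define u where "u s = Z b s - Z a s" for s
    define u' where "u' s = J (traj b s) ** Z b s - J (traj a s) ** Z a s" for s
    have du: "(u has_vector_derivative u' s) (at s within {0..t})" if "s \<in> {0..t}" for s
      unfolding u_def[abs_def] u'_def by (intro has_vector_derivative_diff Z_deriv_Icc a b that)
    have bu: "norm (u' s) \<le> lip * norm (u s) + \<eta> * C" if s: "s \<in> {0..t}" for s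
    proof -
      have K: "traj a s \<in> K" "traj b s \<in> K" using s a b traj_in_K by auto
      have "norm (traj b s - traj a s) \<le> sqrt E * norm (b - a)"
        using dist_traj_le[OF a b, of s T] s t by (simp add: E_def)
      also have "\<dots> < d1" using ab E by (simp add: dist_norm field_simps)
      finally have dJ: "norm (J (traj b s) - J (traj a s)) \<le> \<eta>"
        using d1(2)[OF K] by (simp add: dist_norm)
      have "u' s = J (traj b s) ** u s + (J (traj b s) - J (traj a s)) ** Z a s"
        by (simp add: u'_def u_def matrix_diff_ldistrib matrix_diff_rdistrib)
      then have "norm (u' s) \<le> norm (J (traj b s) ** u s) + norm ((J (traj b s) - J (traj a s)) ** Z a s)"
        by (metis norm_triangle_ineq)
      also have "norm (J (traj b s) ** u s) \<le> lip * norm (u s)"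
        using norm_J_le[OF K(2)] by (intro order_trans[OF norm_matrix_mult_le] mult_right_mono) auto
      also have "norm ((J (traj b s) - J (traj a s)) ** Z a s) \<le> \<eta> * C"
        using dJ C(2)[of s] s t \<eta> by (intro order_trans[OF norm_matrix_mult_le] mult_mono) auto
      finally show ?thesis by simp
    qed
    have t': "0 \<le> t" "t \<le> T" using t by auto
    have "(norm (u t))\<^sup>2 \<le> exp ((2 * lip + 1) * t) * ((norm (u 0))\<^sup>2 + (\<eta> * C)\<^sup>2 * t)"
      by (rule gronwall_norm_squared[OF t'(1) lip_cball(1) du bu])
    also have "\<dots> \<le> E * ((\<eta> * C)\<^sup>2 * T)"
      unfolding E_def using t' lip_cball(1) a b by (intro mult_mono) (auto simp: u_def intro!: mult_left_mono)
    also have "\<dots> \<le> E\<^sup>2 * ((\<eta> * C)\<^sup>2 * (T + 1)\<^sup>2)"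
    proof -
      have "T \<le> (T + 1)\<^sup>2" "E \<le> E\<^sup>2" using E T by (simp_all add: power2_eq_square algebra_simps)
      then show ?thesis using T by (intro mult_mono mult_left_mono) auto
    qed
    also have "\<dots> = (e / 2)\<^sup>2" using E T C by (simp add: \<eta>_def power_mult_distrib[symmetric])
    finally have "norm (u t) \<le> e / 2" using e by (simp add: power2_le_iff_abs_le)
    then show ?thesis using e by (simp add: u_def dist_norm)
  qed
  then show "\<exists>d>0. \<forall>b\<in>K. dist b a < d \<longrightarrow> (\<forall>t\<in>{0..T}. dist (Z b t) (Z a t) < e)"
    using d1(1) E by (intro exI[of _ "d1 / sqrt E"]) auto
qed

end

section \<open>Covering ellipsoids by balls\<close>

text \<open>Geometrically this is the volume factor of the map from \<open>x\<close> to the pair of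
  \<open>x\<close> and \<open>Z *v x\<close>. A contracted direction still counts with a factor of
  at least 1, just as a covering needs at least one ball across it.\<close>

definition vol_expansion :: "real^'n^'n \<Rightarrow> real" where
  "vol_expansion Z = sqrt (det (mat 1 + transpose Z ** Z))"

lemma orthogonal_mult_transpose:
  fixes S :: "real^'n^'n"
  assumes "transpose S ** S = mat 1"
  shows "S *v (transpose S *v x) = x" "(S *v x) \<bullet> (S *v y) = x \<bullet> y"
proof -
  have "S ** transpose S = mat 1" using assms by (simp add: matrix_left_right_inverse)
  then show "S *v (transpose S *v x) = x"
    by (simp only: matrix_vector_mul_assoc matrix_vector_mul_lid)
  show "(S *v x) \<bullet> (S *v y) = x \<bullet> y"
    using inner_transpose_mult[of x S "S *v y"]
    by (simp only: matrix_vector_mul_assoc assms matrix_vector_mul_lid)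
qed

lemma orthogonal_norm:
  fixes S :: "real^'n^'n"
  assumes "transpose S ** S = mat 1"
  shows "norm (S *v x) = norm x"
  using orthogonal_mult_transpose(2)[OF assms, of x x] by (simp add: norm_eq_sqrt_inner)

lemma inner_mat_1_plus: "u \<bullet> ((mat 1 + M ** transpose M) *v u) = u \<bullet> u + (transpose M *v u) \<bullet> (transpose M *v u)"
  for M :: "real^'n^'n"
proof -
  have "u \<bullet> ((M ** transpose M) *v u) = (transpose M *v u) \<bullet> (transpose M *v u)"
    using inner_transpose_mult[of u "transpose M" "transpose M *v u"]
    by (simp only: transpose_transpose matrix_vector_mul_assoc)
  then show ?thesis by (simp only: matrix_vector_mult_add_rdistrib inner_add_right matrix_vector_mul_lid)
qed

lemma sqrt_prod: "sqrt (\<Prod>i\<in>A. f i) = (\<Prod>i\<in>A. sqrt (f i))"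
  by (induction A rule: infinite_finite_induct) (simp_all add: real_sqrt_mult)

text \<open>The image of the unit ball under \<open>Z\<close>, enlarged by the unit ball, is an ellipsoid up to a
  factor of 2. Its principal axes diagonalise \<open>I + Z Z\<^sup>T\<close>, which has the same determinant as
  \<open>I + Z\<^sup>T Z\<close>.\<close>

lemma principal_axes:
  fixes Z :: "real^'n^'n"
  assumes Z: "det Z \<noteq> 0"
  obtains S :: "real^'n^'n" and r where "transpose S ** S = mat 1" "\<And>i. 1 \<le> r i"
    "pullback S (mat 1 + Z ** transpose Z) = diagm (\<lambda>i. (r i)\<^sup>2)" "(\<Prod>i\<in>UNIV. r i) = vol_expansion Z"
proof -
  let ?G = "mat 1 + Z ** transpose Z"
  have "transpose ?G = ?G" by (simp add: transpose_add matrix_transpose_mul transpose_mat)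
  then obtain S :: "real^'n^'n" and d where S: "transpose S ** S = mat 1" "pullback S ?G = diagm d"
    using symmetric_spectral by blast
  have d: "1 \<le> d i" for i
  proof -
    define u where "u = S *v axis i 1"
    have "d i = u \<bullet> (?G *v u)" unfolding u_def pullback_inner[symmetric] S diagm_axis_inner ..
    also have "\<dots> = 1 + (transpose Z *v u) \<bullet> (transpose Z *v u)"
      unfolding inner_mat_1_plus by (simp add: u_def orthogonal_mult_transpose(2)[OF S(1)] inner_axis_axis)
    finally show ?thesis by simp
  qed
  have d0: "0 \<le> d i" for i using d[of i] by linarith
  have "(det S)\<^sup>2 = 1" using arg_cong[OF S(1), of det] by (simp add: det_mul power2_eq_square)
  then have "det ?G = (\<Prod>i\<in>UNIV. d i)"
    using arg_cong[OF S(2), of det] by (simp add: det_pullback det_diagm)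
  moreover have "det ?G = det (mat 1 + transpose Z ** Z)"
  proof -
    \<comment> \<open>Since \<open>det Z\<close> is nonzero, it cancels from the determinants of
      both sides of this intertwining relation.\<close>
    have "Z ** (mat 1 + transpose Z ** Z) = ?G ** Z"
      by (simp add: matrix_add_ldistrib matrix_add_rdistrib matrix_mul_assoc)
    from arg_cong[OF this, of det] show ?thesis using Z by (simp add: det_mul)
  qed
  ultimately have "(\<Prod>i\<in>UNIV. sqrt (d i)) = vol_expansion Z"
    by (simp add: vol_expansion_def sqrt_prod)
  then show ?thesis using that[of S "\<lambda>i. sqrt (d i)"] S d d0 by simp
qed

text \<open>The points of a grid of mesh \<open>\<delta> / m\<close> serve as centres. The count
  along axis \<open>i\<close> is proportional to \<open>r i\<close> because
  \<open>r i \<ge> 1\<close> absorbs the rounding terms.\<close>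

lemma cover_box:
  fixes S :: "real^'n^'n" and r :: "'n \<Rightarrow> real"
  assumes S: "transpose S ** S = mat 1" and r: "\<And>i. 1 \<le> r i" and \<delta>: "0 < \<delta>"
  shows "\<exists>C. finite C \<and> real (card C) \<le> (4 * CARD('n) + 7) ^ CARD('n) * (\<Prod>i\<in>UNIV. r i) \<and>
    (\<forall>y. (\<forall>i. \<bar>y $ i\<bar> \<le> 2 * \<delta> * r i) \<longrightarrow> (\<exists>c\<in>C. p + S *v y \<in> ball c \<delta>))"
proof -
  \<comment> \<open>With \<open>CARD('n) + 1\<close> instead of \<open>CARD('n)\<close> the sum of
    the coordinate errors stays strictly below \<open>\<delta>\<close>, as open balls
    require.\<close>
  define m :: real where "m = CARD('n) + 1"
  have m: "0 < m" by (simp add: m_def)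
  define I where "I i = {- \<lceil>2 * r i * m\<rceil> .. \<lceil>2 * r i * m\<rceil>}" for i
  define g where "g k = p + S *v (\<chi> i. \<delta> / m * of_int (k i))" for k :: "'n \<Rightarrow> int"
  define C where "C = g ` PiE UNIV I"
  have fin: "finite (PiE UNIV I)" by (intro finite_PiE) (auto simp: I_def)
  have "real (card C) \<le> real (card (PiE UNIV I))"
    unfolding C_def by (intro of_nat_mono card_image_le fin)
  also have "\<dots> = (\<Prod>i\<in>UNIV. real (card (I i)))" by (simp add: card_PiE)
  also have "\<dots> \<le> (\<Prod>i\<in>UNIV. (4 * CARD('n) + 7) * r i)"
  proof (rule prod_mono)
    fix i
    have "0 \<le> 2 * r i * m" using r[of i] m by simp
    then have "0 \<le> \<lceil>2 * r i * m\<rceil>" by linarith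
    then have "real (card (I i)) = 2 * of_int \<lceil>2 * r i * m\<rceil> + 1"
      by (simp add: I_def)
    also have "\<dots> \<le> 2 * (2 * r i * m + 1) + 1" 
      by (intro add_right_mono mult_left_mono of_int_ceiling_le_add_one) auto
    \<comment> \<open>With \<open>n = CARD('n)\<close> this reads
      \<open>4 * (n + 1) * r i + 3 \<le> (4 * n + 7) * r i\<close>.\<close>
    also have "\<dots> \<le> (4 * CARD('n) + 7) * r i" using r[of i] by (simp add: m_def algebra_simps)
    finally show "0 \<le> real (card (I i)) \<and> real (card (I i)) \<le> (4 * CARD('n) + 7) * r i" by simp
  qed
  also have "\<dots> = (4 * CARD('n) + 7) ^ CARD('n) * (\<Prod>i\<in>UNIV. r i)" by (simp add: prod.distrib)
  finally have card: "real (card C) \<le> (4 * CARD('n) + 7) ^ CARD('n) * (\<Prod>i\<in>UNIV. r i)" .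
  have "\<exists>c\<in>C. p + S *v y \<in> ball c \<delta>" if y: "\<forall>i. \<bar>y $ i\<bar> \<le> 2 * \<delta> * r i" for y
  proof
    define k where "k i = \<lfloor>y $ i * m / \<delta>\<rfloor>" for i
    have "k i \<in> I i" for i
    proof -
      have "\<bar>y $ i * m / \<delta>\<bar> \<le> 2 * r i * m"
        using y[rule_format, of i] \<delta> m by (simp add: abs_mult field_simps)
      then show ?thesis unfolding I_def k_def by (simp, linarith)
    qed
    then show "g k \<in> C" by (auto simp: C_def)
    have "norm (y - (\<chi> i. \<delta> / m * of_int (k i))) \<le> (\<Sum>i\<in>UNIV. \<bar>(y - (\<chi> i. \<delta> / m * of_int (k i))) $ i\<bar>)"
      by (rule norm_le_l1_cart)
    also have "\<dots> \<le> (\<Sum>i\<in>(UNIV :: 'n set). \<delta> / m)"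
    proof (rule sum_mono)
      fix i
      have "\<bar>y $ i * m / \<delta> - of_int (k i)\<bar> \<le> 1" unfolding k_def by linarith
      then have "\<delta> / m * \<bar>y $ i * m / \<delta> - of_int (k i)\<bar> \<le> \<delta> / m * 1"
        using \<delta> m by (intro mult_left_mono) auto
      moreover have "\<delta> / m * \<bar>y $ i * m / \<delta> - of_int (k i)\<bar> = \<bar>\<delta> / m * (y $ i * m / \<delta> - of_int (k i))\<bar>"
        using \<delta> m by (simp add: abs_mult)
      moreover have "\<delta> / m * (y $ i * m / \<delta> - of_int (k i)) = y $ i - \<delta> / m * of_int (k i)"
        using \<delta> m by (simp add: right_diff_distrib)
      ultimately show "\<bar>(y - (\<chi> i. \<delta> / m * of_int (k i))) $ i\<bar> \<le> \<delta> / m"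
        by (simp only: vector_minus_component vec_lambda_beta mult_1_right)
    qed
    also have "\<dots> < \<delta>" using \<delta> by (simp add: m_def field_simps)
    finally have "norm (S *v (y - (\<chi> i. \<delta> / m * of_int (k i)))) < \<delta>" by (simp only: orthogonal_norm[OF S])
    then show "p + S *v y \<in> ball (g k) \<delta>"
      by (simp add: g_def dist_norm norm_minus_commute matrix_vector_mult_diff_distrib)
  qed
  with card fin show ?thesis by (intro exI[of _ C]) (auto simp: C_def)
qed

text \<open>Packing argument: grid points at least \<open>7 * \<delta>\<close> apart lie in
  different balls of radius \<open>3 * \<delta>\<close>, whose points have distance less than
  \<open>6 * \<delta>\<close>.\<close>

lemma cover_box_lower:
  fixes S :: "real^'n^'n" and r :: "'n \<Rightarrow> real"
  assumes S: "transpose S ** S = mat 1" and r: "\<And>i. 1 \<le> r i" and \<delta>: "0 < \<delta>" and C: "finite C"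
    and cov: "\<And>y. (\<And>i. \<bar>y $ i\<bar> < \<delta> * r i / CARD('n)) \<Longrightarrow> \<exists>c\<in>C. p + S *v y \<in> ball c (3 * \<delta>)"
  shows "(\<Prod>i\<in>UNIV. r i) \<le> (7 * CARD('n)) ^ CARD('n) * card C"
proof -
  \<comment> \<open>The indices start at 0, so even the largest one is below
    \<open>r i / (7 * CARD('n))\<close> despite the ceiling, and the grid stays in the box.\<close>
  define I where "I i = {..<nat \<lceil>r i / (7 * CARD('n))\<rceil>}" for i
  define Y :: "('n \<Rightarrow> nat) \<Rightarrow> real^'n" where "Y k = (\<chi> i. 7 * \<delta> * real (k i))" for k
  have fin: "finite (PiE UNIV I)" by (intro finite_PiE) (auto simp: I_def)
  have "\<exists>c\<in>C. p + S *v Y k \<in> ball c (3 * \<delta>)" if k: "k \<in> PiE UNIV I" for k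
  proof (rule cov)
    fix i
    have "real (k i) < r i / (7 * CARD('n))"
    proof -
      have "int (k i) < \<lceil>r i / (7 * CARD('n))\<rceil>" using k by (simp add: I_def PiE_iff zless_nat_eq_int_zless del: zless_nat_conj)
      then show ?thesis by (simp add: less_ceiling_iff)
    qed
    then have "\<delta> * (7 * real (k i)) < \<delta> * (r i / CARD('n))"
      using \<delta> by (intro mult_strict_left_mono) (auto simp: field_simps)
    then show "\<bar>Y k $ i\<bar> < \<delta> * r i / CARD('n)" using \<delta> by (simp add: Y_def abs_mult mult_ac)
  qed
  then obtain f where f: "\<And>k. k \<in> PiE UNIV I \<Longrightarrow> f k \<in> C"
    "\<And>k. k \<in> PiE UNIV I \<Longrightarrow> p + S *v Y k \<in> ball (f k) (3 * \<delta>)" by metis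
  have "inj_on f (PiE UNIV I)"
  proof (rule inj_onI, rule ccontr)
    fix k l assume k: "k \<in> PiE UNIV I" and l: "l \<in> PiE UNIV I" and eq: "f k = f l" and ne: "k \<noteq> l"
    then obtain i where i: "k i \<noteq> l i" by (auto simp: fun_eq_iff)
    have "7 * \<delta> * 1 \<le> 7 * \<delta> * \<bar>real (k i) - real (l i)\<bar>"
      using i \<delta> by (intro mult_left_mono) auto
    also have "\<dots> = \<bar>7 * \<delta> * (real (k i) - real (l i))\<bar>" using \<delta> by (simp add: abs_mult)
    also have "\<dots> = \<bar>(Y k - Y l) $ i\<bar>" by (simp add: Y_def right_diff_distrib)
    also have "\<dots> \<le> norm (Y k - Y l)" by (rule component_le_norm_cart)
    also have "\<dots> = norm (S *v (Y k - Y l))" by (simp only: orthogonal_norm[OF S])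
    also have "\<dots> = dist (p + S *v Y k) (p + S *v Y l)"
      by (simp add: dist_norm matrix_vector_mult_diff_distrib)
    also have "\<dots> < 3 * \<delta> + 3 * \<delta>"
      using f(2)[OF k] f(2)[OF l] eq dist_triangle[of "p + S *v Y k" "p + S *v Y l" "f k"]
      by (simp add: dist_commute)
    finally show False using \<delta> by simp
  qed
  then have "card (PiE UNIV I) \<le> card C" using f(1) C by (intro card_inj_on_le[of f]) auto
  then have "(\<Prod>i\<in>UNIV. real (card (I i))) \<le> real (card C)"
    by (simp add: card_PiE flip: of_nat_prod)
  moreover have "(\<Prod>i\<in>UNIV. r i / (7 * CARD('n))) \<le> (\<Prod>i\<in>UNIV. real (card (I i)))"
  proof (rule prod_mono)
    fix i
    have "0 \<le> r i" using r[of i] by linarith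
    then show "0 \<le> r i / (7 * CARD('n)) \<and> r i / (7 * CARD('n)) \<le> real (card (I i))"
      by (simp add: I_def) (linarith)?
  qed
  ultimately have "(\<Prod>i\<in>UNIV. r i / (7 * CARD('n))) \<le> real (card C)" by linarith
  then show ?thesis by (simp add: prod_dividef field_simps)
qed

text \<open>For the principal axis \<open>u\<close> belonging to \<open>r i\<close>, the norms of
  \<open>u\<close> and of \<open>transpose Z *v u\<close> are at most \<open>r i\<close>, so the
  coordinate of \<open>Z *v x + y\<close> along \<open>u\<close> is at most
  \<open>2 * \<delta> * r i\<close>.\<close>

theorem cover_ellipsoid:
  fixes Z :: "real^'n^'n"
  assumes Z: "det Z \<noteq> 0" and \<delta>: "0 < \<delta>"
  shows "\<exists>C. finite C \<and> real (card C) \<le> (4 * CARD('n) + 7) ^ CARD('n) * vol_expansion Z \<and>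
    (\<forall>x y. norm x \<le> \<delta> \<longrightarrow> norm y \<le> \<delta> \<longrightarrow> (\<exists>c\<in>C. p + (Z *v x + y) \<in> ball c \<delta>))"
proof -
  obtain S :: "real^'n^'n" and r where S: "transpose S ** S = mat 1" and r: "\<And>i. 1 \<le> r i"
    and diag: "pullback S (mat 1 + Z ** transpose Z) = diagm (\<lambda>i. (r i)\<^sup>2)"
    and prod: "(\<Prod>i\<in>UNIV. r i) = vol_expansion Z"
    using principal_axes[OF Z] by blast
  obtain C where C: "finite C" "real (card C) \<le> (4 * CARD('n) + 7) ^ CARD('n) * vol_expansion Z"
    and cov: "\<And>y. (\<And>i. \<bar>y $ i\<bar> \<le> 2 * \<delta> * r i) \<Longrightarrow> \<exists>c\<in>C. p + S *v y \<in> ball c \<delta>"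
    using cover_box[where r=r and p=p, OF S r \<delta>] unfolding prod by blast
  have "\<exists>c\<in>C. p + (Z *v x + y) \<in> ball c \<delta>" if x: "norm x \<le> \<delta>" and y: "norm y \<le> \<delta>" for x y
  proof -
    define w where "w = transpose S *v (Z *v x + y)"
    have "\<bar>w $ i\<bar> \<le> 2 * \<delta> * r i" for i
    proof -
      define u where "u = S *v axis i 1"
      have ri: "0 \<le> r i" using r[of i] by linarith
      have "w $ i = axis i 1 \<bullet> (transpose S *v (Z *v x + y))" by (simp add: inner_axis' w_def)
      also have "\<dots> = u \<bullet> (Z *v x) + u \<bullet> y"
        unfolding inner_transpose_mult u_def by (simp add: inner_add_right)
      also have "u \<bullet> (Z *v x) = (transpose Z *v u) \<bullet> x"
        using inner_transpose_mult[of u "transpose Z" x] by (simp only: transpose_transpose)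
      finally have wi: "w $ i = (transpose Z *v u) \<bullet> x + u \<bullet> y" .
      have "(r i)\<^sup>2 = u \<bullet> u + (transpose Z *v u) \<bullet> (transpose Z *v u)"
        unfolding inner_mat_1_plus[symmetric] u_def pullback_inner[symmetric] diag diagm_axis_inner ..
      then have "(norm u)\<^sup>2 \<le> (r i)\<^sup>2" "(norm (transpose Z *v u))\<^sup>2 \<le> (r i)\<^sup>2"
        unfolding power2_norm_eq_inner using inner_ge_zero[of u] inner_ge_zero[of "transpose Z *v u"] by linarith+
      then have nu: "norm u \<le> r i" "norm (transpose Z *v u) \<le> r i"
        using ri by (metis power2_le_imp_le)+
      have "\<bar>w $ i\<bar> \<le> norm (transpose Z *v u) * norm x + norm u * norm y"
        unfolding wi using Cauchy_Schwarz_ineq2[of "transpose Z *v u" x] Cauchy_Schwarz_ineq2[of u y] by linarith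
      also have "\<dots> \<le> r i * \<delta> + r i * \<delta>"
        using nu x y ri by (intro add_mono mult_mono) auto
      finally show ?thesis by (simp add: mult_ac)
    qed
    from cov[OF this] show ?thesis unfolding w_def orthogonal_mult_transpose(1)[OF S] .
  qed
  with C show ?thesis by blast
qed

text \<open>Every box point is reached: if \<open>s\<close> solves
  \<open>(I + Z Z^T) s = S w\<close>, then \<open>x = Z^T s\<close> and \<open>y = s\<close> work,
  since \<open>|s|^2 + |Z^T s|^2\<close> is the sum of the squares of \<open>w $ i / r i\<close>.
  Dividing the box by \<open>CARD('n)\<close> makes this sum less than the square of
  \<open>\<delta>\<close>.\<close>

theorem cover_ellipsoid_lower:
  fixes Z :: "real^'n^'n"
  assumes Z: "det Z \<noteq> 0" and \<delta>: "0 < \<delta>" and C: "finite C"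
    and cov: "\<And>x y. norm x < \<delta> \<Longrightarrow> norm y < \<delta> \<Longrightarrow> \<exists>c\<in>C. p + (Z *v x + y) \<in> ball c (3 * \<delta>)"
  shows "vol_expansion Z \<le> (7 * CARD('n)) ^ CARD('n) * card C"
proof -
  obtain S :: "real^'n^'n" and r where S: "transpose S ** S = mat 1" and r: "\<And>i. 1 \<le> r i"
    and diag: "pullback S (mat 1 + Z ** transpose Z) = diagm (\<lambda>i. (r i)\<^sup>2)"
    and prod: "(\<Prod>i\<in>UNIV. r i) = vol_expansion Z"
    using principal_axes[OF Z] by blast
  have r0: "0 < r i" for i using r[of i] by linarith
  have "\<exists>c\<in>C. p + S *v w \<in> ball c (3 * \<delta>)" if w: "\<And>i. \<bar>w $ i\<bar> < \<delta> * r i / CARD('n)" for w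
  proof -
    define s' where "s' = (\<chi> i. w $ i / (r i)\<^sup>2)"
    define s where "s = S *v s'"
    have diag_s: "diagm (\<lambda>i. (r i)\<^sup>2) *v s' = w"
      using r0 by (simp add: diagm_mult_vec s'_def vec_eq_iff less_imp_neq[THEN not_sym])
    have "(mat 1 + Z ** transpose Z) *v s = S *v (transpose S *v ((mat 1 + Z ** transpose Z) *v s))"
      by (rule orthogonal_mult_transpose(1)[OF S, symmetric])
    also have "\<dots> = S *v w" unfolding s_def pullback_mult_vec[symmetric] diag diag_s ..
    finally have Sw: "S *v w = Z *v (transpose Z *v s) + s"
      unfolding matrix_vector_mult_add_rdistrib matrix_vector_mul_lid matrix_vector_mul_assoc[symmetric]
      by (simp only: add.commute)
    have "s \<bullet> s + (transpose Z *v s) \<bullet> (transpose Z *v s) = s' \<bullet> (diagm (\<lambda>i. (r i)\<^sup>2) *v s')"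
      unfolding inner_mat_1_plus[symmetric] diag[symmetric] pullback_inner s_def ..
    also have "\<dots> = (\<Sum>i\<in>UNIV. (w $ i / r i)\<^sup>2)"
      unfolding diag_s inner_vec_def by (rule sum.cong) (simp_all add: s'_def power2_eq_square)
    also have "\<dots> < (\<Sum>i\<in>(UNIV::'n set). (\<delta> / CARD('n))\<^sup>2)"
    proof (rule sum_strict_mono)
      fix i
      have "\<bar>w $ i / r i\<bar> < \<bar>\<delta> / CARD('n)\<bar>" using w[of i] r0[of i] \<delta> by (simp add: field_simps)
      then show "(w $ i / r i)\<^sup>2 < (\<delta> / CARD('n))\<^sup>2" by (metis abs_ge_zero power2_abs power_strict_mono zero_less_numeral)
    qed auto
    also have "\<dots> \<le> \<delta>\<^sup>2"
      using \<delta> by (simp add: power2_eq_square field_simps)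
    finally have "(norm s)\<^sup>2 < \<delta>\<^sup>2" "(norm (transpose Z *v s))\<^sup>2 < \<delta>\<^sup>2"
      unfolding power2_norm_eq_inner using inner_ge_zero[of s] inner_ge_zero[of "transpose Z *v s"] by linarith+
    then have "norm s < \<delta>" "norm (transpose Z *v s) < \<delta>"
      using \<delta> by (metis less_imp_le power_less_imp_less_base)+
    from cov[OF this(2,1)] show ?thesis unfolding Sw .
  qed
  from cover_box_lower[where r=r, OF S r \<delta> C this] show ?thesis by (simp add: prod)
qed

section \<open>Existence of the restoration entropy\<close>

text \<open>Fekete's argument in real time; adding \<open>c\<close> makes the function subadditive.
  The linear bound controls \<open>F\<close> on the remainder left by division by \<open>s\<close>,
  in place of a regularity assumption.\<close>

lemma fekete_real:
  fixes F :: "real \<Rightarrow> real"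
  assumes nn: "\<And>t. 0 \<le> t \<Longrightarrow> 0 \<le> F t" and lin: "\<And>t. 0 \<le> t \<Longrightarrow> F t \<le> A * t + B"
    and sub: "\<And>s t. 0 \<le> s \<Longrightarrow> 0 \<le> t \<Longrightarrow> F (s + t) \<le> F s + F t + c" and c: "0 \<le> c"
  shows "\<exists>l\<ge>0. ((\<lambda>t. F t / t) \<longlongrightarrow> l) at_top"
proof -
  define G where "G t = F t + c" for t
  have G: "G (s + t) \<le> G s + G t" if "0 \<le> s" "0 \<le> t" for s t
    using sub[OF that] by (simp add: G_def)
  have Gnn: "0 \<le> G t" if "0 \<le> t" for t
    using nn[OF that] c by (simp add: G_def)
  have mult: "G (real k * s + u) \<le> real k * G s + G u" if "0 \<le> s" "0 \<le> u" for k s u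
  proof (induction k)
    case (Suc k)
    have "G (real (Suc k) * s + u) = G (s + (real k * s + u))" by (simp add: algebra_simps)
    also have "\<dots> \<le> G s + G (real k * s + u)" using that by (intro G) auto
    finally show ?case using Suc by (simp add: algebra_simps)
  qed simp
  define l where "l = (INF t\<in>{0<..}. G t / t)"
  have bdd: "bdd_below ((\<lambda>t. G t / t) ` {0<..})"
    by (intro bdd_belowI2[of _ 0] divide_nonneg_nonneg Gnn) auto
  have l_le: "l \<le> G t / t" if "0 < t" for t
    unfolding l_def using that bdd by (intro cINF_lower) auto
  have l0: "0 \<le> l" unfolding l_def by (intro cINF_greatest divide_nonneg_nonneg Gnn) auto
  have "((\<lambda>t. G t / t) \<longlongrightarrow> l) at_top"
  proof (rule order_tendstoI)
    fix x assume x: "x < l"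
    show "\<forall>\<^sub>F t in at_top. x < G t / t"
      using eventually_gt_at_top[of 0]
    proof eventually_elim
      fix t :: real assume "0 < t"
      from l_le[OF this] x show "x < G t / t" by linarith
    qed
  next
    fix x assume "l < x"
    then obtain s where s: "0 < s" "G s / s < x"
      unfolding l_def using cINF_less_iff[OF _ bdd, of x] by auto
    define D where "D = \<bar>A\<bar> * s + \<bar>B\<bar> + c"
    have bound: "G t / t \<le> G s / s + D / t" if t: "0 < t" for t
    proof -
      define k where "k = nat \<lfloor>t / s\<rfloor>"
      define u where "u = t - real k * s"
      have "0 \<le> t / s" using s t by simp
      then have k: "real k \<le> t / s" "t / s < real k + 1" unfolding k_def by linarith+
      then have u: "0 \<le> u" "u \<le> s" using s by (auto simp: u_def field_simps)
      have "G t \<le> real k * G s + G u" using mult[of s u k] s u by (simp add: u_def)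
      also have "\<dots> \<le> t / s * G s + G u" using k Gnn[of s] s by (intro add_mono mult_right_mono) auto
      also have "G u \<le> D"
      proof -
        have "A * u \<le> \<bar>A\<bar> * s" using u by (intro mult_mono) auto
        then show ?thesis using lin[OF u(1)] by (simp add: G_def D_def)
      qed
      finally have "G t \<le> t * (G s / s) + D" by simp
      then have "G t / t \<le> (t * (G s / s) + D) / t" using t by (intro divide_right_mono) auto
      also have "\<dots> = G s / s + D / t" using t by (simp add: add_divide_distrib)
      finally show ?thesis .
    qed
    have "((\<lambda>t. G s / s + D / t) \<longlongrightarrow> G s / s + 0) at_top"
      by (intro tendsto_add tendsto_const real_tendsto_divide_at_top[OF tendsto_const filterlim_ident])
    then have "\<forall>\<^sub>F t in at_top. G s / s + D / t < x" using s by (intro order_tendstoD) auto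
    then show "\<forall>\<^sub>F t in at_top. G t / t < x"
      using eventually_gt_at_top[of 0]
    proof eventually_elim
      fix t assume "G s / s + D / t < x" "0 < t"
      with bound[of t] show "G t / t < x" by linarith
    qed
  qed
  moreover have "((\<lambda>t. c / t) \<longlongrightarrow> 0) at_top"
    by (rule real_tendsto_divide_at_top[OF tendsto_const filterlim_ident])
  ultimately have "((\<lambda>t. G t / t - c / t) \<longlongrightarrow> l - 0) at_top" by (intro tendsto_diff)
  then have "((\<lambda>t. F t / t) \<longlongrightarrow> l) at_top" by (simp add: G_def add_divide_distrib)
  with l0 show ?thesis by blast
qed

lemma vol_expansion_ge_1: "1 \<le> vol_expansion Z" for Z :: "real^'n^'n"
proof -
  have eq: "mat 1 + transpose Z ** Z = mat 1 + pullback Z (mat 1)" by (simp add: pullback_def)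
  have "mat 1 \<preceq> mat 1 + transpose Z ** Z"
    unfolding eq by (simp add: loewner_le_def matrix_vector_mult_add_rdistrib inner_add_right pullback_inner)
  then have "det (mat 1 :: real^'n^'n) \<le> det (mat 1 + transpose Z ** Z)"
    by (intro det_mono mat_1_pos_def) (auto simp: transpose_add matrix_transpose_mul transpose_mat)
  then show ?thesis by (simp add: vol_expansion_def)
qed

text \<open>Covers may have centres outside \<open>K\<close>, where covering numbers are not
  controlled. Each ball of half the radius that meets \<open>K\<close> is therefore replaced by a
  ball of full radius around a point of \<open>K\<close>.\<close>

lemma subset_Union_balls_in:
  fixes K :: "(real^'n) set"
  assumes "0 < \<delta>"
  shows "\<exists>D. finite D \<and> D \<subseteq> K \<and> real (card D) \<le> (4 * CARD('n) + 7) ^ CARD('n) \<and> ball c \<delta> \<inter> K \<subseteq> (\<Union>b\<in>D. ball b \<delta>)"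
proof -
  obtain C where C: "finite C" "real (card C) \<le> (4 * CARD('n) + 7) ^ CARD('n)"
    and cov: "\<And>y. (\<And>i. \<bar>y $ i\<bar> \<le> \<delta>) \<Longrightarrow> \<exists>b\<in>C. c + y \<in> ball b (\<delta> / 2)"
    using cover_box[of "mat 1" "\<lambda>_. 1" "\<delta> / 2" c] assms by (auto simp: transpose_mat)
  define C' where "C' = {b \<in> C. ball b (\<delta> / 2) \<inter> K \<noteq> {}}"
  define f where "f b = (SOME x. x \<in> ball b (\<delta> / 2) \<inter> K)" for b
  have f: "f b \<in> ball b (\<delta> / 2)" "f b \<in> K" if "b \<in> C'" for b
    using that some_in_eq[of "ball b (\<delta> / 2) \<inter> K"] by (auto simp: C'_def f_def)
  have "card (f ` C') \<le> card C"
    using C(1) by (intro order_trans[OF card_image_le card_mono]) (auto simp: C'_def)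
  then have "real (card (f ` C')) \<le> (4 * CARD('n) + 7) ^ CARD('n)" using C(2) by linarith
  moreover have "ball c \<delta> \<inter> K \<subseteq> (\<Union>b\<in>f ` C'. ball b \<delta>)"
  proof
    fix x assume x: "x \<in> ball c \<delta> \<inter> K"
    have "\<bar>(x - c) $ i\<bar> \<le> \<delta>" for i
      using x component_le_norm_cart[of "x - c" i] by (simp add: dist_norm norm_minus_commute)
    from cov[OF this] obtain b where b: "b \<in> C" "x \<in> ball b (\<delta> / 2)" by auto
    then have "b \<in> C'" using x by (auto simp: C'_def)
    moreover have "x \<in> ball (f b) \<delta>"
      using f(1)[OF \<open>b \<in> C'\<close>] b(2) dist_triangle[of "f b" x b] by (simp add: dist_commute)
    ultimately show "x \<in> (\<Union>b\<in>f ` C'. ball b \<delta>)" by blast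
  qed
  ultimately show ?thesis using f C(1) by (intro exI[of _ "f ` C'"]) (auto simp: C'_def)
qed

section \<open>Covering numbers and their growth rate\<close>

context compact_invariant_system
begin

abbreviation N :: "real \<Rightarrow> real^'n \<Rightarrow> real \<Rightarrow> nat" where "N \<equiv> covering_number \<phi> K"

definition entropy_rate :: "real \<Rightarrow> ennreal" where
  "entropy_rate \<tau> = Limsup (at_right 0) (\<lambda>\<delta>. SUP a\<in>K. ennreal (log 2 (real (N \<tau> a \<delta>))))"

lemma image_flow_eq: "0 \<le> \<tau> \<Longrightarrow> flow \<phi> \<tau> ` (S \<inter> K) = (\<lambda>b. traj b \<tau>) ` (S \<inter> K)"
  using flow_eq_traj by (intro image_cong) auto

text \<open>Total boundedness of \<open>K\<close>, which contains the image, provides some finite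
  cover, so the \<open>LEAST\<close> is attained.\<close>

lemma covering_number_cover:
  assumes "0 \<le> \<tau>" "0 < \<delta>"
  shows "\<exists>C. finite C \<and> card C = N \<tau> a \<delta> \<and> flow \<phi> \<tau> ` (ball a \<delta> \<inter> K) \<subseteq> (\<Union>c\<in>C. ball c \<delta>)"
proof -
  define P where "P n \<longleftrightarrow> (\<exists>C. finite C \<and> card C = n \<and> flow \<phi> \<tau> ` (ball a \<delta> \<inter> K) \<subseteq> (\<Union>c\<in>C. ball c \<delta>))" for n
  obtain C where "finite C" "K \<subseteq> (\<Union>c\<in>C. ball c \<delta>)"
    using compact_K assms(2) unfolding compact_eq_totally_bounded by blast
  moreover have "flow \<phi> \<tau> ` (ball a \<delta> \<inter> K) \<subseteq> K"
    unfolding image_flow_eq[OF assms(1)] using traj_in_K assms by auto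
  ultimately have "P (card C)" unfolding P_def by blast
  then have "P (Least P)" by (rule LeastI)
  moreover have "Least P = N \<tau> a \<delta>" by (simp add: covering_number_def P_def[abs_def])
  ultimately show ?thesis by (simp add: P_def)
qed

lemma covering_number_le:
  "finite C \<Longrightarrow> flow \<phi> \<tau> ` (ball a \<delta> \<inter> K) \<subseteq> (\<Union>c\<in>C. ball c \<delta>) \<Longrightarrow> N \<tau> a \<delta> \<le> card C"
  unfolding covering_number_def by (intro Least_le) blast

lemma covering_number_ge_1:
  assumes "a \<in> K" "0 \<le> \<tau>" "0 < \<delta>"
  shows "1 \<le> N \<tau> a \<delta>"
proof -
  obtain C where C: "finite C" "card C = N \<tau> a \<delta>" "flow \<phi> \<tau> ` (ball a \<delta> \<inter> K) \<subseteq> (\<Union>c\<in>C. ball c \<delta>)"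
    using covering_number_cover[OF assms(2,3), of a] by blast
  have "flow \<phi> \<tau> a \<in> flow \<phi> \<tau> ` (ball a \<delta> \<inter> K)" using assms by auto
  then have "C \<noteq> {}" using C(3) by auto
  then show ?thesis using C(1,2) by (metis One_nat_def Suc_leI card_gt_0_iff)
qed

text \<open>For small radii the linearisation error is at most \<open>\<delta>\<close>, and
  \<open>cover_ellipsoid\<close> allows for exactly such an error \<open>y\<close>. The threshold
  for \<open>\<delta>\<close> does not depend on \<open>a\<close>.\<close>

lemma covering_number_upper:
  assumes \<tau>: "0 \<le> \<tau>"
  shows "\<forall>\<^sub>F \<delta> in at_right 0. \<forall>a\<in>K. N \<tau> a \<delta> \<le> (4 * CARD('n) + 7) ^ CARD('n) * vol_expansion (Z a \<tau>)"
proof -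
  obtain d where d: "0 < d" "\<And>a b t. a \<in> K \<Longrightarrow> b \<in> K \<Longrightarrow> dist a b < d \<Longrightarrow> t \<in> {0..\<tau>} \<Longrightarrow>
    norm (traj b t - traj a t - Z a t *v (b - a)) \<le> 1 * norm (b - a)"
    using uniform_linearization[OF \<tau> zero_less_one] by blast
  have "N \<tau> a \<delta> \<le> (4 * CARD('n) + 7) ^ CARD('n) * vol_expansion (Z a \<tau>)"
    if \<delta>: "0 < \<delta>" "\<delta> < d" and a: "a \<in> K" for a \<delta>
  proof -
    obtain C where C: "finite C" "real (card C) \<le> (4 * CARD('n) + 7) ^ CARD('n) * vol_expansion (Z a \<tau>)"
      and cov: "\<And>x y. norm x \<le> \<delta> \<Longrightarrow> norm y \<le> \<delta> \<Longrightarrow> \<exists>c\<in>C. traj a \<tau> + (Z a \<tau> *v x + y) \<in> ball c \<delta>"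
      using cover_ellipsoid[OF det_Z_nonzero[OF a \<tau>] \<delta>(1), of "traj a \<tau>"] by blast
    have "flow \<phi> \<tau> ` (ball a \<delta> \<inter> K) \<subseteq> (\<Union>c\<in>C. ball c \<delta>)"
      unfolding image_flow_eq[OF \<tau>]
    proof
      fix z assume "z \<in> (\<lambda>b. traj b \<tau>) ` (ball a \<delta> \<inter> K)"
      then obtain b where b: "b \<in> K" "dist a b < \<delta>" and z: "z = traj b \<tau>" by auto
      define y where "y = traj b \<tau> - traj a \<tau> - Z a \<tau> *v (b - a)"
      have "norm y \<le> 1 * norm (b - a)" unfolding y_def using b \<delta> \<tau> by (intro d(2) a) auto
      then have "norm (b - a) \<le> \<delta>" "norm y \<le> \<delta>" using b by (auto simp: dist_norm norm_minus_commute)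
      from cov[OF this] show "z \<in> (\<Union>c\<in>C. ball c \<delta>)" by (simp add: z y_def)
    qed
    from covering_number_le[OF C(1) this] C(2) show ?thesis by linarith
  qed
  then show ?thesis
    unfolding eventually_at_right_field using d(1) by blast
qed

text \<open>At an interior point every \<open>a + x\<close> with \<open>x\<close> small lies in
  \<open>K\<close>, so the full ellipsoid is seen. The radius \<open>3 * \<delta>\<close> adds up
  the covering ball, the linearisation error and the vector \<open>y\<close>. The threshold may
  depend on \<open>a\<close>, which is harmless below a supremum.\<close>

lemma covering_number_lower:
  assumes a: "a \<in> interior K" and \<tau>: "0 \<le> \<tau>"
  shows "\<forall>\<^sub>F \<delta> in at_right 0. vol_expansion (Z a \<tau>) \<le> (7 * CARD('n)) ^ CARD('n) * N \<tau> a \<delta>"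
proof -
  obtain d where d: "0 < d" "\<And>a b t. a \<in> K \<Longrightarrow> b \<in> K \<Longrightarrow> dist a b < d \<Longrightarrow> t \<in> {0..\<tau>} \<Longrightarrow>
    norm (traj b t - traj a t - Z a t *v (b - a)) \<le> 1 * norm (b - a)"
    using uniform_linearization[OF \<tau> zero_less_one] by blast
  obtain d' where d': "0 < d'" "ball a d' \<subseteq> K" using a by (auto simp: mem_interior)
  then have aK: "a \<in> K" by auto
  have "vol_expansion (Z a \<tau>) \<le> (7 * CARD('n)) ^ CARD('n) * N \<tau> a \<delta>"
    if \<delta>: "0 < \<delta>" "\<delta> < min d d'" for \<delta>
  proof -
    obtain C where C: "finite C" "card C = N \<tau> a \<delta>" "flow \<phi> \<tau> ` (ball a \<delta> \<inter> K) \<subseteq> (\<Union>c\<in>C. ball c \<delta>)"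
      using covering_number_cover[OF \<tau> \<delta>(1), of a] by blast
    have "\<exists>c\<in>C. traj a \<tau> + (Z a \<tau> *v x + y) \<in> ball c (3 * \<delta>)" if x: "norm x < \<delta>" and y: "norm y < \<delta>" for x y
    proof -
      have ball: "a + x \<in> ball a \<delta>" using x by (simp add: dist_norm)
      moreover have K: "a + x \<in> K" using x \<delta> d'(2) by (auto simp: dist_norm subset_iff)
      ultimately have "traj (a + x) \<tau> \<in> flow \<phi> \<tau> ` (ball a \<delta> \<inter> K)" unfolding image_flow_eq[OF \<tau>] by blast
      then obtain c where c: "c \<in> C" "traj (a + x) \<tau> \<in> ball c \<delta>" using C(3) by auto
      have "norm (traj (a + x) \<tau> - traj a \<tau> - Z a \<tau> *v (a + x - a)) \<le> 1 * norm (a + x - a)"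
        using ball \<delta> \<tau> by (intro d(2) aK K) auto
      then have "norm (traj a \<tau> + (Z a \<tau> *v x + y) - traj (a + x) \<tau>) < 2 * \<delta>"
        using x y norm_triangle_ineq[of "traj a \<tau> + Z a \<tau> *v x - traj (a + x) \<tau>" y]
          norm_minus_commute[of "traj a \<tau> + Z a \<tau> *v x" "traj (a + x) \<tau>"]
        by (simp add: algebra_simps)
      then have "traj a \<tau> + (Z a \<tau> *v x + y) \<in> ball c (3 * \<delta>)"
        using c(2) dist_triangle[of c "traj a \<tau> + (Z a \<tau> *v x + y)" "traj (a + x) \<tau>"]
        by (simp add: dist_norm norm_minus_commute)
      with c(1) show ?thesis by blast
    qed
    from cover_ellipsoid_lower[OF det_Z_nonzero[OF aK \<tau>] \<delta>(1) C(1) this] C(2) show ?thesis by simp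
  qed
  then show ?thesis
    unfolding eventually_at_right_field using d(1) d'(1) by (intro exI[of _ "min d d'"]) auto
qed

text \<open>Covers are composed. The balls covering the image at time \<open>\<tau>\<close> are
  first replaced by balls centred in \<open>K\<close>, at the price of the constant factor, because
  \<open>B\<close> bounds covering numbers only there.\<close>

lemma covering_number_submultiplicative:
  fixes B :: real
  assumes \<tau>: "0 \<le> \<tau>" and \<sigma>: "0 \<le> \<sigma>" and \<delta>: "0 < \<delta>" and B: "\<And>b. b \<in> K \<Longrightarrow> real (N \<sigma> b \<delta>) \<le> B" and B0: "0 \<le> B"
  shows "N (\<tau> + \<sigma>) a \<delta> \<le> N \<tau> a \<delta> * ((4 * CARD('n) + 7) ^ CARD('n) * B)"
proof -
  let ?M = "real ((4 * CARD('n) + 7) ^ CARD('n))"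
  obtain C where C: "finite C" "card C = N \<tau> a \<delta>" "flow \<phi> \<tau> ` (ball a \<delta> \<inter> K) \<subseteq> (\<Union>c\<in>C. ball c \<delta>)"
    using covering_number_cover[OF \<tau> \<delta>, of a] by blast
  obtain D where D: "\<And>c. finite (D c)" "\<And>c. D c \<subseteq> K" "\<And>c. real (card (D c)) \<le> ?M"
    "\<And>c. ball c \<delta> \<inter> K \<subseteq> (\<Union>b\<in>D c. ball b \<delta>)"
    using subset_Union_balls_in[OF \<delta>, of K] by metis
  obtain E where E: "\<And>b. finite (E b)" "\<And>b. card (E b) = N \<sigma> b \<delta>"
    "\<And>b. flow \<phi> \<sigma> ` (ball b \<delta> \<inter> K) \<subseteq> (\<Union>c\<in>E b. ball c \<delta>)"
    using covering_number_cover[OF \<sigma> \<delta>] by metis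
  define U where "U = (\<Union>c\<in>C. \<Union>b\<in>D c. E b)"
  have "flow \<phi> (\<tau> + \<sigma>) ` (ball a \<delta> \<inter> K) \<subseteq> (\<Union>c\<in>U. ball c \<delta>)"
  proof
    fix z assume "z \<in> flow \<phi> (\<tau> + \<sigma>) ` (ball a \<delta> \<inter> K)"
    then obtain x where x: "x \<in> ball a \<delta>" "x \<in> K" "z = traj x (\<tau> + \<sigma>)"
      using image_flow_eq[of "\<tau> + \<sigma>" "ball a \<delta>"] \<tau> \<sigma> by auto
    have y: "traj x \<tau> \<in> K" "z = traj (traj x \<tau>) \<sigma>" using x \<tau> \<sigma> by (auto simp: traj_in_K traj_add)
    have "traj x \<tau> \<in> flow \<phi> \<tau> ` (ball a \<delta> \<inter> K)" unfolding image_flow_eq[OF \<tau>] using x by blast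
    then obtain c where c: "c \<in> C" "traj x \<tau> \<in> ball c \<delta>" using C(3) by auto
    then obtain b where b: "b \<in> D c" "traj x \<tau> \<in> ball b \<delta>" using D(4)[of c] y(1) by auto
    then have "z \<in> flow \<phi> \<sigma> ` (ball b \<delta> \<inter> K)" unfolding image_flow_eq[OF \<sigma>] using y by blast
    then obtain e where "e \<in> E b" "z \<in> ball e \<delta>" using E(3)[of b] by auto
    with b c show "z \<in> (\<Union>c\<in>U. ball c \<delta>)" by (auto simp: U_def)
  qed
  moreover have "finite U" using C(1) D(1) E(1) by (auto simp: U_def)
  ultimately have "N (\<tau> + \<sigma>) a \<delta> \<le> card U" by (intro covering_number_le)
  also have "real (card U) \<le> (\<Sum>c\<in>C. real (card (\<Union>b\<in>D c. E b)))"
    unfolding U_def of_nat_sum[symmetric] by (intro of_nat_mono card_UN_le C)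
  also have "\<dots> \<le> (\<Sum>c\<in>C. ?M * B)"
  proof (rule sum_mono)
    fix c
    have "real (card (\<Union>b\<in>D c. E b)) \<le> (\<Sum>b\<in>D c. real (card (E b)))"
      unfolding of_nat_sum[symmetric] by (intro of_nat_mono card_UN_le D)
    also have "\<dots> \<le> (\<Sum>b\<in>D c. B)" using D(2)[of c] B by (intro sum_mono) (auto simp: E)
    also have "\<dots> = card (D c) * B" by simp
    also have "\<dots> \<le> ?M * B" using D(3)[of c] B0 by (intro mult_right_mono) auto
    finally show "real (card (\<Union>b\<in>D c. E b)) \<le> ?M * B" .
  qed
  also have "\<dots> = N \<tau> a \<delta> * (?M * B)" using C(2) by simp
  finally show ?thesis by simp
qed

lemma entropy_rate_upper:
  assumes \<tau>: "0 \<le> \<tau>" and B: "\<And>a. a \<in> K \<Longrightarrow> log 2 ((4 * CARD('n) + 7) ^ CARD('n) * vol_expansion (Z a \<tau>)) \<le> B"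
  shows "entropy_rate \<tau> \<le> ennreal B"
  unfolding entropy_rate_def
proof (rule Limsup_bounded)
  show "\<forall>\<^sub>F \<delta> in at_right 0. (SUP a\<in>K. ennreal (log 2 (real (N \<tau> a \<delta>)))) \<le> ennreal B"
    using covering_number_upper[OF \<tau>] eventually_at_right_less[of 0]
  proof eventually_elim
    fix \<delta> :: real assume up: "\<forall>a\<in>K. N \<tau> a \<delta> \<le> (4 * CARD('n) + 7) ^ CARD('n) * vol_expansion (Z a \<tau>)" and \<delta>: "0 < \<delta>"
    show "(SUP a\<in>K. ennreal (log 2 (real (N \<tau> a \<delta>)))) \<le> ennreal B"
    proof (rule SUP_least)
      fix a assume a: "a \<in> K"
      have "log 2 (real (N \<tau> a \<delta>)) \<le> log 2 ((4 * CARD('n) + 7) ^ CARD('n) * vol_expansion (Z a \<tau>))"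
        using up a covering_number_ge_1[OF a \<tau> \<delta>] by (intro log_mono) auto
      also have "\<dots> \<le> B" by (rule B[OF a])
      finally show "ennreal (log 2 (real (N \<tau> a \<delta>))) \<le> ennreal B" by (rule ennreal_leI)
    qed
  qed
qed

lemma entropy_rate_lower_interior:
  assumes a: "a \<in> interior K" and \<tau>: "0 \<le> \<tau>"
  shows "ennreal (log 2 (vol_expansion (Z a \<tau>) / (7 * CARD('n)) ^ CARD('n))) \<le> entropy_rate \<tau>"
  unfolding entropy_rate_def
proof (rule le_Limsup)
  have aK: "a \<in> K" using a interior_subset by blast
  show "\<forall>\<^sub>F \<delta> in at_right 0. ennreal (log 2 (vol_expansion (Z a \<tau>) / (7 * CARD('n)) ^ CARD('n)))
      \<le> (SUP a\<in>K. ennreal (log 2 (real (N \<tau> a \<delta>))))"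
    using covering_number_lower[OF a \<tau>]
  proof eventually_elim
    fix \<delta> assume low: "vol_expansion (Z a \<tau>) \<le> (7 * CARD('n)) ^ CARD('n) * N \<tau> a \<delta>"
    have "log 2 (vol_expansion (Z a \<tau>) / (7 * CARD('n)) ^ CARD('n)) \<le> log 2 (real (N \<tau> a \<delta>))"
      using low vol_expansion_ge_1[of "Z a \<tau>"] by (intro log_mono) (auto simp: field_simps)
    then show "ennreal (log 2 (vol_expansion (Z a \<tau>) / (7 * CARD('n)) ^ CARD('n)))
      \<le> (SUP a\<in>K. ennreal (log 2 (real (N \<tau> a \<delta>))))"
      by (intro SUP_upper2[OF aK] ennreal_leI)
  qed
qed simp

lemma det_continuous_on:
  assumes "continuous_on S A"
  shows "continuous_on S (\<lambda>x. det (A x :: real^'m^'m))"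
  unfolding det_def using assms by (intro continuous_intros)

lemma continuous_on_vol_expansion_Z:
  assumes \<tau>: "0 \<le> \<tau>"
  shows "continuous_on K (\<lambda>a. vol_expansion (Z a \<tau>))"
proof -
  have "continuous_on K (\<lambda>a. Z a \<tau>)"
  proof -
    have c1: "continuous_on K (\<lambda>a. (a, \<tau>))" by (intro continuous_intros)
    have c2: "(\<lambda>a. (a, \<tau>)) ` K \<subseteq> K \<times> {0..\<tau>}" using \<tau> by auto
    from continuous_on_compose2[OF continuous_on_Z_joint[OF \<tau>] c1 c2] show ?thesis by simp
  qed
  then show ?thesis
    unfolding vol_expansion_def by (intro continuous_intros det_continuous_on)
qed

text \<open>The linear growth serves twice: it makes the passage to \<open>entropy_rate_real\<close>
  faithful, and it is the growth hypothesis of \<open>fekete_real\<close>. It comes from the bound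
  of \<open>I + Z^T Z\<close> by the multiple \<open>2 * exp (2 * lip * \<tau>)\<close> of the
  identity.\<close>

lemma entropy_rate_finite:
  assumes \<tau>: "0 \<le> \<tau>"
  shows "entropy_rate \<tau> \<le> ennreal (CARD('n) * lip / ln 2 * \<tau> + log 2 ((4 * CARD('n) + 7) ^ CARD('n) * sqrt 2 ^ CARD('n)))"
proof (rule entropy_rate_upper[OF \<tau>])
  fix a assume a: "a \<in> K"
  let ?c = "2 * exp (2 * lip * \<tau>)"
  have c: "0 < ?c" "1 \<le> exp (2 * lip * \<tau>)" using \<tau> lip_cball(1) by auto
  have "mat 1 + transpose (Z a \<tau>) ** Z a \<tau> = mat 1 + pullback (Z a \<tau>) (mat 1)" by (simp add: pullback_def)
  also have "\<dots> \<preceq> ?c *\<^sub>R mat 1"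
    unfolding loewner_le_def
  proof
    fix v :: "real^'n"
    have "v \<bullet> v + (Z a \<tau> *v v) \<bullet> (Z a \<tau> *v v) \<le> exp (2 * lip * \<tau>) * (v \<bullet> v) + exp (2 * lip * \<tau>) * (v \<bullet> v)"
      using Z_growth_bounds(1)[OF a \<tau>, of v] mult_right_mono[OF c(2), of "v \<bullet> v"]
        inner_ge_zero[of v] by linarith
    then show "v \<bullet> ((mat 1 + pullback (Z a \<tau>) (mat 1)) *v v) \<le> v \<bullet> ((?c *\<^sub>R mat 1) *v v)"
      by (simp add: matrix_vector_mult_add_rdistrib inner_add_right pullback_inner scaleR_matrix_vector_assoc[symmetric] mult_ac)
  qed
  finally have le: "mat 1 + transpose (Z a \<tau>) ** Z a \<tau> \<preceq> ?c *\<^sub>R mat 1" .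
  have "det (mat 1 + transpose (Z a \<tau>) ** Z a \<tau>) \<le> ?c ^ CARD('n)"
    using det_mono[OF mat_1_plus_pos_def _ le] by (simp add: det_scaleR transpose_scalar transpose_mat)
  then have "vol_expansion (Z a \<tau>) \<le> sqrt ?c ^ CARD('n)"
    unfolding vol_expansion_def real_sqrt_power[symmetric] by (rule real_sqrt_le_mono)
  also have "sqrt ?c = sqrt 2 * exp (lip * \<tau>)"
    by (simp add: real_sqrt_mult) (simp add: real_sqrt_unique power2_eq_square exp_add[symmetric])
  finally have v: "vol_expansion (Z a \<tau>) \<le> sqrt 2 ^ CARD('n) * exp (lip * \<tau>) ^ CARD('n)" by (simp add: power_mult_distrib)
  have "log 2 ((4 * CARD('n) + 7) ^ CARD('n) * vol_expansion (Z a \<tau>))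
      \<le> log 2 (((4 * CARD('n) + 7) ^ CARD('n) * sqrt 2 ^ CARD('n)) * exp (lip * \<tau>) ^ CARD('n))"
    using v vol_expansion_ge_1[of "Z a \<tau>"] unfolding mult.assoc
    by (intro log_mono mult_pos_pos mult_left_mono) auto
  also have "\<dots> = log 2 ((4 * CARD('n) + 7) ^ CARD('n) * sqrt 2 ^ CARD('n)) + log 2 (exp (lip * \<tau>) ^ CARD('n))"
    by (subst log_mult) auto
  also have "log 2 (exp (lip * \<tau>) ^ CARD('n)) = CARD('n) * lip / ln 2 * \<tau>"
    by (simp add: log_def ln_realpow)
  finally show "log 2 ((4 * CARD('n) + 7) ^ CARD('n) * vol_expansion (Z a \<tau>))
      \<le> CARD('n) * lip / ln 2 * \<tau> + log 2 ((4 * CARD('n) + 7) ^ CARD('n) * sqrt 2 ^ CARD('n))" by simp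
qed

definition entropy_rate_real :: "real \<Rightarrow> real" where
  "entropy_rate_real \<tau> = enn2real (entropy_rate \<tau>)"

lemma entropy_rate_real: "0 \<le> \<tau> \<Longrightarrow> entropy_rate \<tau> = ennreal (entropy_rate_real \<tau>)"
  unfolding entropy_rate_real_def using entropy_rate_finite[of \<tau>]
  by (metis ennreal_enn2real ennreal_less_top le_less_trans)

lemma entropy_rate_real_nonneg: "0 \<le> entropy_rate_real \<tau>"
  by (simp add: entropy_rate_real_def)

lemma entropy_rate_subadditive:
  assumes \<tau>: "0 \<le> \<tau>" and \<sigma>: "0 \<le> \<sigma>"
  shows "entropy_rate_real (\<tau> + \<sigma>) \<le> entropy_rate_real \<tau> + entropy_rate_real \<sigma> + log 2 ((4 * CARD('n) + 7) ^ CARD('n))"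
proof -
  let ?M = "real ((4 * CARD('n) + 7) ^ CARD('n))"
  have ev: "\<forall>\<^sub>F \<delta> in at_right 0. (SUP a\<in>K. ennreal (log 2 (real (N t a \<delta>)))) < ennreal (entropy_rate_real t + e)"
    if "0 \<le> t" "0 < e" for t e
    using entropy_rate_real[OF that(1)] that entropy_rate_real_nonneg[of t] unfolding entropy_rate_def
    by (intro Limsup_lessD) (simp add: ennreal_less_iff)
  have M1: "1 \<le> ?M" by (simp add: one_le_power)
  have M: "0 \<le> log 2 ?M" using M1 by (intro zero_le_log_cancel_iff[THEN iffD2]) auto
  have le_e: "entropy_rate_real (\<tau> + \<sigma>) \<le> entropy_rate_real \<tau> + entropy_rate_real \<sigma> + log 2 ?M + 2 * e" if e: "0 < e" for e
  proof -
    \<comment> \<open>For small \<open>\<delta>\<close> each of the two upper limits is exceeded by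
      at most \<open>e\<close>.\<close>
    define B where "B = entropy_rate_real \<tau> + e + (log 2 ?M + (entropy_rate_real \<sigma> + e))"
    have B0: "0 \<le> B" using M e entropy_rate_real_nonneg[of \<tau>] entropy_rate_real_nonneg[of \<sigma>] by (simp add: B_def)
    have "entropy_rate (\<tau> + \<sigma>) \<le> ennreal B"
      unfolding entropy_rate_def
    proof (rule Limsup_bounded)
      show "\<forall>\<^sub>F \<delta> in at_right 0. (SUP a\<in>K. ennreal (log 2 (real (N (\<tau> + \<sigma>) a \<delta>)))) \<le> ennreal B"
        using ev[OF \<tau> e] ev[OF \<sigma> e] eventually_at_right_less[of 0]
      proof eventually_elim
        fix \<delta> :: real
        assume t: "(SUP a\<in>K. ennreal (log 2 (real (N \<tau> a \<delta>)))) < ennreal (entropy_rate_real \<tau> + e)"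
          and s: "(SUP a\<in>K. ennreal (log 2 (real (N \<sigma> a \<delta>)))) < ennreal (entropy_rate_real \<sigma> + e)" and \<delta>: "0 < \<delta>"
        have le: "log 2 (real (N u a \<delta>)) \<le> entropy_rate_real u + e"
          if "(SUP a\<in>K. ennreal (log 2 (real (N u a \<delta>)))) < ennreal (entropy_rate_real u + e)" "a \<in> K" for u a
        proof -
          have "ennreal (log 2 (real (N u a \<delta>))) \<le> ennreal (entropy_rate_real u + e)"
            using that SUP_upper[of a K "\<lambda>a. ennreal (log 2 (real (N u a \<delta>)))"] by (auto intro: order_trans less_imp_le)
          then show ?thesis
            using e entropy_rate_real_nonneg[of u] by (simp add: ennreal_le_iff del: ennreal_plus)
        qed
        show "(SUP a\<in>K. ennreal (log 2 (real (N (\<tau> + \<sigma>) a \<delta>)))) \<le> ennreal B"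
        proof (rule SUP_least, rule ennreal_leI)
          fix a assume a: "a \<in> K"
          define Bs where "Bs = 2 powr (entropy_rate_real \<sigma> + e)"
          have "real (N \<sigma> b \<delta>) \<le> Bs" if "b \<in> K" for b
            using le[OF s that] covering_number_ge_1[OF that \<sigma> \<delta>] by (simp add: Bs_def log_le_iff)
          then have "real (N (\<tau> + \<sigma>) a \<delta>) \<le> N \<tau> a \<delta> * (?M * Bs)"
            using \<tau> \<sigma> \<delta> by (intro covering_number_submultiplicative) (auto simp: Bs_def)
          then have "log 2 (real (N (\<tau> + \<sigma>) a \<delta>)) \<le> log 2 (N \<tau> a \<delta> * (?M * Bs))"
            using covering_number_ge_1[OF a _ \<delta>, of "\<tau> + \<sigma>"] \<tau> \<sigma> by (intro log_mono) auto
          also have "\<dots> = log 2 (N \<tau> a \<delta>) + (log 2 ?M + (entropy_rate_real \<sigma> + e))"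
          proof -
            have "0 < real (N \<tau> a \<delta>)" "0 < ?M" "0 < Bs" "log 2 Bs = entropy_rate_real \<sigma> + e"
              using covering_number_ge_1[OF a \<tau> \<delta>] M1 by (auto simp: Bs_def)
            then show ?thesis by (simp only: log_mult_pos mult_pos_pos)
          qed
          also have "\<dots> \<le> B" using le[OF t a] by (simp add: B_def)
          finally show "log 2 (real (N (\<tau> + \<sigma>) a \<delta>)) \<le> B" .
        qed
      qed
    qed
    then show ?thesis
      using entropy_rate_real[of "\<tau> + \<sigma>"] \<tau> \<sigma> B0 by (simp add: B_def)
  qed
  show ?thesis
  proof (rule field_le_epsilon)
    fix e :: real assume "0 < e"
    then show "entropy_rate_real (\<tau> + \<sigma>)
        \<le> entropy_rate_real \<tau> + entropy_rate_real \<sigma> + log 2 ?M + e"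
      using le_e[of "e / 2"] by simp
  qed
qed

text \<open>\<open>Lim\<close> denotes the limit only where one exists, so convergence has to be
  shown; it follows from subadditivity up to a constant.\<close>

theorem restoration_entropy_limit:
  obtains h where "0 \<le> h" "restoration_entropy \<phi> K = ennreal h"
    "((\<lambda>\<tau>. entropy_rate_real \<tau> / \<tau>) \<longlongrightarrow> h) at_top"
proof -
  have "\<exists>h\<ge>0. ((\<lambda>\<tau>. entropy_rate_real \<tau> / \<tau>) \<longlongrightarrow> h) at_top"
  proof (rule fekete_real[OF entropy_rate_real_nonneg _ entropy_rate_subadditive])
    let ?B = "log 2 ((4 * CARD('n) + 7) ^ CARD('n) * sqrt 2 ^ CARD('n))"
    have "1 \<le> real ((4 * CARD('n) + 7) ^ CARD('n)) * sqrt 2 ^ CARD('n)"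
    proof -
      have "1 * 1 \<le> real ((4 * CARD('n) + 7) ^ CARD('n)) * sqrt 2 ^ CARD('n)"
        by (intro mult_mono) (auto simp: one_le_power)
      then show ?thesis by simp
    qed
    then have B: "0 \<le> ?B" by (intro zero_le_log_cancel_iff[THEN iffD2]) auto
    show "entropy_rate_real t \<le> CARD('n) * lip / ln 2 * t + ?B" if "0 \<le> t" for t
    proof -
      have "0 \<le> CARD('n) * lip / ln 2 * t" using lip_cball(1) that by simp
      then show ?thesis
        using entropy_rate_finite[OF that] B unfolding entropy_rate_real[OF that] by (simp add: ennreal_le_iff del: ennreal_plus)
    qed
    show "0 \<le> log 2 (real ((4 * CARD('n) + 7) ^ CARD('n)))"
      by (intro zero_le_log_cancel_iff[THEN iffD2]) (auto simp: one_le_power)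
  qed
  then obtain h where h: "0 \<le> h" "((\<lambda>\<tau>. entropy_rate_real \<tau> / \<tau>) \<longlongrightarrow> h) at_top" by blast
  have "((\<lambda>\<tau>. ennreal (entropy_rate_real \<tau> / \<tau>)) \<longlongrightarrow> ennreal h) at_top"
    using h(2) by (rule tendsto_ennrealI)
  moreover have "\<forall>\<^sub>F \<tau> in at_top. ennreal (entropy_rate_real \<tau> / \<tau>) = ennreal (1 / \<tau>) * entropy_rate \<tau>"
    using eventually_gt_at_top[of 0]
    by eventually_elim (simp add: entropy_rate_real ennreal_mult[symmetric] entropy_rate_real_nonneg)
  ultimately have "((\<lambda>\<tau>. ennreal (1 / \<tau>) * entropy_rate \<tau>) \<longlongrightarrow> ennreal h) at_top"
    by (rule Lim_transform_eventually)
  then have "Lim at_top (\<lambda>\<tau>. ennreal (1 / \<tau>) * entropy_rate \<tau>) = ennreal h"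
    by (rule tendsto_Lim[OF trivial_limit_at_top_linorder])
  then have "restoration_entropy \<phi> K = ennreal h"
    by (simp only: restoration_entropy_def entropy_rate_def)
  from that[OF h(1) this h(2)] show ?thesis .
qed

text \<open>The counting bound holds at interior points; as \<open>entropy_rate_real \<tau>\<close>
  does not depend on the point, continuity of \<open>vol_expansion\<close> extends it to the
  closure.\<close>

lemma entropy_rate_lower:
  assumes K: "K = closure (interior K)" and a: "a \<in> K" and \<tau>: "0 \<le> \<tau>"
  shows "log 2 (vol_expansion (Z a \<tau>) / (7 * CARD('n)) ^ CARD('n)) \<le> entropy_rate_real \<tau>"
proof (rule continuous_le_on_closure[of "interior K"])
  show "continuous_on (closure (interior K)) (\<lambda>a. log 2 (vol_expansion (Z a \<tau>) / (7 * CARD('n)) ^ CARD('n)))"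
  proof -
    have "vol_expansion (Z x \<tau>) \<noteq> 0" for x using vol_expansion_ge_1[of "Z x \<tau>"] by linarith
    then show ?thesis
      unfolding K[symmetric] by (intro continuous_intros continuous_on_vol_expansion_Z \<tau>) auto
  qed
  show "a \<in> closure (interior K)" using a K by simp
  show "log 2 (vol_expansion (Z x \<tau>) / (7 * CARD('n)) ^ CARD('n)) \<le> entropy_rate_real \<tau>" if "x \<in> interior K" for x
    using entropy_rate_lower_interior[OF that \<tau>] entropy_rate_real_nonneg[of \<tau>]
    unfolding entropy_rate_real[OF \<tau>] by (simp add: ennreal_le_iff)
qed

end

section \<open>The upper bound\<close>

lemma sym_pos_def_add: "A \<in> sym_pos_def \<Longrightarrow> B \<in> sym_pos_def \<Longrightarrow> A + B \<in> sym_pos_def"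
  by (auto simp: sym_pos_def_def transpose_add matrix_vector_mult_add_rdistrib inner_add_right intro: add_pos_pos)

lemma right_derivative_tendsto:
  assumes "(f has_vector_derivative f') (at 0 within {0..})"
  shows "((\<lambda>s. (1 / s) *\<^sub>R (f s - f 0)) \<longlongrightarrow> f') (at_right (0 :: real))"
proof -
  have "((\<lambda>s. (1 / norm (s - 0)) *\<^sub>R (f s - (f 0 + (s - 0) *\<^sub>R f'))) \<longlongrightarrow> 0) (at 0 within {0..})"
    using assms by (simp add: has_vector_derivative_def has_derivative_within)
  then have "((\<lambda>s. (1 / norm (s - 0)) *\<^sub>R (f s - (f 0 + (s - 0) *\<^sub>R f')) + f') \<longlongrightarrow> 0 + f') (at_right 0)"
    by (intro tendsto_add tendsto_const) (rule tendsto_within_subset, auto)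
  moreover have "\<forall>\<^sub>F s in at_right 0. (1 / norm (s - 0)) *\<^sub>R (f s - (f 0 + (s - 0) *\<^sub>R f')) + f' = (1 / s) *\<^sub>R (f s - f 0)"
    using eventually_at_right_less[of 0] by eventually_elim (simp add: algebra_simps)
  ultimately show ?thesis by (simp add: Lim_transform_eventually)
qed

text \<open>The times at which the bound with slope \<open>S + e\<close> holds form a closed set,
  and a last such time before \<open>T\<close> contradicts the right-hand estimate there. One-sided
  estimates are all that orbital derivatives provide.\<close>

lemma right_dini_bound:
  fixes F :: "real \<Rightarrow> real"
  assumes T: "0 \<le> T" and cont: "continuous_on {0..T} F"
    and dini: "\<And>t e. 0 \<le> t \<Longrightarrow> t < T \<Longrightarrow> 0 < e \<Longrightarrow> \<forall>\<^sub>F s in at_right 0. F (t + s) \<le> F t + s * (S + e)"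
  shows "F T \<le> F 0 + S * T"
proof -
  have le_e: "F T \<le> F 0 + (S + e) * T" if e: "0 < e" for e
  proof (rule ccontr)
    assume contr: "\<not> ?thesis"
    define A where "A = {t \<in> {0..T}. F t - (S + e) * t \<le> F 0}"
    have "closed A" unfolding A_def
      by (intro continuous_on_closed_Collect_le continuous_intros cont)
    then have "compact ({0..T} \<inter> A)" by (intro compact_Int_closed compact_Icc)
    moreover have "{0..T} \<inter> A = A" by (auto simp: A_def)
    moreover have "0 \<in> A" using T by (simp add: A_def)
    ultimately obtain t where t: "t \<in> A" and max: "\<And>r. r \<in> A \<Longrightarrow> r \<le> t"
      using compact_attains_sup[of A] by auto
    have "t \<noteq> T" using t contr by (auto simp: A_def)
    then have tT: "0 \<le> t" "t < T" using t by (auto simp: A_def)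
    have "\<forall>\<^sub>F s in at_right 0. s < T - t"
      using tT by (intro eventually_at_rightI[of 0 "T - t"]) auto
    with dini[OF tT e] eventually_at_right_less[of 0]
    have "\<forall>\<^sub>F s in at_right 0. F (t + s) \<le> F t + s * (S + e) \<and> 0 < s \<and> s < T - t"
      by (intro eventually_conj)
    from eventually_happens'[OF trivial_limit_at_right_real this]
    obtain s where s: "F (t + s) \<le> F t + s * (S + e)" "0 < s" "s < T - t" by blast
    then have "t + s \<in> A" using t tT by (auto simp: A_def algebra_simps)
    from max[OF this] s show False by simp
  qed
  show ?thesis
  proof (rule field_le_epsilon)
    fix e :: real assume e: "0 < e"
    have "F T \<le> F 0 + (S + e / (T + 1)) * T" using T e by (intro le_e) simp
    also have "\<dots> \<le> F 0 + S * T + e" using T e by (simp add: field_simps)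
    finally show "F T \<le> F 0 + S * T + e" .
  qed
qed

lemma tendsto_pullback [tendsto_intros]:
  "(f \<longlongrightarrow> S) F \<Longrightarrow> (g \<longlongrightarrow> A) F \<Longrightarrow> ((\<lambda>x. pullback (f x) (g x)) \<longlongrightarrow> pullback S A) F"
  unfolding pullback_def by (intro tendsto_intros)

lemma continuous_on_pullback [continuous_intros]:
  "continuous_on S f \<Longrightarrow> continuous_on S g \<Longrightarrow> continuous_on S (\<lambda>x. pullback (f x) (g x))"
  unfolding pullback_def by (intro continuous_intros)

lemma tendsto_trace: "(f \<longlongrightarrow> A) F \<Longrightarrow> ((\<lambda>x. trace (f x)) \<longlongrightarrow> trace A) F"
  for f :: "'b \<Rightarrow> real^'n^'n"
  unfolding trace_def by (intro tendsto_intros)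

lemma trace_scaleR: "trace (c *\<^sub>R A) = c * trace A" for A :: "real^'n^'n"
  by (simp add: trace_def sum_distrib_left)

text \<open>Bounds the derivative of \<open>ln (det (A + Y))\<close>, \<open>Y = Z\<^sup>T P Z\<close>, where \<open>Z\<^sup>T Q Z\<close> is the derivative of \<open>Y\<close>.\<close>

lemma trace_bound_pullback:
  fixes A P Q R Z :: "real^'n^'n"
  assumes A: "A \<in> sym_pos_def" and P: "P \<in> sym_pos_def" and Q: "transpose Q = Q"
    and R: "pullback R (A + pullback Z P) = mat 1"
  shows "trace (pullback R (pullback Z Q)) \<le> pos_root_sum Q P"
proof -
  have "((Z ** R) *v w) \<bullet> (P *v ((Z ** R) *v w)) \<le> 1 * (w \<bullet> w)" for w
  proof -
    have "w \<bullet> w = w \<bullet> (pullback R (A + pullback Z P) *v w)" by (simp add: R)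
    also have "\<dots> = w \<bullet> (pullback R A *v w) + w \<bullet> (pullback (Z ** R) P *v w)"
      by (simp only: pullback_add pullback_pullback matrix_vector_mult_add_rdistrib inner_add_right)
    also have "\<dots> \<ge> w \<bullet> (pullback (Z ** R) P *v w)"
      using sym_pos_def_nonneg[OF A] by (simp add: pullback_inner)
    finally show ?thesis by (simp add: pullback_inner)
  qed
  from trace_pullback_le_pos_root_sum[OF P Q this] show ?thesis by (simp add: pullback_pullback)
qed

context compact_invariant_system
begin

definition orbital_matrix :: "(real^'n \<Rightarrow> real^'n^'n) \<Rightarrow> real^'n \<Rightarrow> real^'n^'n" where
  "orbital_matrix P x = P x ** J x + transpose (J x) ** P x + orbital_deriv \<phi> P x"

lemma sum_varsigma: "(\<Sum>s\<in>#varsigma \<phi> P x. max 0 s) = pos_root_sum (orbital_matrix P x) (P x)"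
  by (simp add: varsigma_def pos_root_sum_def orbital_matrix_def)

lemma continuous_on_compose_traj:
  assumes "continuous_on K P" "a \<in> K"
  shows "continuous_on {0..} (\<lambda>t. P (traj a t))"
  using continuous_on_compose2[OF assms(1) continuous_on_traj[OF assms(2)]] traj_in_K[OF assms(2)] by auto

lemma tendsto_at_right_0:
  assumes "continuous_on {0..} f"
  shows "(f \<longlongrightarrow> f 0) (at_right (0 :: real))"
  using assms unfolding continuous_on_def by (auto intro: tendsto_within_subset)

text \<open>Product rule at time 0, needed in both directions: one way it differentiates a pullback,
  the other way it recovers the orbital derivative of a metric whose pullbacks have a known
  derivative.\<close>

lemma pullback_difference_tendsto_iff:
  fixes P :: "real^'n \<Rightarrow> real^'n^'n"
  assumes P: "continuous_on K P" and x: "x \<in> K"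
  shows "((\<lambda>s. (1 / s) *\<^sub>R (pullback (Z x s) (P (traj x s)) - P x)) \<longlongrightarrow> P x ** J x + transpose (J x) ** P x + D) (at_right 0)
    \<longleftrightarrow> ((\<lambda>s. (1 / s) *\<^sub>R (P (traj x s) - P x)) \<longlongrightarrow> D) (at_right 0)" (is "?L \<longleftrightarrow> ?R")
proof -
  define q where "q s = (1 / s) *\<^sub>R (Z x s - mat 1)" for s
  have Z: "(Z x \<longlongrightarrow> mat 1) (at_right 0)"
    using tendsto_at_right_0[OF continuous_on_Z[OF x]] x by simp
  have Ps: "((\<lambda>s. P (traj x s)) \<longlongrightarrow> P x) (at_right 0)"
    using tendsto_at_right_0[OF continuous_on_compose_traj[OF P x]] x by simp
  have q: "(q \<longlongrightarrow> J x) (at_right 0)"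
    using right_derivative_tendsto[of "Z x" "J x"] Z_deriv[OF x, of 0] x by (simp add: q_def[abs_def])
  have r: "((\<lambda>s. P (traj x s) ** q s + transpose (q s) ** P (traj x s) ** Z x s) \<longlongrightarrow>
      P x ** J x + transpose (J x) ** P x ** mat 1) (at_right 0)"
    by (intro tendsto_intros Z Ps q)
  \<comment> \<open>Exact splitting of the difference quotient; all but the last term converge by
    \<open>r\<close>.\<close>
  have eq: "(1 / s) *\<^sub>R (pullback (Z x s) (P (traj x s)) - P x)
      = (P (traj x s) ** q s + transpose (q s) ** P (traj x s) ** Z x s) + (1 / s) *\<^sub>R (P (traj x s) - P x)" for s
    by (simp add: pullback_def q_def transpose_scalar transpose_diff transpose_mat matrix_diff_ldistrib
        matrix_diff_rdistrib matrix_scaleR_mult_left matrix_scaleR_mult_right scaleR_diff_right)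
  show ?thesis
  proof
    assume ?L
    from tendsto_diff[OF this[unfolded eq] r] show ?R by simp
  next
    assume ?R
    from tendsto_add[OF r this] show ?L unfolding eq by simp
  qed
qed

lemma admissible_orbital_deriv:
  assumes adm: "admissible \<phi> K P" and x: "x \<in> K"
  shows "((\<lambda>s. (1 / s) *\<^sub>R (P (traj x s) - P x)) \<longlongrightarrow> orbital_deriv \<phi> P x) (at_right 0)"
    and "transpose (orbital_deriv \<phi> P x) = orbital_deriv \<phi> P x"
proof -
  obtain D where D: "(orbital_quotient \<phi> P x \<longlongrightarrow> D) (at_right 0)"
    using adm x unfolding admissible_def orbitally_differentiable_at_def by blast
  then have "orbital_deriv \<phi> P x = D"
    unfolding orbital_deriv_def by (intro tendsto_Lim) (auto simp: trivial_limit_at_right_real)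
  with D have "(orbital_quotient \<phi> P x \<longlongrightarrow> orbital_deriv \<phi> P x) (at_right 0)" by simp
  moreover have "\<forall>\<^sub>F s in at_right 0. orbital_quotient \<phi> P x s = (1 / s) *\<^sub>R (P (traj x s) - P x)"
    using eventually_at_right_less[of 0]
    by eventually_elim (simp add: orbital_quotient_def flow_eq_traj[OF x])
  ultimately show lim: "((\<lambda>s. (1 / s) *\<^sub>R (P (traj x s) - P x)) \<longlongrightarrow> orbital_deriv \<phi> P x) (at_right 0)"
    by (rule Lim_transform_eventually)
  have sym: "transpose (P y) = P y" if "y \<in> K" for y
    using adm that by (auto simp: admissible_def sym_pos_def_symmetric)
  have "((\<lambda>s. transpose ((1 / s) *\<^sub>R (P (traj x s) - P x))) \<longlongrightarrow> transpose (orbital_deriv \<phi> P x)) (at_right 0)"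
    by (intro tendsto_transpose lim)
  moreover have "\<forall>\<^sub>F s in at_right 0. transpose ((1 / s) *\<^sub>R (P (traj x s) - P x)) = (1 / s) *\<^sub>R (P (traj x s) - P x)"
    using eventually_at_right_less[of 0]
    by eventually_elim (simp add: transpose_scalar transpose_diff sym x traj_in_K)
  ultimately have "((\<lambda>s. (1 / s) *\<^sub>R (P (traj x s) - P x)) \<longlongrightarrow> transpose (orbital_deriv \<phi> P x)) (at_right 0)"
    by (rule Lim_transform_eventually)
  from tendsto_unique[OF _ this lim] show "transpose (orbital_deriv \<phi> P x) = orbital_deriv \<phi> P x"
    by (simp add: trivial_limit_at_right_real)
qed

lemma orbital_matrix_symmetric:
  assumes "admissible \<phi> K P" "x \<in> K"
  shows "transpose (orbital_matrix P x) = orbital_matrix P x"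
proof -
  have "transpose (P x) = P x" using assms by (auto simp: admissible_def sym_pos_def_symmetric)
  then show ?thesis
    by (simp add: orbital_matrix_def transpose_add matrix_transpose_mul admissible_orbital_deriv(2)[OF assms] add.commute)
qed

definition transported :: "(real^'n \<Rightarrow> real^'n^'n) \<Rightarrow> real^'n \<Rightarrow> real \<Rightarrow> real^'n^'n" where
  "transported P a t = pullback (Z a t) (P (traj a t))"

lemma transported_0 [simp]: "a \<in> K \<Longrightarrow> transported P a 0 = P a"
  by (simp add: transported_def)

lemma transported_add:
  "a \<in> K \<Longrightarrow> 0 \<le> s \<Longrightarrow> 0 \<le> t \<Longrightarrow> transported P a (s + t) = pullback (Z a s) (transported P (traj a s) t)"
  by (simp add: transported_def Z_add traj_add pullback_pullback)

lemma transported_pos_def: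
  "(\<And>x. x \<in> K \<Longrightarrow> P x \<in> sym_pos_def) \<Longrightarrow> a \<in> K \<Longrightarrow> 0 \<le> t \<Longrightarrow> transported P a t \<in> sym_pos_def"
  unfolding transported_def using pullback_pos_def[OF _ det_Z_nonzero] traj_in_K by blast

lemma continuous_on_transported:
  "continuous_on K P \<Longrightarrow> a \<in> K \<Longrightarrow> continuous_on {0..} (transported P a)"
  unfolding transported_def[abs_def] by (intro continuous_intros continuous_on_Z continuous_on_compose_traj)

text \<open>By the cocycle property the quotient at time \<open>t\<close> is the congruence by
  \<open>Z a t\<close> of the quotient at time 0 from the point \<open>traj a t\<close>.\<close>

lemma transported_right_deriv:
  assumes adm: "admissible \<phi> K P" and a: "a \<in> K" and t: "0 \<le> t"
  shows "((\<lambda>s. (1 / s) *\<^sub>R (transported P a (t + s) - transported P a t)) \<longlongrightarrow>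
    pullback (Z a t) (orbital_matrix P (traj a t))) (at_right 0)"
proof -
  let ?x = "traj a t"
  have x: "?x \<in> K" using traj_in_K[OF a t] .
  have P: "continuous_on K P" using adm by (simp add: admissible_def)
  have "((\<lambda>s. (1 / s) *\<^sub>R (pullback (Z ?x s) (P (traj ?x s)) - P ?x)) \<longlongrightarrow> orbital_matrix P ?x) (at_right 0)"
    unfolding orbital_matrix_def pullback_difference_tendsto_iff[OF P x] by (rule admissible_orbital_deriv[OF adm x])
  then have "((\<lambda>s. pullback (Z a t) ((1 / s) *\<^sub>R (transported P ?x s - P ?x))) \<longlongrightarrow>
      pullback (Z a t) (orbital_matrix P ?x)) (at_right 0)"
    unfolding transported_def by (intro tendsto_intros)
  moreover have "\<forall>\<^sub>F s in at_right 0. pullback (Z a t) ((1 / s) *\<^sub>R (transported P ?x s - P ?x))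
      = (1 / s) *\<^sub>R (transported P a (t + s) - transported P a t)"
    using eventually_at_right_less[of 0]
  proof eventually_elim
    fix s :: real assume "0 < s"
    then show "pullback (Z a t) ((1 / s) *\<^sub>R (transported P ?x s - P ?x))
      = (1 / s) *\<^sub>R (transported P a (t + s) - transported P a t)"
      using transported_add[OF a t, of s P] by (simp add: pullback_scaleR pullback_diff transported_def[of P a t])
  qed
  ultimately show ?thesis by (rule Lim_transform_eventually)
qed

text \<open>Over a short step the growth of the determinant is controlled by
  \<open>det_add_le\<close>; the trace in the exponent, divided by the step, tends to a value that
  \<open>trace_bound_pullback\<close> limits by \<open>S\<close>.\<close>

lemma ln_det_growth:
  assumes adm: "admissible \<phi> K P" and a: "a \<in> K" and T: "0 \<le> T"
    and S: "\<And>x. x \<in> K \<Longrightarrow> pos_root_sum (orbital_matrix P x) (P x) \<le> S"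
  shows "ln (det (P a + transported P a T)) \<le> ln (det (2 *\<^sub>R P a)) + S * T"
proof -
  have pd: "x \<in> K \<Longrightarrow> P x \<in> sym_pos_def" for x using adm by (auto simp: admissible_def)
  have P: "continuous_on K P" using adm by (simp add: admissible_def)
  define F where "F t = ln (det (P a + transported P a t))" for t
  have pdt: "P a + transported P a t \<in> sym_pos_def" if "0 \<le> t" for t
    using that a by (intro sym_pos_def_add transported_pos_def pd)
  have "F T \<le> F 0 + S * T"
  proof (rule right_dini_bound[OF T])
    have "continuous_on {0..T} (transported P a)"
      using continuous_on_transported[OF P a] by (rule continuous_on_subset) auto
    then show "continuous_on {0..T} F"
      unfolding F_def[abs_def] using sym_pos_def_det_pos[OF pdt]
      by (intro continuous_on_ln det_continuous_on continuous_intros) (auto simp: less_imp_neq[THEN not_sym])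
    fix t e :: real assume t: "0 \<le> t" and e: "0 < e"
    let ?A = "P a + transported P a t" and ?x = "traj a t"
    have x: "?x \<in> K" using traj_in_K[OF a t] .
    \<comment> \<open>Diagonalising \<open>?A\<close> together with itself yields a matrix
      \<open>R\<close> that normalises it.\<close>
    obtain R :: "real^'n^'n" and d where R: "pullback R ?A = mat 1" "pullback R ?A = diagm d"
      using simultaneous_diagonalization[OF pdt[OF t] sym_pos_def_symmetric[OF pdt[OF t]]] by blast
    define H where "H s = transported P a (t + s) - transported P a t" for s
    have "((\<lambda>s. trace (pullback R ((1 / s) *\<^sub>R H s))) \<longlongrightarrow>
        trace (pullback R (pullback (Z a t) (orbital_matrix P ?x)))) (at_right 0)"
      unfolding H_def by (intro tendsto_trace tendsto_pullback tendsto_const transported_right_deriv adm a t)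
    moreover have "trace (pullback R (pullback (Z a t) (orbital_matrix P ?x))) < S + e"
    proof -
      have "trace (pullback R (pullback (Z a t) (orbital_matrix P ?x))) \<le> pos_root_sum (orbital_matrix P ?x) (P ?x)"
        using R(1) by (intro trace_bound_pullback[OF pd[OF a] pd[OF x]] orbital_matrix_symmetric adm x)
          (simp add: transported_def)
      then show ?thesis using S[OF x] e by linarith
    qed
    ultimately have "\<forall>\<^sub>F s in at_right 0. trace (pullback R ((1 / s) *\<^sub>R H s)) < S + e" by (rule order_tendstoD)
    then show "\<forall>\<^sub>F s in at_right 0. F (t + s) \<le> F t + s * (S + e)"
      using eventually_at_right_less[of 0]
    proof eventually_elim
      fix s assume tr: "trace (pullback R ((1 / s) *\<^sub>R H s)) < S + e" and s: "0 < s"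
      have ts: "0 \<le> t + s" using t s by simp
      have eq: "P a + transported P a (t + s) = ?A + H s" by (simp add: H_def)
      have "det (?A + H s) \<le> det ?A * exp (trace (pullback R (H s)))"
      proof (rule det_add_le[OF R(1)])
        show "transpose (H s) = H s"
          unfolding H_def using ts t a
          by (simp add: transpose_diff sym_pos_def_symmetric transported_pos_def pd)
        show "0 \<preceq> ?A + H s"
          unfolding eq[symmetric] loewner_le_def using sym_pos_def_nonneg[OF pdt[OF ts]] by simp
      qed
      also have "\<dots> \<le> det ?A * exp (s * (S + e))"
      proof -
        have "trace (pullback R (H s)) / s < S + e"
          using tr by (simp add: pullback_scaleR trace_scaleR)
        then have "trace (pullback R (H s)) \<le> s * (S + e)" using s by (simp add: field_simps)
        then show ?thesis using sym_pos_def_det_pos[OF pdt[OF t]] by (intro mult_left_mono) auto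
      qed
      finally have "ln (det (P a + transported P a (t + s))) \<le> ln (det ?A * exp (s * (S + e)))"
        unfolding eq[symmetric] using sym_pos_def_det_pos[OF pdt[OF ts]] sym_pos_def_det_pos[OF pdt[OF t]] by simp
      then show "F (t + s) \<le> F t + s * (S + e)"
        using sym_pos_def_det_pos[OF pdt[OF t]] by (simp add: F_def ln_mult)
    qed
  qed
  then show ?thesis using a by (simp add: F_def scaleR_2)
qed

text \<open>On the compact \<open>K\<close> the metric dominates \<open>m\<close> times the identity
  and its determinant is bounded. Hence passing between \<open>I + Z^T Z\<close> and
  \<open>P a + transported P a t\<close> costs only the constant \<open>C\<close>. The division by 2
  is the square root in \<open>vol_expansion\<close>.\<close>

lemma vol_expansion_growth:
  assumes adm: "admissible \<phi> K P"
    and S: "\<And>x. x \<in> K \<Longrightarrow> pos_root_sum (orbital_matrix P x) (P x) \<le> S"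
  obtains C where "\<And>a t. a \<in> K \<Longrightarrow> 0 \<le> t \<Longrightarrow> ln (vol_expansion (Z a t)) \<le> (S * t + C) / 2"
proof -
  have pd: "x \<in> K \<Longrightarrow> P x \<in> sym_pos_def" for x using adm by (auto simp: admissible_def)
  have P: "continuous_on K P" using adm by (simp add: admissible_def)
  obtain m where m: "0 < m" "\<And>x v. x \<in> K \<Longrightarrow> m * (v \<bullet> v) \<le> v \<bullet> (P x *v v)"
    using uniform_lower_bound[OF compact_K P pd] by blast
  have "compact ((\<lambda>x. det (P x)) ` K)" by (intro compact_continuous_image det_continuous_on P compact_K)
  then have "bounded ((\<lambda>x. det (P x)) ` K)" by (rule compact_imp_bounded)
  then obtain D where D: "0 < D" "\<And>x. x \<in> K \<Longrightarrow> det (P x) \<le> D"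
    unfolding bounded_pos by (auto simp: abs_le_iff)
  define C where "C = ln (2 ^ CARD('n) * D) - ln (m ^ CARD('n))"
  have "ln (vol_expansion (Z a t)) \<le> (S * t + C) / 2" if a: "a \<in> K" and t: "0 \<le> t" for a t
  proof -
    let ?W = "mat 1 + transpose (Z a t) ** Z a t"
    have W: "0 < det ?W" by (rule sym_pos_def_det_pos[OF mat_1_plus_pos_def])
    have "m *\<^sub>R ?W \<preceq> P a + transported P a t"
      unfolding loewner_le_def
    proof
      fix v
      have "m * (v \<bullet> v + (Z a t *v v) \<bullet> (Z a t *v v)) \<le> v \<bullet> (P a *v v) + (Z a t *v v) \<bullet> (P (traj a t) *v (Z a t *v v))"
        unfolding distrib_left by (intro add_mono m a traj_in_K t)
      moreover have "?W = mat 1 + pullback (Z a t) (mat 1)" by (simp add: pullback_def)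
      ultimately show "v \<bullet> (m *\<^sub>R ?W *v v) \<le> v \<bullet> ((P a + transported P a t) *v v)"
        by (simp add: transported_def matrix_vector_mult_add_rdistrib inner_add_right pullback_inner
            scaleR_matrix_vector_assoc[symmetric])
    qed
    moreover have "m *\<^sub>R ?W \<in> sym_pos_def" by (intro sym_pos_def_scaleR mat_1_plus_pos_def m)
    moreover have "P a + transported P a t \<in> sym_pos_def"
      using a t by (intro sym_pos_def_add transported_pos_def pd)
    ultimately have "m ^ CARD('n) * det ?W \<le> det (P a + transported P a t)"
      unfolding det_scaleR[symmetric] by (intro det_mono sym_pos_def_symmetric)
    then have "ln (m ^ CARD('n) * det ?W) \<le> ln (det (P a + transported P a t))"
      using m W by (intro ln_mono) auto
    also have "\<dots> \<le> ln (det (2 *\<^sub>R P a)) + S * t" by (rule ln_det_growth[OF adm a t S])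
    also have "ln (det (2 *\<^sub>R P a)) \<le> ln (2 ^ CARD('n) * D)"
      using D a sym_pos_def_det_pos[OF pd[OF a]] unfolding det_scaleR by (intro ln_mono mult_left_mono) auto
    finally have "ln (m ^ CARD('n)) + ln (det ?W) \<le> ln (2 ^ CARD('n) * D) + S * t"
      using m W by (simp add: ln_mult_pos)
    then have "ln (det ?W) \<le> S * t + C" by (simp add: C_def)
    then show ?thesis using W by (simp add: vol_expansion_def ln_sqrt)
  qed
  then show ?thesis by (rule that)
qed

theorem restoration_entropy_le:
  assumes adm: "admissible \<phi> K P"
  shows "restoration_entropy \<phi> K \<le> ennreal (1 / (2 * ln 2)) * max_pos_root_sum \<phi> K P"
proof (cases "max_pos_root_sum \<phi> K P = top")
  case True
  \<comment> \<open>An infinite supremum stays infinite under multiplication by the positive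
    constant.\<close>
  then show ?thesis by (simp add: ennreal_mult_top)
next
  case False
  define S where "S = enn2real (max_pos_root_sum \<phi> K P)"
  have S: "max_pos_root_sum \<phi> K P = ennreal S" "0 \<le> S"
    using False by (simp_all add: S_def ennreal_enn2real_if)
  have bound: "pos_root_sum (orbital_matrix P x) (P x) \<le> S" if "x \<in> K" for x
  proof -
    have "ennreal (pos_root_sum (orbital_matrix P x) (P x)) \<le> ennreal S"
      unfolding S(1)[symmetric] max_pos_root_sum_def sum_varsigma using that by (rule SUP_upper)
    then show ?thesis using S(2) by (simp add: ennreal_le_iff)
  qed
  obtain C where C: "\<And>a t. a \<in> K \<Longrightarrow> 0 \<le> t \<Longrightarrow> ln (vol_expansion (Z a t)) \<le> (S * t + C) / 2"
    using vol_expansion_growth[OF adm bound] by blast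
  obtain h where h: "0 \<le> h" "restoration_entropy \<phi> K = ennreal h"
    "((\<lambda>\<tau>. entropy_rate_real \<tau> / \<tau>) \<longlongrightarrow> h) at_top"
    using restoration_entropy_limit .
  define M where "M = real ((4 * CARD('n) + 7) ^ CARD('n))"
  have M: "1 \<le> M" by (simp add: M_def one_le_power)
  \<comment> \<open>The 2 stems from the square root in \<open>vol_expansion\<close>,
    \<open>ln 2\<close> from the change to binary logarithms.\<close>
  define c where "c = S / (2 * ln 2)"
  define D where "D = \<bar>log 2 M + C / (2 * ln 2)\<bar>"
  have c: "0 \<le> c" using S(2) by (simp add: c_def)
  have rate: "entropy_rate_real \<tau> \<le> c * \<tau> + D" if \<tau>: "0 \<le> \<tau>" for \<tau>
  proof -
    have "entropy_rate \<tau> \<le> ennreal (c * \<tau> + D)"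
    proof (rule entropy_rate_upper[OF \<tau>])
      fix a assume a: "a \<in> K"
      have v: "0 < vol_expansion (Z a \<tau>)" using vol_expansion_ge_1[of "Z a \<tau>"] by linarith
      have "log 2 (M * vol_expansion (Z a \<tau>)) = log 2 M + log 2 (vol_expansion (Z a \<tau>))"
        using M v by (intro log_mult_pos) auto
      also have "log 2 (vol_expansion (Z a \<tau>)) \<le> (S * \<tau> + C) / 2 / ln 2"
        unfolding log_def using C[OF a \<tau>] by (intro divide_right_mono) auto
      also have "(S * \<tau> + C) / 2 / ln 2 = c * \<tau> + C / (2 * ln 2)"
        by (simp add: c_def add_divide_distrib)
      finally show "log 2 ((4 * CARD('n) + 7) ^ CARD('n) * vol_expansion (Z a \<tau>)) \<le> c * \<tau> + D"
        unfolding M_def D_def by simp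
    qed
    moreover have "0 \<le> c * \<tau> + D" using c \<tau> by (simp add: D_def)
    ultimately show ?thesis unfolding entropy_rate_real[OF \<tau>] by (simp only: ennreal_le_iff)
  qed
  have "h \<le> c"
  proof (rule tendsto_le[OF _ _ h(3)])
    have "((\<lambda>\<tau>. c + D / \<tau>) \<longlongrightarrow> c + 0) at_top"
      by (intro tendsto_add tendsto_const real_tendsto_divide_at_top[OF tendsto_const filterlim_ident])
    then show "((\<lambda>\<tau>. c + D / \<tau>) \<longlongrightarrow> c) at_top" by simp
    show "\<forall>\<^sub>F \<tau> in at_top. entropy_rate_real \<tau> / \<tau> \<le> c + D / \<tau>"
      using eventually_gt_at_top[of 0]
    proof eventually_elim
      fix \<tau> :: real assume "0 < \<tau>"
      then show "entropy_rate_real \<tau> / \<tau> \<le> c + D / \<tau>" using rate[of \<tau>] by (simp add: field_simps)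
    qed
  qed simp
  then show ?thesis
    unfolding h(2) S(1) using S(2) by (subst ennreal_mult[symmetric]) (auto simp: c_def)
qed

end

section \<open>Construction of an almost optimal metric\<close>

lemma continuous_on_gmean:
  fixes f g :: "'b::topological_space \<Rightarrow> real^'n^'n"
  assumes f: "continuous_on S f" and g: "continuous_on S g"
    and fp: "\<And>x. x \<in> S \<Longrightarrow> f x \<in> sym_pos_def" and gp: "\<And>x. x \<in> S \<Longrightarrow> g x \<in> sym_pos_def"
  shows "continuous_on S (\<lambda>x. gmean (f x) (g x))"
  unfolding continuous_on_def
proof
  fix x assume x: "x \<in> S"
  \<comment> \<open>\<open>tendsto_gmean\<close> asks for positive definite values everywhere; off
    \<open>S\<close> the value at \<open>x\<close> is used instead.\<close>
  define f' g' where "f' y = (if y \<in> S then f y else f x)" and "g' y = (if y \<in> S then g y else g x)" for y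
  have ev: "\<forall>\<^sub>F y in at x within S. f y = f' y" "\<forall>\<^sub>F y in at x within S. g y = g' y"
    by (auto simp: eventually_at_filter f'_def g'_def)
  have "(f' \<longlongrightarrow> f x) (at x within S)" "(g' \<longlongrightarrow> g x) (at x within S)"
    using f g x unfolding continuous_on_def
    by (blast intro: Lim_transform_eventually[OF _ ev(1)] Lim_transform_eventually[OF _ ev(2)])+
  then have "((\<lambda>y. gmean (f' y) (g' y)) \<longlongrightarrow> gmean (f x) (g x)) (at x within S)"
    by (rule tendsto_gmean) (simp_all add: x f'_def g'_def fp gp)
  moreover have "\<forall>\<^sub>F y in at x within S. gmean (f' y) (g' y) = gmean (f y) (g y)"
    by (auto simp: eventually_at_filter f'_def g'_def)
  ultimately show "((\<lambda>y. gmean (f y) (g y)) \<longlongrightarrow> gmean (f x) (g x)) (at x within S)"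
    by (rule Lim_transform_eventually)
qed

lemma sym_pos_def_mono:
  "A \<in> sym_pos_def \<Longrightarrow> A \<preceq> B \<Longrightarrow> transpose B = B \<Longrightarrow> B \<in> sym_pos_def"
  unfolding sym_pos_def_def loewner_le_def by (auto intro: less_le_trans)

lemma bounded_linear_quadratic_form: "bounded_linear (\<lambda>M :: real^'n^'n. v \<bullet> (M *v v))"
  by (rule bounded_linear_compose[OF bounded_linear_inner_right
        bounded_bilinear.bounded_linear_left[OF bounded_bilinear_matrix_vector_mult]])

lemma bounded_linear_pullback: "bounded_linear (pullback S)"
  unfolding pullback_def[abs_def]
  by (rule bounded_linear_compose[OF bounded_bilinear.bounded_linear_left[OF bounded_bilinear_matrix_mult]
        bounded_bilinear.bounded_linear_right[OF bounded_bilinear_matrix_mult]])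

text \<open>With \<open>h\<close> the time step, the first factor is the loss from averaging and the
  second the growth over one step; together they tend to the rate \<open>c\<close>.\<close>

lemma exp_quotient_tendsto:
  "((\<lambda>h. exp (L * h) * ((exp (c * h) - 1) / h)) \<longlongrightarrow> c) (at_right (0 :: real))"
proof -
  have "((\<lambda>h. exp (c * h)) has_real_derivative c) (at 0)"
    by (auto intro!: derivative_eq_intros)
  then have "((\<lambda>h. (exp (c * h) - 1) / h) \<longlongrightarrow> c) (at 0)"
    by (simp add: has_field_derivative_iff)
  then have "((\<lambda>h. (exp (c * h) - 1) / h) \<longlongrightarrow> c) (at_right 0)"
    by (rule tendsto_within_subset) simp
  moreover have "((\<lambda>h. exp (L * h)) \<longlongrightarrow> exp (L * 0)) (at_right (0 :: real))"
    by (intro tendsto_intros)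
  ultimately have "((\<lambda>h. exp (L * h) * ((exp (c * h) - 1) / h)) \<longlongrightarrow> exp (L * 0) * c) (at_right 0)"
    by (intro tendsto_mult)
  then show ?thesis by simp
qed

section \<open>Repeated geometric means of a metric and its pullback\<close>

context compact_invariant_system
begin

lemma continuous_on_transported_joint:
  assumes P: "continuous_on K P" and T: "0 \<le> T"
  shows "continuous_on (K \<times> {0..T}) (\<lambda>(x, t). transported P x t)"
proof -
  have traj: "continuous_on (K \<times> {0..T}) (\<lambda>y. traj (fst y) (snd y))"
    and Z: "continuous_on (K \<times> {0..T}) (\<lambda>y. Z (fst y) (snd y))"
    using continuous_on_traj_joint[OF T] continuous_on_Z_joint[OF T] by (simp_all add: case_prod_beta)
  have "continuous_on (K \<times> {0..T}) (\<lambda>y. P (traj (fst y) (snd y)))"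
    by (rule continuous_on_compose2[OF P traj]) (auto intro: traj_in_K)
  with Z show ?thesis unfolding transported_def case_prod_beta by (intro continuous_intros)
qed

lemma continuous_on_transported_fst:
  assumes P: "continuous_on K P" and t: "0 \<le> t"
  shows "continuous_on K (\<lambda>x. transported P x t)"
proof -
  have c1: "continuous_on K (\<lambda>x. (x, t))" by (intro continuous_intros)
  have c2: "(\<lambda>x. (x, t)) ` K \<subseteq> K \<times> {0..t}" using t by auto
  from continuous_on_compose2[OF continuous_on_transported_joint[OF P t] c1 c2] show ?thesis by simp
qed

text \<open>Each step halves both the time step and the expansion over one step.\<close>

primrec bisected_metric :: "real \<Rightarrow> nat \<Rightarrow> real^'n \<Rightarrow> real^'n^'n" where
  "bisected_metric T 0 = (\<lambda>x. mat 1)"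
| "bisected_metric T (Suc k) =
    (\<lambda>x. gmean (bisected_metric T k x) (transported (bisected_metric T k) x (T / 2 ^ Suc k)))"

lemma bisected_metric_pos_def:
  assumes "0 \<le> T"
  shows "x \<in> K \<Longrightarrow> bisected_metric T k x \<in> sym_pos_def"
proof (induction k arbitrary: x)
  case (Suc k)
  then show ?case using assms by (auto intro!: gmean_pos_def transported_pos_def)
qed (simp add: mat_1_pos_def)

lemma continuous_on_bisected_metric:
  assumes T: "0 \<le> T"
  shows "continuous_on K (bisected_metric T k)"
proof (induction k)
  case (Suc k)
  then show ?case
    using T unfolding bisected_metric.simps
    by (intro continuous_on_gmean continuous_on_transported_fst bisected_metric_pos_def transported_pos_def) auto
qed simp

text \<open>Transport is a congruence and hence commutes with the geometric mean; only the time
  argument shifts.\<close>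

lemma transported_bisected_metric_Suc:
  assumes T: "0 \<le> T" and x: "x \<in> K" and s: "0 \<le> s"
  shows "transported (bisected_metric T (Suc k)) x s =
    gmean (transported (bisected_metric T k) x s) (transported (bisected_metric T k) x (s + T / 2 ^ Suc k))"
proof -
  let ?M = "bisected_metric T k" and ?h = "T / 2 ^ Suc k"
  have h: "0 \<le> ?h" using T by simp
  have xs: "traj x s \<in> K" by (rule traj_in_K[OF x s])
  have "transported (bisected_metric T (Suc k)) x s
      = pullback (Z x s) (gmean (?M (traj x s)) (transported ?M (traj x s) ?h))"
    by (simp add: transported_def[of _ x s])
  also have "\<dots> = gmean (pullback (Z x s) (?M (traj x s))) (pullback (Z x s) (transported ?M (traj x s) ?h))"
    by (rule gmean_pullback[symmetric])
      (use T h xs x s in \<open>auto intro!: bisected_metric_pos_def transported_pos_def dest: det_Z_nonzero\<close>)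
  also have "pullback (Z x s) (transported ?M (traj x s) ?h) = transported ?M x (s + ?h)"
    by (rule transported_add[OF x s h, symmetric])
  finally show ?thesis by (simp add: transported_def[of _ x s])
qed

text \<open>The constant does not deteriorate with \<open>k\<close>: by monotonicity and homogeneity
  of the mean, the relation passes from a metric and its transport to their mean. At level 0 it is
  the lower growth bound of \<open>Z\<close>.\<close>

lemma bisected_metric_le_transported:
  assumes T: "0 \<le> T"
  shows "x \<in> K \<Longrightarrow> 0 \<le> s \<Longrightarrow> exp (- (2 * lip * s)) *\<^sub>R bisected_metric T k x \<preceq> transported (bisected_metric T k) x s"
proof (induction k arbitrary: x)
  case 0
  then show ?case
    using Z_growth_bounds(2)[of x s]
    by (simp add: loewner_le_def transported_def pullback_inner scaleR_matrix_vector_assoc[symmetric])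
next
  case (Suc k)
  let ?M = "bisected_metric T k" and ?h = "T / 2 ^ Suc k" and ?e = "exp (- (2 * lip * s))"
  have h: "0 \<le> ?h" using T by simp
  have xh: "traj x ?h \<in> K" by (rule traj_in_K[OF Suc.prems(1) h])
  have pd: "?M y \<in> sym_pos_def" "0 \<le> t \<Longrightarrow> transported ?M y t \<in> sym_pos_def" if "y \<in> K" for y t
    using that T by (auto intro!: bisected_metric_pos_def transported_pos_def)
  have "pullback (Z x ?h) (?e *\<^sub>R ?M (traj x ?h)) \<preceq> pullback (Z x ?h) (transported ?M (traj x ?h) s)"
    by (intro pullback_mono Suc.IH xh Suc.prems)
  then have *: "?e *\<^sub>R transported ?M x ?h \<preceq> transported ?M x (s + ?h)"
    using transported_add[OF Suc.prems(1) h Suc.prems(2), of ?M] transported_def[of ?M x ?h]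
    by (simp add: pullback_scaleR add.commute)
  have "?e *\<^sub>R bisected_metric T (Suc k) x = gmean (?e *\<^sub>R ?M x) (?e *\<^sub>R transported ?M x ?h)"
    using gmean_scaleR[OF pd(1)[OF Suc.prems(1)] pd(2)[OF Suc.prems(1) h], of ?e] by simp
  also have "\<dots> \<preceq> gmean (transported ?M x s) (transported ?M x (s + ?h))"
    using Suc.prems h by (intro gmean_mono sym_pos_def_scaleR pd Suc.IH *) auto
  also have "\<dots> = transported (bisected_metric T (Suc k)) x s"
    by (rule transported_bisected_metric_Suc[OF T Suc.prems, symmetric])
  finally show ?case .
qed

text \<open>For positive definite \<open>A\<close> and \<open>B\<close>, the existence of \<open>C \<succeq> A, B\<close> with \<open>det C \<le> e\<^sup>r det A\<close> means
  that the positive parts of the logarithms of the eigenvalues of \<open>A\<^sup>-\<^sup>1 B\<close> add up to at most \<open>r\<close>.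
  Since the geometric mean is monotone and symmetric, such a \<open>C\<close> for \<open>A\<close> and \<open>E\<close> yields the
  majorant \<open>B # C\<close> for \<open>A # B\<close> and \<open>B # E\<close>, with \<open>r / 2\<close> in place of \<open>r\<close>.\<close>

lemma bisected_metric_majorant:
  assumes T: "0 \<le> T" and c: "\<And>x. x \<in> K \<Longrightarrow> det (mat 1 + transpose (Z x T) ** Z x T) \<le> exp (c * T)"
  shows "x \<in> K \<Longrightarrow> \<exists>C. transpose C = C \<and> bisected_metric T k x \<preceq> C \<and>
    transported (bisected_metric T k) x (T / 2 ^ k) \<preceq> C \<and>
    det C \<le> exp (c * (T / 2 ^ k)) * det (bisected_metric T k x)"
proof (induction k arbitrary: x)
  case 0
  \<comment> \<open>This sum dominates both the identity and its pullback, and its determinant is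
    the quantity bounded by \<open>c\<close>.\<close>
  let ?C = "mat 1 + transpose (Z x T) ** Z x T"
  have eq: "?C = mat 1 + pullback (Z x T) (mat 1)" by (simp add: pullback_def)
  have "mat 1 \<preceq> ?C" "pullback (Z x T) (mat 1) \<preceq> ?C"
    unfolding eq by (simp_all add: loewner_le_def matrix_vector_mult_add_rdistrib inner_add_right pullback_inner)
  then show ?case
    using c[OF 0] by (intro exI[of _ ?C]) (simp add: transported_def sym_pos_def_symmetric[OF mat_1_plus_pos_def])
next
  case (Suc k)
  let ?M = "bisected_metric T k" and ?h = "T / 2 ^ Suc k"
  have h: "0 \<le> ?h" and hh: "?h + ?h = T / 2 ^ k" using T by auto
  have pd: "?M y \<in> sym_pos_def" "0 \<le> t \<Longrightarrow> transported ?M y t \<in> sym_pos_def" if "y \<in> K" for y t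
    using that T by (auto intro!: bisected_metric_pos_def transported_pos_def)
  let ?A = "?M x" and ?B = "transported ?M x ?h" and ?E = "transported ?M x (T / 2 ^ k)"
  have A: "?A \<in> sym_pos_def" and B: "?B \<in> sym_pos_def" and E: "?E \<in> sym_pos_def"
    using pd[OF Suc.prems] T by auto
  obtain C where C: "transpose C = C" "?A \<preceq> C" "?E \<preceq> C" "det C \<le> exp (c * (T / 2 ^ k)) * det ?A"
    using Suc.IH[OF Suc.prems] by blast
  have Cpd: "C \<in> sym_pos_def" by (rule sym_pos_def_mono[OF A C(2,1)])
  have "gmean ?A ?B \<preceq> gmean C ?B" by (intro gmean_mono A B Cpd C) simp
  then have "bisected_metric T (Suc k) x \<preceq> gmean C ?B" by simp
  moreover have "transported (bisected_metric T (Suc k)) x ?h \<preceq> gmean C ?B"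
  proof -
    have "transported (bisected_metric T (Suc k)) x ?h = gmean ?B ?E"
      unfolding transported_bisected_metric_Suc[OF T Suc.prems h] hh ..
    also have "\<dots> = gmean ?E ?B" by (rule gmean_commute[OF B E])
    also have "\<dots> \<preceq> gmean C ?B" by (intro gmean_mono E B Cpd C) simp
    finally show ?thesis .
  qed
  moreover have "det (gmean C ?B) \<le> exp (c * ?h) * det (bisected_metric T (Suc k) x)"
  \<comment> \<open>Squares are compared because \<open>gmean_det\<close> speaks of squares. The
    factor \<open>det ?B\<close> is common to both sides, and taking the root halves the
    exponent.\<close>
  proof (rule power2_le_imp_le)
    have "(det (gmean C ?B))\<^sup>2 = det C * det ?B" by (rule gmean_det[OF Cpd B])
    also have "\<dots> \<le> exp (c * (T / 2 ^ k)) * det ?A * det ?B"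
      using sym_pos_def_det_pos[OF B] C(4) by (intro mult_right_mono) auto
    also have "\<dots> = (exp (c * ?h))\<^sup>2 * (det (gmean ?A ?B))\<^sup>2"
    proof -
      have "(exp (c * ?h))\<^sup>2 = exp (c * (T / 2 ^ k))"
        unfolding power2_eq_square exp_add[symmetric] distrib_left[symmetric] hh ..
      then show ?thesis by (simp only: gmean_det[OF A B] mult.assoc)
    qed
    finally show "(det (gmean C ?B))\<^sup>2 \<le> (exp (c * ?h) * det (bisected_metric T (Suc k) x))\<^sup>2"
      by (simp add: power_mult_distrib)
    show "0 \<le> exp (c * ?h) * det (bisected_metric T (Suc k) x)"
      using sym_pos_def_det_pos[OF bisected_metric_pos_def[OF T Suc.prems, of "Suc k"]] by simp
  qed
  ultimately show ?case
    using sym_pos_def_symmetric[OF gmean_pos_def[OF Cpd B]] by blast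
qed

section \<open>Averaging the pullbacks of a metric along the flow\<close>

definition averaged_metric :: "real \<Rightarrow> (real^'n \<Rightarrow> real^'n^'n) \<Rightarrow> real^'n \<Rightarrow> real^'n^'n" where
  "averaged_metric h P x = (1 / h) *\<^sub>R integral {0..h} (transported P x)"

lemma transported_integrable:
  assumes P: "continuous_on K P" and x: "x \<in> K" and r: "0 \<le> r"
  shows "transported P x integrable_on {r..t}"
  using continuous_on_transported[OF P x] r
  by (intro integrable_continuous_real) (auto intro: continuous_on_subset)

lemma averaged_metric_ge:
  assumes P: "continuous_on K P" and x: "x \<in> K" and h: "0 < h" and A: "\<And>s. s \<in> {0..h} \<Longrightarrow> A \<preceq> transported P x s"
  shows "A \<preceq> averaged_metric h P x"
  unfolding loewner_le_def
proof
  fix v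
  note int = transported_integrable[OF P x order_refl, of h]
  have "h * (v \<bullet> (A *v v)) = integral {0..h} (\<lambda>s. v \<bullet> (A *v v))" using h by simp
  also have "\<dots> \<le> integral {0..h} (\<lambda>s. v \<bullet> (transported P x s *v v))"
    using A integrable_linear[OF int bounded_linear_quadratic_form, of v]
    by (intro integral_le) (auto simp: loewner_le_def o_def)
  also have "\<dots> = v \<bullet> (integral {0..h} (transported P x) *v v)"
    using integral_linear[OF int bounded_linear_quadratic_form, of v] by (simp add: o_def)
  finally show "v \<bullet> (A *v v) \<le> v \<bullet> (averaged_metric h P x *v v)"
    using h by (simp add: averaged_metric_def scaleR_matrix_vector_assoc[symmetric] field_simps)
qed

lemma averaged_metric_symmetric:
  assumes P: "continuous_on K P" and pd: "\<And>x. x \<in> K \<Longrightarrow> P x \<in> sym_pos_def" and x: "x \<in> K"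
  shows "transpose (averaged_metric h P x) = averaged_metric h P x"
proof -
  note int = transported_integrable[OF P x order_refl, of h]
  have "transpose (integral {0..h} (transported P x)) = integral {0..h} (\<lambda>s. transpose (transported P x s))"
    using integral_linear[OF int bounded_linear_transpose] by (simp add: o_def)
  also have "\<dots> = integral {0..h} (transported P x)"
    using pd x by (intro Henstock_Kurzweil_Integration.integral_cong sym_pos_def_symmetric transported_pos_def) auto
  finally show ?thesis by (simp add: averaged_metric_def transpose_scalar)
qed

lemma continuous_on_averaged_metric:
  assumes P: "continuous_on K P" and h: "0 < h"
  shows "continuous_on K (averaged_metric h P)"
  unfolding averaged_metric_def[abs_def]
  using integral_continuous_on_param[of K 0 h "transported P"] continuous_on_transported_joint[OF P, of h] h
  by (intro continuous_intros) (simp add: cbox_interval)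

text \<open>By the cocycle property the transported average is the average over the shifted window
  from \<open>t\<close> to \<open>t + h\<close>.\<close>

lemma transported_averaged_metric:
  assumes P: "continuous_on K P" and x: "x \<in> K" and h: "0 < h" and t: "0 \<le> t"
  shows "transported (averaged_metric h P) x t = (1 / h) *\<^sub>R
    (integral {0..t + h} (transported P x) - integral {0..t} (transported P x))"
proof -
  let ?I = "\<lambda>r. integral {0..r} (transported P x)"
  have xt: "traj x t \<in> K" by (rule traj_in_K[OF x t])
  have "((\<lambda>s. transported P x (t + s)) has_integral (?I (t + h) - ?I (t + 0))) {0..h}"
  proof (rule fundamental_theorem_of_calculus)
    fix s assume s: "s \<in> {0..h}"
    have "(?I has_vector_derivative transported P x (t + s)) (at (t + s) within {0..t + h})"
      using s t continuous_on_transported[OF P x]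
      by (intro integral_has_vector_derivative) (auto intro: continuous_on_subset)
    then have "(?I has_vector_derivative transported P x (t + s)) (at (t + s) within (+) t ` {0..h})"
      by (rule has_vector_derivative_within_subset) (use t in auto)
    then have "(?I \<circ> (+) t has_vector_derivative 1 *\<^sub>R transported P x (t + s)) (at s within {0..h})"
      by (intro vector_diff_chain_within) (auto intro!: derivative_eq_intros)
    then show "((\<lambda>s. ?I (t + s)) has_vector_derivative transported P x (t + s)) (at s within {0..h})"
      by (simp add: o_def)
  qed (use h in simp)
  then have I: "integral {0..h} (\<lambda>s. transported P x (t + s)) = ?I (t + h) - ?I t"
    by (simp add: integral_unique)
  note int = transported_integrable[OF P xt order_refl, of h]
  have "pullback (Z x t) (integral {0..h} (transported P (traj x t)))
      = integral {0..h} (\<lambda>s. pullback (Z x t) (transported P (traj x t) s))"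
    using integral_linear[OF int bounded_linear_pullback, of "Z x t"] by (simp add: o_def)
  also have "\<dots> = integral {0..h} (\<lambda>s. transported P x (t + s))"
    using transported_add[OF x t] by (intro Henstock_Kurzweil_Integration.integral_cong) auto
  finally show ?thesis
    by (simp add: transported_def[of "averaged_metric h P"] averaged_metric_def pullback_scaleR I)
qed

text \<open>Differentiating an integral over a moving window leaves the difference of the integrand
  at the two ends, so continuity of \<open>P\<close> is enough.\<close>

lemma transported_averaged_metric_right_deriv:
  assumes P: "continuous_on K P" and x: "x \<in> K" and h: "0 < h"
  shows "((\<lambda>s. (1 / s) *\<^sub>R (transported (averaged_metric h P) x s - averaged_metric h P x)) \<longlongrightarrow>
    (1 / h) *\<^sub>R (transported P x h - P x)) (at_right 0)"
proof -
  let ?I = "\<lambda>r. integral {0..r} (transported P x)"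
  define f where "f t = (1 / h) *\<^sub>R (?I (t + h) - ?I t)" for t
  have dI: "(?I has_vector_derivative transported P x r) (at r within {0..})" if r: "0 \<le> r" for r
  proof -
    have "(?I has_vector_derivative transported P x r) (at r within {0..r + 1})"
      using r continuous_on_transported[OF P x]
      by (intro integral_has_vector_derivative) (auto intro: continuous_on_subset)
    moreover have "at r within {0..r + 1} = at r within {0..}"
      by (rule at_within_nhd[of _ "{..<r + 1}"]) auto
    ultimately show ?thesis by simp
  qed
  have "(?I \<circ> (\<lambda>t. t + h) has_vector_derivative 1 *\<^sub>R transported P x (0 + h)) (at 0 within {0..})"
    by (rule vector_diff_chain_within)
      (use h in \<open>auto intro!: derivative_eq_intros has_vector_derivative_within_subset[OF dI]\<close>)
  then have "((\<lambda>t. ?I (t + h)) has_vector_derivative transported P x h) (at 0 within {0..})"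
    by (simp add: o_def)
  from has_vector_derivative_diff[OF this dI[OF order_refl]]
  have "((\<lambda>t. ?I (t + h) - ?I t) has_vector_derivative transported P x h - P x) (at 0 within {0..})"
    using x by simp
  then have "(f has_vector_derivative (1 / h) *\<^sub>R (transported P x h - P x)) (at 0 within {0..})"
    unfolding f_def[abs_def] by (rule bounded_linear.has_vector_derivative[OF bounded_linear_scaleR_right])
  from right_derivative_tendsto[OF this]
  have "((\<lambda>s. (1 / s) *\<^sub>R (f s - f 0)) \<longlongrightarrow> (1 / h) *\<^sub>R (transported P x h - P x)) (at_right 0)" .
  moreover have "\<forall>\<^sub>F s in at_right 0. (1 / s) *\<^sub>R (f s - f 0)
      = (1 / s) *\<^sub>R (transported (averaged_metric h P) x s - averaged_metric h P x)"
    using eventually_at_right_less[of 0]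
    by eventually_elim (simp add: f_def transported_averaged_metric[OF P x h] averaged_metric_def)
  ultimately show ?thesis by (rule Lim_transform_eventually)
qed

text \<open>The product rule is solved for the orbital derivative. The subtracted terms are those
  that \<open>orbital_matrix\<close> adds, so the latter becomes exactly the difference quotient of
  the pullback.\<close>

lemma averaged_metric_orbital_deriv:
  assumes P: "continuous_on K P" and x: "x \<in> K" and h: "0 < h"
  defines "R \<equiv> averaged_metric h P"
  shows "orbitally_differentiable_at \<phi> R x"
    and "orbital_deriv \<phi> R x = (1 / h) *\<^sub>R (transported P x h - P x) - (R x ** J x + transpose (J x) ** R x)"
proof -
  let ?D = "(1 / h) *\<^sub>R (transported P x h - P x) - (R x ** J x + transpose (J x) ** R x)"
  have R: "continuous_on K R" unfolding R_def by (rule continuous_on_averaged_metric[OF P h])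
  have "((\<lambda>s. (1 / s) *\<^sub>R (R (traj x s) - R x)) \<longlongrightarrow> ?D) (at_right 0)"
    unfolding pullback_difference_tendsto_iff[OF R x, symmetric]
    using transported_averaged_metric_right_deriv[OF P x h] unfolding R_def[symmetric]
    by (simp add: transported_def[of R])
  moreover have "\<forall>\<^sub>F s in at_right 0. (1 / s) *\<^sub>R (R (traj x s) - R x) = orbital_quotient \<phi> R x s"
    using eventually_at_right_less[of 0]
    by eventually_elim (simp add: orbital_quotient_def flow_eq_traj[OF x])
  ultimately have lim: "(orbital_quotient \<phi> R x \<longlongrightarrow> ?D) (at_right 0)"
    by (rule Lim_transform_eventually)
  then show "orbitally_differentiable_at \<phi> R x" unfolding orbitally_differentiable_at_def by blast
  show "orbital_deriv \<phi> R x = ?D"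
    unfolding orbital_deriv_def by (rule tendsto_Lim[OF _ lim]) (simp add: trivial_limit_at_right_real)
qed

text \<open>The explicit formula for the orbital derivative is continuous on \<open>K\<close>, which
  gives continuity along orbits. The comparison by \<open>\<gamma>\<close> supplies one positive
  definite lower bound for all the matrices averaged at a point, hence for their mean.\<close>

lemma averaged_metric_admissible:
  assumes P: "continuous_on K P" and h: "0 < h" and pd: "\<And>x. x \<in> K \<Longrightarrow> P x \<in> sym_pos_def"
    and \<gamma>: "0 < \<gamma>" "\<And>x s. x \<in> K \<Longrightarrow> s \<in> {0..h} \<Longrightarrow> \<gamma> *\<^sub>R P x \<preceq> transported P x s"
  shows "admissible \<phi> K (averaged_metric h P)"
  unfolding admissible_def
proof (intro conjI ballI)
  let ?R = "averaged_metric h P"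
  have R: "continuous_on K ?R" by (rule continuous_on_averaged_metric[OF P h])
  show "?R ` K \<subseteq> sym_pos_def"
  proof
    fix y assume "y \<in> ?R ` K"
    then obtain x where x: "x \<in> K" "y = ?R x" by blast
    have "\<gamma> *\<^sub>R P x \<preceq> ?R x" using x \<gamma> by (intro averaged_metric_ge P h) auto
    then show "y \<in> sym_pos_def"
      unfolding x(2)
      by (rule sym_pos_def_mono[OF sym_pos_def_scaleR[OF pd[OF x(1)] \<gamma>(1)]]) (rule averaged_metric_symmetric[OF P pd x(1)])
  qed
  show "continuous_on K ?R" by (rule R)
  show "orbitally_differentiable_at \<phi> ?R a" if "a \<in> K" for a
    by (rule averaged_metric_orbital_deriv(1)[OF P that h])
  fix a assume a: "a \<in> K"
  define D where "D x = (1 / h) *\<^sub>R (transported P x h - P x) - (?R x ** J x + transpose (J x) ** ?R x)" for x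
  have "continuous_on K D"
    unfolding D_def[abs_def] using h
    by (intro continuous_intros continuous_on_transported_fst P R continuous_on_J) auto
  from continuous_on_compose_traj[OF this a] have "continuous_on {0..} (\<lambda>t. D (traj a t))" .
  moreover have "D (traj a t) = orbital_deriv \<phi> ?R (flow \<phi> t a)" if "t \<in> {0..}" for t
    using that averaged_metric_orbital_deriv(2)[OF P traj_in_K[OF a] h, of t] flow_eq_traj[OF a, of t]
    by (simp add: D_def)
  ultimately show "continuous_on {0..} (\<lambda>t. orbital_deriv \<phi> ?R (flow \<phi> t a))"
    by (simp cong: continuous_on_cong_simp)
qed

lemma bisected_averaged_metric_bound:
  fixes k :: nat
  assumes T: "0 < T" and c: "\<And>x. x \<in> K \<Longrightarrow> det (mat 1 + transpose (Z x T) ** Z x T) \<le> exp (c * T)"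
  defines "h \<equiv> T / 2 ^ k"
  defines "R \<equiv> averaged_metric h (bisected_metric T k)"
  shows "admissible \<phi> K R" "max_pos_root_sum \<phi> K R \<le> ennreal (exp (2 * lip * h) * ((exp (c * h) - 1) / h))"
proof -
  let ?M = "bisected_metric T k"
  have T0: "0 \<le> T" and h: "0 < h" using T by (auto simp: h_def)
  have M: "continuous_on K ?M" by (rule continuous_on_bisected_metric[OF T0])
  have pd: "x \<in> K \<Longrightarrow> ?M x \<in> sym_pos_def" for x by (rule bisected_metric_pos_def[OF T0])
  let ?g = "exp (- (2 * lip * h))"
  \<comment> \<open>The weakest lower bound on the window is the one at time \<open>h\<close>; using
    it for all times gives a bound independent of \<open>s\<close>, which survives
    averaging.\<close>
  have close: "?g *\<^sub>R ?M x \<preceq> transported ?M x s" if x: "x \<in> K" and s: "s \<in> {0..h}" for x s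
  proof -
    have "?g *\<^sub>R ?M x \<preceq> exp (- (2 * lip * s)) *\<^sub>R ?M x"
      unfolding loewner_le_def scaleR_matrix_vector_assoc[symmetric] inner_scaleR_right
      using s lip_cball(1) sym_pos_def_nonneg[OF pd[OF x]] by (auto intro!: mult_right_mono mult_left_mono)
    also have "\<dots> \<preceq> transported ?M x s" using s by (intro bisected_metric_le_transported T0 x) auto
    finally show ?thesis .
  qed
  show adm: "admissible \<phi> K R"
    unfolding R_def by (rule averaged_metric_admissible[OF M h pd _ close]) auto
  show "max_pos_root_sum \<phi> K R \<le> ennreal (exp (2 * lip * h) * ((exp (c * h) - 1) / h))"
    unfolding max_pos_root_sum_def sum_varsigma
  proof (intro SUP_least ennreal_leI)
    fix x assume x: "x \<in> K"
    define Q where "Q = (1 / h) *\<^sub>R (transported ?M x h - ?M x)"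
    have Q: "orbital_matrix R x = Q"
      unfolding orbital_matrix_def R_def averaged_metric_orbital_deriv(2)[OF M x h] by (simp add: Q_def)
    obtain C where C: "transpose C = C" "?M x \<preceq> C" "transported ?M x h \<preceq> C" "det C \<le> exp (c * h) * det (?M x)"
      using bisected_metric_majorant[OF T0 c x, of k] unfolding h_def by blast
    have "h * pos_root_sum Q (R x) \<le> exp (2 * lip * h) * (exp (c * h) - 1)"
    \<comment> \<open>Comparing \<open>R x\<close> with the unaveraged metric costs
      \<open>exp (2 * lip * h)\<close>. The majorant \<open>C\<close> enters through the increment
      \<open>C - ?M x\<close>, which dominates both 0 and \<open>h *\<^sub>R Q\<close>, the change
      of the metric under transport.\<close>
    proof (rule pos_root_sum_le[where P'="?M x" and N="C - ?M x"])
      show "R x \<in> sym_pos_def" using adm x by (auto simp: admissible_def)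
      show "?M x \<in> sym_pos_def" by (rule pd[OF x])
      have "?g *\<^sub>R ?M x \<preceq> R x" unfolding R_def by (intro averaged_metric_ge M x h close)
      then show "?M x \<preceq> exp (2 * lip * h) *\<^sub>R R x"
        by (simp add: loewner_le_def scaleR_matrix_vector_assoc[symmetric] exp_minus field_simps)
      show "transpose Q = Q" unfolding Q[symmetric] by (rule orbital_matrix_symmetric[OF adm x])
      show "transpose (C - ?M x) = C - ?M x"
        by (simp add: transpose_diff C sym_pos_def_symmetric[OF pd[OF x]])
      show "0 \<preceq> C - ?M x"
        using C(2) by (simp add: loewner_le_def matrix_vector_mult_diff_rdistrib inner_diff_right)
      show "h *\<^sub>R Q \<preceq> C - ?M x"
        using C(3) h by (simp add: Q_def loewner_le_def matrix_vector_mult_diff_rdistrib inner_diff_right)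
      show "det (?M x + (C - ?M x)) \<le> exp (c * h) * det (?M x)" using C(4) by simp
    qed (rule h)
    then show "pos_root_sum (orbital_matrix R x) (R x) \<le> exp (2 * lip * h) * ((exp (c * h) - 1) / h)"
      unfolding Q using h by (simp add: field_simps)
  qed
qed

theorem restoration_entropy_ge:
  assumes K: "K = closure (interior K)" and \<epsilon>: "0 < \<epsilon>"
  shows "\<exists>P. admissible \<phi> K P \<and>
    restoration_entropy \<phi> K \<ge> ennreal (1 / (2 * ln 2)) * max_pos_root_sum \<phi> K P - ennreal \<epsilon>"
proof -
  obtain H where H: "0 \<le> H" "restoration_entropy \<phi> K = ennreal H"
    "((\<lambda>\<tau>. entropy_rate_real \<tau> / \<tau>) \<longlongrightarrow> H) at_top"
    using restoration_entropy_limit .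
  define M where "M = real ((7 * CARD('n)) ^ CARD('n))"
  have M: "0 < M" by (simp add: M_def)
  \<comment> \<open>The constant \<open>M\<close> of the lower covering bound becomes negligible for
    large times.\<close>
  have "((\<lambda>\<tau>. entropy_rate_real \<tau> / \<tau> + log 2 M / \<tau>) \<longlongrightarrow> H + 0) at_top"
    by (intro tendsto_add H(3) real_tendsto_divide_at_top[OF tendsto_const filterlim_ident])
  then have "\<forall>\<^sub>F \<tau> in at_top. entropy_rate_real \<tau> / \<tau> + log 2 M / \<tau> < H + \<epsilon> / 2"
    using \<epsilon> by (intro order_tendstoD) auto
  then have "\<forall>\<^sub>F \<tau> in at_top. entropy_rate_real \<tau> / \<tau> + log 2 M / \<tau> < H + \<epsilon> / 2 \<and> 0 < \<tau>"
    by (intro eventually_conj eventually_gt_at_top)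
  then obtain T where T: "entropy_rate_real T / T + log 2 M / T < H + \<epsilon> / 2" "0 < T"
    using eventually_happens'[OF trivial_limit_at_top_linorder] by blast
  \<comment> \<open>Half of \<open>\<epsilon>\<close> is spent on choosing \<open>T\<close>; the
    other half is left for the loss in averaging. The factor \<open>2 * ln 2\<close> turns a bound
    on the binary logarithm of a square root into one on \<open>ln\<close> of the
    determinant.\<close>
  define c where "c = 2 * ln 2 * (H + \<epsilon> / 2)"
  have det: "det (mat 1 + transpose (Z x T) ** Z x T) \<le> exp (c * T)" if x: "x \<in> K" for x
  proof -
    let ?W = "mat 1 + transpose (Z x T) ** Z x T"
    have W: "0 < det ?W" by (rule sym_pos_def_det_pos[OF mat_1_plus_pos_def])
    have v: "0 < vol_expansion (Z x T)" using vol_expansion_ge_1[of "Z x T"] by linarith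
    have "log 2 (vol_expansion (Z x T)) - log 2 M \<le> entropy_rate_real T"
      using entropy_rate_lower[OF K x, of T] T(2) M v unfolding M_def[symmetric]
      by (simp add: log_divide_pos)
    moreover have "entropy_rate_real T + log 2 M < (H + \<epsilon> / 2) * T"
      using T by (simp add: field_simps)
    ultimately have "log 2 (vol_expansion (Z x T)) \<le> (H + \<epsilon> / 2) * T" by linarith
    then have "ln (vol_expansion (Z x T)) \<le> (H + \<epsilon> / 2) * T * ln 2"
      by (simp add: log_def divide_le_eq)
    moreover have "ln (vol_expansion (Z x T)) = ln (det ?W) / 2"
      using W by (simp add: vol_expansion_def ln_sqrt)
    ultimately have "ln (det ?W) \<le> c * T" by (simp add: c_def algebra_simps)
    then show ?thesis using W by (metis exp_le_cancel_iff exp_ln)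
  qed
  have "filterlim (\<lambda>k. T / 2 ^ k) (at_right 0) sequentially"
    using T(2) by (intro tendsto_imp_filterlim_at_right LIMSEQ_divide_realpow_zero) auto
  from filterlim_compose[OF exp_quotient_tendsto[of "2 * lip" c] this]
  have "(\<lambda>k. exp (2 * lip * (T / 2 ^ k)) * ((exp (c * (T / 2 ^ k)) - 1) / (T / 2 ^ k))) \<longlonglongrightarrow> c" .
  moreover have "c < 2 * ln 2 * (H + \<epsilon>)" using \<epsilon> by (simp add: c_def)
  ultimately have "\<forall>\<^sub>F k in sequentially.
      exp (2 * lip * (T / 2 ^ k)) * ((exp (c * (T / 2 ^ k)) - 1) / (T / 2 ^ k)) < 2 * ln 2 * (H + \<epsilon>)"
    by (rule order_tendstoD)
  then obtain k where k: "exp (2 * lip * (T / 2 ^ k)) * ((exp (c * (T / 2 ^ k)) - 1) / (T / 2 ^ k)) < 2 * ln 2 * (H + \<epsilon>)"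
    using eventually_happens'[OF sequentially_bot] by blast
  define P where "P = averaged_metric (T / 2 ^ k) (bisected_metric T k)"
  have adm: "admissible \<phi> K P"
    unfolding P_def using T(2) det by (rule bisected_averaged_metric_bound(1))
  have "max_pos_root_sum \<phi> K P \<le> ennreal (exp (2 * lip * (T / 2 ^ k)) * ((exp (c * (T / 2 ^ k)) - 1) / (T / 2 ^ k)))"
    unfolding P_def using T(2) det by (rule bisected_averaged_metric_bound(2))
  also have "\<dots> \<le> ennreal (2 * ln 2 * (H + \<epsilon>))" using k by (intro ennreal_leI) simp
  finally have "ennreal (1 / (2 * ln 2)) * max_pos_root_sum \<phi> K P \<le> ennreal (1 / (2 * ln 2)) * ennreal (2 * ln 2 * (H + \<epsilon>))"
    by (rule mult_left_mono) simp
  also have "\<dots> = ennreal H + ennreal \<epsilon>"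
    using H(1) \<epsilon> by (simp add: ennreal_mult[symmetric] del: ennreal_plus) (simp add: ennreal_plus)
  finally have "ennreal (1 / (2 * ln 2)) * max_pos_root_sum \<phi> K P \<le> ennreal H + ennreal \<epsilon>" .
  \<comment> \<open>Subtraction in \<open>ennreal\<close> is truncated at 0, which leaves the claim
    unchanged since the entropy is nonnegative.\<close>
  then have "ennreal (1 / (2 * ln 2)) * max_pos_root_sum \<phi> K P - ennreal \<epsilon> \<le> restoration_entropy \<phi> K"
    unfolding H(2) by (simp add: ennreal_minus_le_iff add.commute)
  with adm show ?thesis by blast
qed

end

theorem theorem3p7:
  fixes \<phi> :: "real^'n \<Rightarrow> real^'n" and K :: "(real^'n) set"
  assumes "class_C1 \<phi>" and "compact K" and "forward_invariant \<phi> K"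
  shows "(\<forall>P. admissible \<phi> K P \<longrightarrow>
            restoration_entropy \<phi> K \<le> ennreal (1 / (2 * ln 2)) * max_pos_root_sum \<phi> K P) \<and>
         (K = closure (interior K) \<longrightarrow>
           (\<forall>\<epsilon>::real. \<epsilon> > 0 \<longrightarrow>
             (\<exists>P. admissible \<phi> K P \<and>
                restoration_entropy \<phi> K
                  \<ge> ennreal (1 / (2 * ln 2)) * max_pos_root_sum \<phi> K P - ennreal \<epsilon>)))"
proof -
  interpret compact_invariant_system \<phi> K
    using assms by unfold_locales
  show ?thesis using restoration_entropy_le restoration_entropy_ge by blast
qed

end
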